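(* Let $X$ be a finite dimensional CAT(0) cube complex and $\Gamma\le\mathrm{Aut}(X)$. The following are equivalent: (1) $\Gamma$ does not preserve any interval $\mathcal I\subset\overline X$ (i.e. there is no interval $\mathcal I$ with $\Gamma\cdot\mathcal I=\mathcal I$); (2) the $\Gamma$-action is Roller nonelementary; (3) $\Gamma$ contains a nonabelian free subgroup acting freely on $X$. Moreover these imply (4): the closure $\overline\Gamma$ of $\Gamma$ in $\mathrm{Aut}(X)$ is nonamenable; and if $X$ is locally compact then (4) implies (1), so all four are equivalent.
   Context: Conventions. $X$ is a finite-dimensional, second countable CAT(0) cube complex, identified with its vertex set and equipped with the combinatorial metric. A half-space is the set of vertices in one of the two complementary components of a hyperplane; $\mathfrak H$ is the set of half-spaces, $h^*=X\setminus h$. For $v\in X$, $U_v=\{h\in\mathfrak H:v\in h\}$; the Roller compactification $\overline X$ is the closure of $\{U_v:v\in X\}$ in $2^{\mathfrak H}$ (product topology), each $\xi\in\overline X$ being a subset $U_\xi\subset\mathfrak H$. For $v,w\in\overline X$, $\mathcal I(v,w)=\{m\in\overline X:U_v\cap U_w\subset U_m\}$; an interval of $\overline X$ is a set of this form. The action of $\Gamma$ is Roller nonelementary if every $\Gamma$-orbit in $\overline X$ is infinite. $\mathrm{Aut}(X)$ carries the topology of pointwise convergence on vertices. *)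

theory Defs
  imports Complex_Main "HOL-Library.Countable_Set"
begin

text \<open>A CAT(0) cube complex is encoded by its 1-skeleton, a median graph on the
vertex type 'v with adjacency relation adj; the combinatorial metric is the graph metric.\<close>

definition gpath :: "('v \<Rightarrow> 'v \<Rightarrow> bool) \<Rightarrow> 'v list \<Rightarrow> bool" where
  "gpath adj xs \<longleftrightarrow> xs \<noteq> [] \<and> (\<forall>i < length xs - 1. adj (xs ! i) (xs ! Suc i))"

definition connected_graph :: "('v \<Rightarrow> 'v \<Rightarrow> bool) \<Rightarrow> bool" where
  "connected_graph adj \<longleftrightarrow> (\<forall>x y. \<exists>xs. gpath adj xs \<and> hd xs = x \<and> last xs = y)"

definition gdist :: "('v \<Rightarrow> 'v \<Rightarrow> bool) \<Rightarrow> 'v \<Rightarrow> 'v \<Rightarrow> nat" where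
  "gdist adj x y = (LEAST n. \<exists>xs. gpath adj xs \<and> hd xs = x \<and> last xs = y \<and> length xs = Suc n)"

definition gint :: "('v \<Rightarrow> 'v \<Rightarrow> bool) \<Rightarrow> 'v \<Rightarrow> 'v \<Rightarrow> 'v set" where
  "gint adj x y = {m. gdist adj x m + gdist adj m y = gdist adj x y}"

definition median_graph :: "('v \<Rightarrow> 'v \<Rightarrow> bool) \<Rightarrow> bool" where
  "median_graph adj \<longleftrightarrow> (\<forall>x y. adj x y \<longleftrightarrow> adj y x) \<and> (\<forall>x. \<not> adj x x) \<and>
     connected_graph adj \<and>
     (\<forall>x y z. \<exists>!m. m \<in> gint adj x y \<and> m \<in> gint adj y z \<and> m \<in> gint adj x z)"

definition gconvex :: "('v \<Rightarrow> 'v \<Rightarrow> bool) \<Rightarrow> 'v set \<Rightarrow> bool" where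
  "gconvex adj C \<longleftrightarrow> (\<forall>x\<in>C. \<forall>y\<in>C. gint adj x y \<subseteq> C)"

definition halfspaces :: "('v \<Rightarrow> 'v \<Rightarrow> bool) \<Rightarrow> 'v set set" where
  "halfspaces adj = {h. h \<noteq> {} \<and> h \<noteq> UNIV \<and> gconvex adj h \<and> gconvex adj (- h)}"

definition transverse :: "'v set \<Rightarrow> 'v set \<Rightarrow> bool" where
  "transverse h k \<longleftrightarrow> h \<inter> k \<noteq> {} \<and> h \<inter> - k \<noteq> {} \<and> - h \<inter> k \<noteq> {} \<and> - h \<inter> - k \<noteq> {}"

definition finite_dim :: "('v \<Rightarrow> 'v \<Rightarrow> bool) \<Rightarrow> bool" where
  "finite_dim adj \<longleftrightarrow> (\<exists>N::nat. \<forall>S \<subseteq> halfspaces adj.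
      (\<forall>h\<in>S. \<forall>k\<in>S. h \<noteq> k \<longrightarrow> transverse h k) \<longrightarrow> finite S \<and> card S \<le> N)"

definition locally_finite :: "('v \<Rightarrow> 'v \<Rightarrow> bool) \<Rightarrow> bool" where
  "locally_finite adj \<longleftrightarrow> (\<forall>v. finite {w. adj v w})"

definition Uv :: "('v \<Rightarrow> 'v \<Rightarrow> bool) \<Rightarrow> 'v \<Rightarrow> 'v set set" where
  "Uv adj v = {h \<in> halfspaces adj. v \<in> h}"

text \<open>Roller compactification: closure of the U_v in the product topology on 2^H.\<close>
definition roller :: "('v \<Rightarrow> 'v \<Rightarrow> bool) \<Rightarrow> 'v set set set" where
  "roller adj = {\<xi>. \<xi> \<subseteq> halfspaces adj \<and>
     (\<forall>F. finite F \<and> F \<subseteq> halfspaces adj \<longrightarrow> (\<exists>v. Uv adj v \<inter> F = \<xi> \<inter> F))}"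

definition rinterval :: "('v \<Rightarrow> 'v \<Rightarrow> bool) \<Rightarrow> 'v set set \<Rightarrow> 'v set set \<Rightarrow> 'v set set set" where
  "rinterval adj a b = {m \<in> roller adj. a \<inter> b \<subseteq> m}"

definition is_interval :: "('v \<Rightarrow> 'v \<Rightarrow> bool) \<Rightarrow> 'v set set set \<Rightarrow> bool" where
  "is_interval adj I \<longleftrightarrow> (\<exists>a\<in>roller adj. \<exists>b\<in>roller adj. I = rinterval adj a b)"

definition ract :: "('v \<Rightarrow> 'v) \<Rightarrow> 'v set set \<Rightarrow> 'v set set" where
  "ract g \<xi> = (\<lambda>h. g ` h) ` \<xi>"

definition aut :: "('v \<Rightarrow> 'v \<Rightarrow> bool) \<Rightarrow> ('v \<Rightarrow> 'v) set" where
  "aut adj = {g. bij g \<and> (\<forall>x y. adj (g x) (g y) \<longleftrightarrow> adj x y)}"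

definition aut_subgroup :: "('v \<Rightarrow> 'v \<Rightarrow> bool) \<Rightarrow> ('v \<Rightarrow> 'v) set \<Rightarrow> bool" where
  "aut_subgroup adj \<Gamma> \<longleftrightarrow> \<Gamma> \<subseteq> aut adj \<and> id \<in> \<Gamma> \<and>
     (\<forall>g\<in>\<Gamma>. \<forall>h\<in>\<Gamma>. g \<circ> h \<in> \<Gamma>) \<and> (\<forall>g\<in>\<Gamma>. inv g \<in> \<Gamma>)"

definition roller_nonelementary :: "('v \<Rightarrow> 'v \<Rightarrow> bool) \<Rightarrow> ('v \<Rightarrow> 'v) set \<Rightarrow> bool" where
  "roller_nonelementary adj \<Gamma> \<longleftrightarrow> (\<forall>\<xi>\<in>roller adj. infinite ((\<lambda>g. ract g \<xi>) ` \<Gamma>))"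

definition preserves_interval :: "('v \<Rightarrow> 'v \<Rightarrow> bool) \<Rightarrow> ('v \<Rightarrow> 'v) set \<Rightarrow> bool" where
  "preserves_interval adj \<Gamma> \<longleftrightarrow> (\<exists>I. is_interval adj I \<and> (\<forall>g\<in>\<Gamma>. ract g ` I = I))"

definition word_eval :: "(('v \<Rightarrow> 'v) \<times> bool) list \<Rightarrow> 'v \<Rightarrow> 'v" where
  "word_eval w = foldr (\<lambda>(s, b) acc. (if b then s else inv s) \<circ> acc) w id"

definition reduced_word :: "(('a \<times> bool)) list \<Rightarrow> bool" where
  "reduced_word w \<longleftrightarrow> (\<forall>i < length w - 1.
      \<not> (fst (w ! i) = fst (w ! Suc i) \<and> snd (w ! i) \<noteq> snd (w ! Suc i)))"

definition has_free_nonabelian_free_action :: "('v \<Rightarrow> 'v) set \<Rightarrow> bool" where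
  "has_free_nonabelian_free_action \<Gamma> \<longleftrightarrow> (\<exists>S \<subseteq> \<Gamma>. (\<exists>s\<in>S. \<exists>t\<in>S. s \<noteq> t) \<and>
     (\<forall>w. w \<noteq> [] \<and> set (map fst w) \<subseteq> S \<and> reduced_word w \<longrightarrow> word_eval w \<noteq> id) \<and>
     (\<forall>w. set (map fst w) \<subseteq> S \<and> word_eval w \<noteq> id \<longrightarrow> (\<forall>v. word_eval w v \<noteq> v)))"

text \<open>Closure of Gamma in Aut(X) for the topology of pointwise convergence on vertices.\<close>
definition aut_closure :: "('v \<Rightarrow> 'v \<Rightarrow> bool) \<Rightarrow> ('v \<Rightarrow> 'v) set \<Rightarrow> ('v \<Rightarrow> 'v) set" where
  "aut_closure adj \<Gamma> = {g \<in> aut adj. \<forall>F. finite F \<longrightarrow> (\<exists>\<gamma>\<in>\<Gamma>. \<forall>p\<in>F. \<gamma> p = g p)}"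

text \<open>Bounded right uniformly continuous functions on a group G of permutations with the
pointwise-convergence topology (identity neighbourhoods = pointwise stabilisers of finite sets).\<close>
definition ruc :: "('v \<Rightarrow> 'v) set \<Rightarrow> (('v \<Rightarrow> 'v) \<Rightarrow> real) \<Rightarrow> bool" where
  "ruc G f \<longleftrightarrow> (\<exists>B. \<forall>x\<in>G. \<bar>f x\<bar> \<le> B) \<and>
     (\<forall>\<epsilon>>0. \<exists>F. finite F \<and>
        (\<forall>x\<in>G. \<forall>v\<in>G. (\<forall>p\<in>F. v p = p) \<longrightarrow> \<bar>f (v \<circ> x) - f x\<bar> < \<epsilon>))"

definition amenable_perm_group :: "('v \<Rightarrow> 'v) set \<Rightarrow> bool" where
  "amenable_perm_group G \<longleftrightarrow> (\<exists>m :: (('v \<Rightarrow> 'v) \<Rightarrow> real) \<Rightarrow> real.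
     (\<forall>f g a b. ruc G f \<and> ruc G g \<longrightarrow> m (\<lambda>x. a * f x + b * g x) = a * m f + b * m g) \<and>
     m (\<lambda>_. 1) = 1 \<and>
     (\<forall>f. ruc G f \<and> (\<forall>x\<in>G. 0 \<le> f x) \<longrightarrow> 0 \<le> m f) \<and>
     (\<forall>f h. ruc G f \<and> h \<in> G \<longrightarrow> m (\<lambda>x. f (h \<circ> x)) = m f))"

end

theory Submission
  imports Defs "HOL-Analysis.Elementary_Normed_Spaces" "HOL-Analysis.Infinite_Sum"
    "HOL-Real_Asymp.Real_Asymp"
begin

text \<open>Let \<open>W\<close> be a \<open>\<Gamma>\<close>-invariant family of pairwise intersecting half-spaces. The points of the
  Roller compactification containing \<open>W\<close> form an interval as soon as the half-spaces undecided by
  \<open>W\<close> fall into classes such that nested half-spaces share a class and complementary ones do not.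
  For an invariant mean on the compactification this applies to the half-spaces of measure more
  than \<open>1/2\<close>, the classes being taken modulo null sets; hence a finite orbit, or amenability of the
  closure of \<open>\<Gamma>\<close>, yields an invariant interval. Conversely an interval has finitely many corners in
  finite dimension, so an invariant interval yields a finite orbit.

  If no interval is invariant, take \<open>W\<close> maximal. Maximality says exactly that every undecided
  half-space can be flipped. A facing triple then provides two elements playing ping-pong on four
  disjoint half-spaces; without facing triples, having a common lower bound is an equivalence
  relation on undecided half-spaces and the criterion above gives an interval.

  If a free group \<open>\<langle>s, t\<rangle>\<close> acts freely and \<open>\<xi>\<close> has a finite orbit, a positive word \<open>w\<close> is determined
  by the median \<open>m\<close> of \<open>x\<close>, \<open>w x\<close>, \<open>\<xi>\<close> together with \<open>w\<inverse> m\<close>. Both lie in balls of intervals from \<open>x\<close>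
  to points of the orbit, which grow polynomially, whereas there are \<open>2 ^ n\<close> words of length \<open>n\<close>.

  For locally compact \<open>X\<close> and a finite orbit, the probability measures
  \<open>z ^ d x v * (1 - z) ^ c\<close> on the vertices \<open>v\<close> between \<open>x\<close> and \<open>\<xi>\<close>, where \<open>c\<close> counts the hyperplanes
  adjacent to \<open>v\<close> on the side of \<open>\<xi>\<close>, become invariant as \<open>z \<longrightarrow> 1\<close>; averaging means
  invariant under vertex stabilisers against them gives an invariant mean.\<close>

section \<open>Median graphs and half-spaces\<close>

text \<open>An interval enters only through \<open>a \<inter> b\<close>, the intersection of all its
  members: invariance of the interval is invariance of this family of half-spaces, so the end points
  may be chosen without any equivariance. Helly's property does the work of compactness, since it
  turns every consistent choice of sides into a point of the Roller compactification. The dimension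
  mostly enters through antichains: half-spaces on the side of \<xi> that miss \<open>x\<close> are
  nested or transverse, so those without inclusions are boundedly many. Means are evaluated only on
  functions of finitely many half-spaces; these pull back to uniformly continuous functions on the
  closure of the group because a half-space is determined by any edge crossing its wall. The
  exponent of \<open>1 - z\<close> in the weights makes their total mass exactly 1 for every base
  point. Together with a pointwise comparison of the weights of two neighbours this bounds the total
  change along an edge by \<open>2 * (1 - z)\<close>.\<close>

lemma gpath_iff_relpowp:
  "(\<exists>xs. gpath adj xs \<and> hd xs = x \<and> last xs = y \<and> length xs = Suc n) \<longleftrightarrow> (adj ^^ n) x y"
proof (induction n arbitrary: x)
  case 0
  show ?case
  proof
    assume "(adj ^^ 0) x y"
    then show "\<exists>xs. gpath adj xs \<and> hd xs = x \<and> last xs = y \<and> length xs = Suc 0"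
      by (intro exI[of _ "[x]"]) (auto simp: gpath_def)
  qed (auto simp: length_Suc_conv)
next
  case (Suc n)
  show ?case
  proof
    assume "\<exists>xs. gpath adj xs \<and> hd xs = x \<and> last xs = y \<and> length xs = Suc (Suc n)"
    then obtain xs where xs: "gpath adj xs" "hd xs = x" "last xs = y" "length xs = Suc (Suc n)"
      by blast
    then obtain z zs where zs: "xs = x # z # zs"
      by (metis length_Suc_conv list.sel(1))
    have "adj x z" "gpath adj (z # zs)"
      using xs(1) unfolding gpath_def zs by force+
    moreover have "\<exists>ys. gpath adj ys \<and> hd ys = z \<and> last ys = y \<and> length ys = Suc n"
      using xs zs calculation by (intro exI[of _ "z # zs"]) auto
    ultimately show "(adj ^^ Suc n) x y"
      using Suc.IH relpowp_Suc_I2 by metis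
  next
    assume "(adj ^^ Suc n) x y"
    then obtain z where z: "adj x z" "(adj ^^ n) z y"
      by (meson relpowp_Suc_D2)
    then obtain ys where ys: "gpath adj ys" "hd ys = z" "last ys = y" "length ys = Suc n"
      using Suc.IH by blast
    have "gpath adj (x # ys)"
      unfolding gpath_def
    proof (intro conjI allI impI)
      fix i assume "i < length (x # ys) - 1"
      then show "adj ((x # ys) ! i) ((x # ys) ! Suc i)"
        using ys z by (cases i) (auto simp: gpath_def hd_conv_nth)
    qed auto
    then show "\<exists>xs. gpath adj xs \<and> hd xs = x \<and> last xs = y \<and> length xs = Suc (Suc n)"
      using ys by (intro exI[of _ "x # ys"]) auto
  qed
qed

lemma gdist_eq_Least: "gdist adj x y = (LEAST n. (adj ^^ n) x y)"
  unfolding gdist_def gpath_iff_relpowp ..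

locale median_gr =
  fixes adj :: "'v \<Rightarrow> 'v \<Rightarrow> bool"
  assumes median_graph: "median_graph adj"
begin

abbreviation d :: "'v \<Rightarrow> 'v \<Rightarrow> nat" where "d \<equiv> gdist adj"
abbreviation H :: "'v set set" where "H \<equiv> halfspaces adj"
abbreviation U :: "'v \<Rightarrow> 'v set set" where "U \<equiv> Uv adj"

lemma adj_sym: "adj x y \<longleftrightarrow> adj y x"
  and adj_irrefl: "\<not> adj x x"
  using median_graph by (auto simp: median_graph_def)

lemma d_walk: "(adj ^^ d x y) x y"
proof -
  obtain xs where xs: "gpath adj xs" "hd xs = x" "last xs = y"
    using median_graph unfolding median_graph_def connected_graph_def by blast
  then have "length xs = Suc (length xs - 1)"
    by (simp add: gpath_def)
  then have "(adj ^^ (length xs - 1)) x y"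
    using xs gpath_iff_relpowp by metis
  then show ?thesis
    unfolding gdist_eq_Least by (rule LeastI)
qed

lemma d_le: "(adj ^^ n) x y \<Longrightarrow> d x y \<le> n"
  unfolding gdist_eq_Least by (rule Least_le)

lemma d_self [simp]: "d x x = 0"
  using d_le[of 0 x x] by simp

lemma d_eq_0 [simp]: "d x y = 0 \<longleftrightarrow> x = y"
  using d_walk[of x y] by auto

lemma relpowp_adj_sym: "(adj ^^ n) x y \<Longrightarrow> (adj ^^ n) y x"
proof (induction n arbitrary: x)
  case (Suc n)
  then obtain z where "adj x z" "(adj ^^ n) z y" by (meson relpowp_Suc_D2)
  then have "(adj ^^ n) y z" "adj z x" using Suc.IH adj_sym by blast+
  then show ?case by (rule relpowp_Suc_I)
qed auto

lemma d_sym: "d x y = d y x"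
  by (rule le_antisym; rule d_le[OF relpowp_adj_sym[OF d_walk]])

lemma d_triangle: "d x z \<le> d x y + d y z"
proof -
  have "(adj ^^ (d x y + d y z)) x z"
    unfolding relpowp_add using d_walk by blast
  then show ?thesis by (rule d_le)
qed

lemma d_eq_1: "d x y = 1 \<longleftrightarrow> adj x y"
proof
  assume "d x y = 1"
  then show "adj x y" using d_walk[of x y] by auto
next
  assume "adj x y"
  then have "d x y \<le> 1" "d x y \<noteq> 0"
    using d_le[of 1 x y] adj_irrefl by auto
  then show "d x y = 1" by linarith
qed

lemma d_step:
  assumes "x \<noteq> y"
  obtains x' where "adj x x'" "d x y = Suc (d x' y)"
proof -
  obtain n where n: "d x y = Suc n"
    using assms d_eq_0 not0_implies_Suc by blast
  then have "(adj ^^ Suc n) x y"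
    using d_walk[of x y] by simp
  then obtain x' where x': "adj x x'" "(adj ^^ n) x' y"
    by (meson relpowp_Suc_D2)
  have "d x' y \<le> n" using x' d_le by blast
  moreover have "d x y \<le> 1 + d x' y"
    using d_triangle[of x y x'] x' d_eq_1 by metis
  ultimately show thesis using that[OF x'(1)] n by linarith
qed

lemma median_ex1: "\<exists>!m. m \<in> gint adj x y \<and> m \<in> gint adj y z \<and> m \<in> gint adj x z"
  using median_graph by (simp add: median_graph_def)

lemma gint_iff: "m \<in> gint adj x y \<longleftrightarrow> d x m + d m y = d x y"
  by (simp add: gint_def)

lemma gint_sym: "gint adj x y = gint adj y x"
  by (auto simp: gint_def d_sym add.commute)

text \<open>Median graphs are bipartite: the median of \<open>u\<close>, \<open>v\<close> and
  \<open>z\<close> lies on the edge, so it is one of its ends, and the other end is one step farther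
  from \<open>z\<close>.\<close>

lemma d_adj_neq:
  assumes "adj u v"
  shows "d z u = Suc (d z v) \<or> d z v = Suc (d z u)"
proof -
  obtain m where m: "m \<in> gint adj u v" "m \<in> gint adj v z" "m \<in> gint adj u z"
    using median_ex1 by metis
  have "d u v = 1" using assms d_eq_1 by blast
  then have "d u m = 0 \<or> d m v = 0"
    using m(1) unfolding gint_iff by linarith
  then show ?thesis
    using m \<open>d u v = 1\<close> by (auto simp: gint_iff d_sym)
qed

section \<open>Walls: the two sides of an edge\<close>

definition side :: "'v \<Rightarrow> 'v \<Rightarrow> 'v set" where
  "side u v = {z. d z u < d z v}"

lemma side_compl: "adj u v \<Longrightarrow> - side u v = side v u"
proof (rule set_eqI)
  fix z assume "adj u v"
  then show "z \<in> - side u v \<longleftrightarrow> z \<in> side v u"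
    using d_adj_neq[of u v z] by (auto simp: side_def)
qed

lemma side_refl: "adj u v \<Longrightarrow> u \<in> side u v" "adj u v \<Longrightarrow> v \<notin> side u v"
  using d_eq_1[of u v] by (auto simp: side_def)

lemma sideD: "adj u v \<Longrightarrow> z \<in> side u v \<Longrightarrow> d z v = Suc (d z u)"
  using d_adj_neq[of u v z] by (auto simp: side_def)

lemma gint_side_subset:
  assumes "adj u v" "x \<in> side u v" "t \<in> gint adj x u"
  shows "t \<in> side u v"
  using sideD[OF assms(1,2)] assms(3) d_triangle[of x v t] by (auto simp: side_def gint_iff)

text \<open>On \<open>side u v\<close> a geodesic to \<open>u\<close> extends by the edge to a
  geodesic to \<open>v\<close>. Hence the median of \<open>x\<close>, \<open>y\<close> and
  \<open>u\<close> is also a median of \<open>x\<close>, \<open>y\<close> and \<open>v\<close>, and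
  uniqueness identifies it with \<open>m\<close>.\<close>

lemma median_side_eq:
  assumes "adj u v" "x \<in> side u v" "y \<in> side u v"
    and "m \<in> gint adj x y" "m \<in> gint adj x v" "m \<in> gint adj y v"
  shows "m \<in> gint adj x u"
proof -
  obtain q where q: "q \<in> gint adj x y" "q \<in> gint adj y u" "q \<in> gint adj x u"
    using median_ex1 by metis
  have uv: "d u v = 1" using assms(1) d_eq_1 by blast
  have "q \<in> gint adj x v" "q \<in> gint adj y v"
    using q sideD[OF assms(1,2)] sideD[OF assms(1,3)] uv
      d_triangle[of q v u] d_triangle[of x v q] d_triangle[of y v q]
    by (auto simp: gint_iff)
  then have "q = m"
    using q assms(4-6) median_ex1 by (metis gint_sym)
  then show ?thesis using q by simp
qed

text \<open>In a shortest counterexample the geodesic from \<open>x\<close> to \<open>y\<close> through \<open>z\<close> leaves \<open>side u v\<close> at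
  its first edge and reenters at its last; the median of the inner end points with \<open>v\<close> is then
  the median of \<open>x\<close>, \<open>y\<close> and \<open>v\<close>, but it lies on the wrong side.\<close>

lemma gconvex_side:
  assumes uv: "adj u v"
  shows "gconvex adj (side u v)"
proof -
  have "z \<in> side u v" if "x \<in> side u v" "y \<in> side u v" "z \<in> gint adj x y" for x y z
    using that
  proof (induction "d x y" arbitrary: x y rule: less_induct)
    case less
    have xyz: "d x z + d z y = d x y" using less.prems by (simp add: gint_iff)
    show ?case
    proof (rule ccontr)
      assume z: "z \<notin> side u v"
      then have "x \<noteq> z" "y \<noteq> z" using less.prems by auto
      obtain x' where x': "adj x x'" "d x z = Suc (d x' z)" using d_step[OF \<open>x \<noteq> z\<close>] by blast
      obtain y' where y': "adj y y'" "d y z = Suc (d y' z)" using d_step[OF \<open>y \<noteq> z\<close>] by blast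
      have dx: "d x x' = 1" "d x' x = 1" and dy: "d y y' = 1" "d y' y = 1"
        using x' y' d_eq_1 adj_sym by blast+
      have zy: "d z y = Suc (d z y')" using y' by (simp add: d_sym)
      have x'y: "d x y = Suc (d x' y)" "d x' z + d z y = d x' y"
        using xyz x'(2) d_triangle[of x y x'] d_triangle[of x' y z] dx by auto
      have xy': "d x y = Suc (d x y')" "d x z + d z y' = d x y'"
        using xyz zy d_triangle[of x y y'] d_triangle[of x y' z] dy by auto
      have x'y': "d x y = Suc (Suc (d x' y'))"
        using xyz x'(2) zy d_triangle[of x' y y'] d_triangle[of x' y' z] dy x'y by auto
      have "x' \<notin> side u v"
        using less.hyps[of x' y] x'y less.prems(2) z by (auto simp: gint_iff)
      then have x's: "x' \<in> side v u" using side_compl[OF uv] by auto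
      have "y' \<notin> side u v"
        using less.hyps[of x y'] xy' less.prems(1) z by (auto simp: gint_iff)
      then have y's: "y' \<in> side v u" using side_compl[OF uv] by auto
      have vu: "adj v u" using uv adj_sym by blast
      have e1: "d x' v = d x u"
        using sideD[OF uv less.prems(1)] sideD[OF vu x's] dx
          d_triangle[of x v x'] d_triangle[of x' u x] by linarith
      have e2: "d y' v = d y u"
        using sideD[OF uv less.prems(2)] sideD[OF vu y's] dy
          d_triangle[of y v y'] d_triangle[of y' u y] by linarith
      obtain r where r: "r \<in> gint adj x' y'" "r \<in> gint adj y' v" "r \<in> gint adj x' v"
        using median_ex1 by metis
      have rs: "r \<in> side v u" using gint_side_subset[OF vu x's r(3)] .
      have r': "d x' r + d r y' = d x' y'" "d x' r + d r v = d x u" "d y' r + d r v = d y u"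
        using r e1 e2 by (auto simp: gint_iff)
      have t: "d x r \<le> 1 + d x' r" "d y r \<le> 1 + d y' r" "d x y \<le> d x r + d r y"
        using d_triangle[of x r x'] d_triangle[of y r y'] d_triangle[of x y r] dx dy by auto
      have "d x v \<le> d x r + d r v" "d y v \<le> d y r + d r v" by (rule d_triangle)+
      then have "r \<in> gint adj x y" "r \<in> gint adj x v" "r \<in> gint adj y v"
        using r' t x'y' sideD[OF uv less.prems(1)] sideD[OF uv less.prems(2)]
          d_sym[of r y'] d_sym[of r y]
        unfolding gint_iff by linarith+
      then have "r \<in> gint adj x u"
        using median_side_eq[OF uv less.prems(1,2)] by blast
      then have "r \<in> side u v"
        using gint_side_subset[OF uv less.prems(1)] by blast
      then show False using rs side_compl[OF uv] by blast
    qed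
  qed
  then show ?thesis unfolding gconvex_def by blast
qed

lemma side_halfspace: "adj u v \<Longrightarrow> side u v \<in> H"
  using gconvex_side side_refl side_compl adj_sym by (fastforce simp: halfspaces_def)

lemma halfspace_compl: "- h \<in> H \<longleftrightarrow> h \<in> H"
  by (auto simp: halfspaces_def)

lemma halfspace_convex: "h \<in> H \<Longrightarrow> x \<in> h \<Longrightarrow> y \<in> h \<Longrightarrow> z \<in> gint adj x y \<Longrightarrow> z \<in> h"
  by (auto simp: halfspaces_def gconvex_def)

text \<open>For \<open>z\<close> in \<open>side u v\<close> the vertex \<open>u\<close> lies on a
  geodesic from \<open>z\<close> to \<open>v\<close>; were \<open>z\<close> in the convex complement
  of \<open>h\<close>, so would be \<open>u\<close>. The reversed edge gives the other
  inclusion.\<close>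

lemma halfspace_eq_side:
  assumes "adj u v" "h \<in> H" "u \<in> h" "v \<notin> h"
  shows "h = side u v"
proof -
  have sub: "side u v \<subseteq> h" if "adj u v" "h \<in> H" "u \<in> h" "v \<notin> h" for u v h
  proof
    fix z assume "z \<in> side u v"
    then have "u \<in> gint adj z v"
      using sideD[OF that(1), of z] d_eq_1[of u v] that(1) by (simp add: gint_iff)
    then show "z \<in> h"
      using halfspace_convex[of "- h" z v u] that halfspace_compl[of h] by blast
  qed
  have "side v u \<subseteq> - h"
    using sub[of v u "- h"] assms adj_sym halfspace_compl[of h] by blast
  then show ?thesis
    using sub[OF assms] side_compl[OF assms(1)] by blast
qed

text \<open>The first edge of a geodesic crosses one wall, which the rest does not cross again;
  every other wall between \<open>x\<close> and \<open>y\<close> still separates the next vertex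
  from \<open>y\<close>.\<close>

lemma sep_card: "finite {h \<in> H. x \<in> h \<and> y \<notin> h} \<and> card {h \<in> H. x \<in> h \<and> y \<notin> h} = d x y"
proof (induction "d x y" arbitrary: x)
  case 0
  then show ?case by simp
next
  case (Suc n)
  then have "x \<noteq> y" by auto
  then obtain x' where x': "adj x x'" "d x y = Suc (d x' y)" using d_step by blast
  have ix: "x' \<in> gint adj x y" using x' d_eq_1[of x x'] by (simp add: gint_iff)
  let ?S = "{h \<in> H. x' \<in> h \<and> y \<notin> h}"
  have S: "finite ?S" "card ?S = d x' y"
    using Suc.hyps(1)[of x'] Suc.hyps(2) x'(2) by auto
  have y: "y \<notin> side x x'"
    using x'(2) by (simp add: side_def d_sym)
  have "{h \<in> H. x \<in> h \<and> y \<notin> h} = insert (side x x') ?S"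
  proof (intro equalityI subsetI)
    fix h assume "h \<in> {h \<in> H. x \<in> h \<and> y \<notin> h}"
    then show "h \<in> insert (side x x') ?S"
      using halfspace_eq_side[OF x'(1)] by blast
  next
    fix h assume "h \<in> insert (side x x') ?S"
    then show "h \<in> {h \<in> H. x \<in> h \<and> y \<notin> h}"
    proof
      assume "h = side x x'"
      then show ?thesis using side_halfspace[OF x'(1)] side_refl[OF x'(1)] y by blast
    next
      assume "h \<in> ?S"
      then show ?thesis
        using halfspace_convex[of "- h" x y x'] ix halfspace_compl[of h] by blast
    qed
  qed
  moreover have "side x x' \<notin> ?S" using side_refl[OF x'(1)] by blast
  ultimately show ?case using S x'(2) by simp
qed

lemma finite_sep: "finite {h \<in> H. x \<in> h \<and> y \<notin> h}"
  using sep_card by blast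

lemma U_diff: "U x - U y = {h \<in> H. x \<in> h \<and> y \<notin> h}"
  by (auto simp: Uv_def)

lemma finite_U_diff: "finite (U x - U y)"
  and card_U_diff: "card (U x - U y) = d x y"
  using sep_card unfolding U_diff by auto

lemma U_sub: "U x \<subseteq> H" by (auto simp: Uv_def)

lemma U_compl: "h \<in> H \<Longrightarrow> - h \<in> U x \<longleftrightarrow> h \<notin> U x"
  using halfspace_compl by (auto simp: Uv_def)

lemma U_inj: "U x = U y \<longleftrightarrow> x = y"
  using card_U_diff[of x y] by auto

lemma halfspace_nonempty: "h \<in> H \<Longrightarrow> h \<noteq> {}" "h \<in> H \<Longrightarrow> - h \<noteq> {}"
  by (auto simp: halfspaces_def)

section \<open>Helly's theorem for convex sets\<close>

lemma median_in_convex: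
  assumes "gconvex adj A" "gconvex adj B" "gconvex adj C"
    and "x \<in> A \<inter> B" "y \<in> B \<inter> C" "z \<in> A \<inter> C"
  shows "A \<inter> B \<inter> C \<noteq> {}"
proof -
  obtain m where "m \<in> gint adj x y" "m \<in> gint adj y z" "m \<in> gint adj x z"
    using median_ex1 by metis
  then have "m \<in> A" "m \<in> B" "m \<in> C" using assms unfolding gconvex_def by blast+
  then show ?thesis by blast
qed

lemma gconvex_Int: "gconvex adj A \<Longrightarrow> gconvex adj B \<Longrightarrow> gconvex adj (A \<inter> B)"
  unfolding gconvex_def by blast

text \<open>Two of the sets are replaced by their intersection; the case of three sets, settled by a
  median, shows that the smaller family still meets pairwise.\<close>

lemma helly_convex:
  assumes "finite S" "S \<noteq> {}" "\<forall>A\<in>S. gconvex adj A" "\<forall>A\<in>S. \<forall>B\<in>S. A \<inter> B \<noteq> {}"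
  shows "\<Inter>S \<noteq> {}"
  using assms
proof (induction "card S" arbitrary: S rule: less_induct)
  case less
  show ?case
  proof (cases "\<exists>A B. A \<in> S \<and> B \<in> S \<and> A \<noteq> B")
    case False
    then obtain A where "S = {A}" using less.prems(2) by blast
    then show ?thesis using less.prems by blast
  next
    case True
    then obtain A B where AB: "A \<in> S" "B \<in> S" "A \<noteq> B" by blast
    let ?S = "insert (A \<inter> B) (S - {A, B})"
    have "card ?S \<le> Suc (card (S - {A, B}))" by (rule card_insert_le_m1) auto
    also have "card (S - {A, B}) = card S - 2"
      using AB less.prems(1) by (subst card_Diff_subset) auto
    also have "card S \<ge> 2"
      using AB less.prems(1) card_mono[of S "{A, B}"] by auto
    then have "Suc (card S - 2) < card S" by linarith
    finally have "card ?S < card S" .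
    moreover have "\<forall>C\<in>?S. \<forall>D\<in>?S. C \<inter> D \<noteq> {}"
    proof -
      have "A \<inter> B \<inter> C \<noteq> {}" if C: "C \<in> S" for C
      proof -
        have "A \<inter> B \<noteq> {}" "B \<inter> C \<noteq> {}" "A \<inter> C \<noteq> {}"
          using less.prems(4) AB C by auto
        then show ?thesis
          using median_in_convex[of A B C] less.prems(3) AB C by blast
      qed
      moreover have "A \<inter> B \<noteq> {}" using less.prems(4) AB by auto
      ultimately show ?thesis using less.prems(4) by blast
    qed
    ultimately have "\<Inter>?S \<noteq> {}"
      using less.hyps[of ?S] less.prems AB gconvex_Int by simp
    moreover have "\<Inter>?S = \<Inter>S" using AB by auto
    ultimately show ?thesis by argo
  qed
qed

lemma helly:
  assumes "finite S" "S \<subseteq> H" "\<forall>h\<in>S. \<forall>k\<in>S. h \<inter> k \<noteq> {}"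
  shows "\<Inter>S \<noteq> {}"
  using helly_convex[OF assms(1)] assms by (cases "S = {}") (auto simp: halfspaces_def)

section \<open>Roller points as consistent orientations\<close>

lemma roller_approx:
  assumes "\<xi> \<in> roller adj" "finite F" "F \<subseteq> H"
  obtains v where "U v \<inter> F = \<xi> \<inter> F"
  using assms unfolding roller_def by (elim CollectE conjE allE[of _ F]) blast

text \<open>Membership in the closure is tested on finite sets of half-spaces, and there Helly's
  theorem supplies a vertex as soon as the chosen sides meet pairwise.\<close>

lemma roller_iff:
  "\<xi> \<in> roller adj \<longleftrightarrow> \<xi> \<subseteq> H \<and> (\<forall>h\<in>H. - h \<in> \<xi> \<longleftrightarrow> h \<notin> \<xi>) \<and> (\<forall>h\<in>\<xi>. \<forall>k\<in>\<xi>. h \<inter> k \<noteq> {})"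
proof safe
  fix h assume xi: "\<xi> \<in> roller adj"
  then show "h \<in> \<xi> \<Longrightarrow> h \<in> H" by (auto simp: roller_def)
  assume h: "h \<in> H"
  then have "finite {h, - h}" "{h, - h} \<subseteq> H" using halfspace_compl by auto
  then obtain v where v: "U v \<inter> {h, - h} = \<xi> \<inter> {h, - h}"
    by (rule roller_approx[OF xi])
  show "- h \<in> \<xi> \<Longrightarrow> h \<in> \<xi> \<Longrightarrow> False" "h \<notin> \<xi> \<Longrightarrow> - h \<in> \<xi>"
    using U_compl[OF h, of v] v by blast+
next
  fix h k assume xi: "\<xi> \<in> roller adj" and hk: "h \<in> \<xi>" "k \<in> \<xi>" "h \<inter> k = {}"
  then have "finite {h, k}" "{h, k} \<subseteq> H" by (auto simp: roller_def)
  then obtain v where v: "U v \<inter> {h, k} = \<xi> \<inter> {h, k}"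
    by (rule roller_approx[OF xi])
  then have "v \<in> h \<inter> k" using hk by (auto simp: Uv_def)
  then show False using hk by blast
next
  assume xi: "\<xi> \<subseteq> H" "\<forall>h\<in>H. - h \<in> \<xi> \<longleftrightarrow> h \<notin> \<xi>" "\<forall>h\<in>\<xi>. \<forall>k\<in>\<xi>. h \<inter> k \<noteq> {}"
  have "\<exists>v. U v \<inter> F = \<xi> \<inter> F" if F: "finite F" "F \<subseteq> H" for F
  proof -
    \<comment> \<open>Complements are included so that the vertex also avoids those members of
      \<open>F\<close> that are not in \<xi>.\<close>
    let ?S = "(F \<union> uminus ` F) \<inter> \<xi>"
    have "finite ?S" "?S \<subseteq> H" "\<forall>h\<in>?S. \<forall>k\<in>?S. h \<inter> k \<noteq> {}"
      using F(1) xi(1,3) by auto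
    then have "\<Inter>?S \<noteq> {}" by (rule helly)
    then obtain v where "v \<in> \<Inter>?S" by auto
    then have v: "\<forall>h\<in>?S. v \<in> h" by blast
    have "U v \<inter> F = \<xi> \<inter> F"
    proof (intro equalityI subsetI)
      fix h assume h: "h \<in> U v \<inter> F"
      then have "- h \<notin> \<xi>" using v by (auto simp: Uv_def)
      then show "h \<in> \<xi> \<inter> F" using h xi(2) F by blast
    next
      fix h assume "h \<in> \<xi> \<inter> F"
      then show "h \<in> U v \<inter> F" using v F by (auto simp: Uv_def)
    qed
    then show ?thesis by blast
  qed
  then show "\<xi> \<in> roller adj" unfolding roller_def using xi(1) by blast
qed

lemma rollerD:
  assumes "\<xi> \<in> roller adj"
  shows "\<xi> \<subseteq> H" "h \<in> H \<Longrightarrow> - h \<in> \<xi> \<longleftrightarrow> h \<notin> \<xi>" "h \<in> \<xi> \<Longrightarrow> k \<in> \<xi> \<Longrightarrow> h \<inter> k \<noteq> {}"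
  using assms unfolding roller_iff by blast+

lemma roller_up:
  assumes "\<xi> \<in> roller adj" "h \<in> \<xi>" "h \<subseteq> k" "k \<in> H"
  shows "k \<in> \<xi>"
  using rollerD(2)[OF assms(1,4)] rollerD(3)[OF assms(1,2), of "- k"] assms(3) by blast

lemma U_roller: "U v \<in> roller adj"
  unfolding roller_iff using U_sub U_compl by (auto simp: Uv_def)

text \<open>The vertex is the point of \<open>\<Inter>(\<eta> - U x)\<close> nearest to \<open>x\<close>.\<close>

lemma roller_finite_diff_vertex:
  assumes eta: "\<eta> \<in> roller adj" and fin: "finite (\<eta> - U x)"
  obtains v where "\<eta> = U v"
proof -
  let ?K = "\<Inter>(\<eta> - U x)"
  have "?K \<noteq> {}"
    using helly[of "\<eta> - U x"] fin rollerD[OF eta] by blast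
  then obtain v0 where "v0 \<in> ?K" by blast
  then obtain v where v: "v \<in> ?K" "\<And>w. w \<in> ?K \<Longrightarrow> d x v \<le> d x w"
    using exists_least_iff[of "\<lambda>n. \<exists>w\<in>?K. d x w = n"] by (metis linorder_not_less)
  have "U v - U x \<subseteq> \<eta>"
  proof
    fix h assume h: "h \<in> U v - U x"
    then have hH: "h \<in> H" "v \<in> h" "x \<notin> h" by (auto simp: Uv_def)
    show "h \<in> \<eta>"
    proof (rule ccontr)
      assume "h \<notin> \<eta>"
      then have "- h \<in> \<eta>" using rollerD(2)[OF eta hH(1)] by blast
      then have "\<Inter>(insert (- h) (\<eta> - U x)) \<noteq> {}"
        using helly[of "insert (- h) (\<eta> - U x)"] fin rollerD[OF eta] by blast
      then obtain z where z: "z \<in> ?K" "z \<notin> h" by auto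
      \<comment> \<open>With \<open>v\<close> and \<open>z\<close> also \<open>m\<close> lies in
        \<open>?K\<close>, and it is no farther from \<open>x\<close> than the nearest point
        \<open>v\<close>; so \<open>m = v\<close>. But \<open>m\<close> lies outside
        \<open>h\<close>, as do \<open>x\<close> and \<open>z\<close>.\<close>
      obtain m where m: "m \<in> gint adj x v" "m \<in> gint adj v z" "m \<in> gint adj x z"
        using median_ex1 by metis
      have "m \<in> ?K" using v(1) z(1) m(2) halfspace_convex rollerD(1)[OF eta] by blast
      then have "d x v \<le> d x m" using v(2) by blast
      then have "m = v" using m(1) d_eq_0[of m v] unfolding gint_iff by linarith
      moreover have "m \<in> - h"
        using halfspace_convex[of "- h" x z m] hH z(2) m(3) halfspace_compl by blast
      ultimately show False using hH by blast
    qed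
  qed
  moreover have "\<eta> - U x \<subseteq> U v" using v(1) rollerD(1)[OF eta] by (auto simp: Uv_def)
  ultimately have eq: "h \<in> \<eta> \<longleftrightarrow> h \<in> U v" if "h \<notin> U x" for h using that by blast
  have "h \<in> \<eta> \<longleftrightarrow> h \<in> U v" for h
  proof (cases "h \<in> U x")
    case True
    then have "h \<in> H" "- h \<notin> U x" using U_compl U_sub by blast+
    then show ?thesis using eq[of "- h"] rollerD(2)[OF eta] U_compl by blast
  qed (use eq in auto)
  then show thesis using that by blast
qed

lemma nested_or_transverse:
  assumes "h \<inter> k \<noteq> {}" "- h \<inter> - k \<noteq> {}"
  shows "h \<subseteq> k \<or> k \<subseteq> h \<or> transverse h k"
  using assms unfolding transverse_def by blast

end

context median_gr
begin

section \<open>Automorphisms acting on half-spaces and Roller points\<close>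

lemma autD:
  assumes "g \<in> aut adj"
  shows "bij g" "adj (g x) (g y) \<longleftrightarrow> adj x y"
  using assms by (auto simp: aut_def)

lemma aut_id: "id \<in> aut adj"
  by (auto simp: aut_def)

lemma aut_comp: "g \<in> aut adj \<Longrightarrow> h \<in> aut adj \<Longrightarrow> g \<circ> h \<in> aut adj"
  by (auto simp: aut_def bij_comp)

lemma inv_cancel:
  assumes "bij g"
  shows "g (inv g x) = x" "inv g (g x) = x"
  using assms by (simp_all add: bij_is_surj surj_f_inv_f bij_is_inj)

lemma aut_inv:
  assumes "g \<in> aut adj"
  shows "inv g \<in> aut adj"
proof -
  have "adj (inv g x) (inv g y) \<longleftrightarrow> adj x y" for x y
    using autD(2)[OF assms, of "inv g x" "inv g y"] inv_cancel(1)[OF autD(1)[OF assms]] by simp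
  then show ?thesis using bij_imp_bij_inv[OF autD(1)[OF assms]] by (auto simp: aut_def)
qed

lemma aut_relpowp: "g \<in> aut adj \<Longrightarrow> (adj ^^ n) x y \<Longrightarrow> (adj ^^ n) (g x) (g y)"
proof (induction n arbitrary: y)
  case (Suc n)
  then obtain z where "(adj ^^ n) x z" "adj z y" by auto
  then have "(adj ^^ n) (g x) (g z)" "adj (g z) (g y)" using Suc autD by auto
  then show ?case by (rule relpowp_Suc_I)
qed auto

lemma aut_dist:
  assumes g: "g \<in> aut adj"
  shows "d (g x) (g y) = d x y"
proof -
  have "d (f x) (f y) \<le> d x y" if "f \<in> aut adj" for f x y
    using d_le aut_relpowp[OF that d_walk] by blast
  from this[OF g] this[OF aut_inv[OF g], of "g x" "g y"] show ?thesis
    using inv_cancel(2)[OF autD(1)[OF g]] by (simp add: le_antisym)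
qed

lemma aut_gconvex:
  assumes g: "g \<in> aut adj" and C: "gconvex adj C"
  shows "gconvex adj (g ` C)"
  unfolding gconvex_def
proof safe
  fix x y z assume "x \<in> C" "y \<in> C" "z \<in> gint adj (g x) (g y)"
  moreover have "z = g (inv g z)" using inv_cancel(1)[OF autD(1)[OF g], of z] by simp
  ultimately have "inv g z \<in> C"
    using C aut_dist[OF g] unfolding gconvex_def gint_def
    by (metis (mono_tags, lifting) mem_Collect_eq subsetD)
  then show "z \<in> g ` C" using \<open>z = g (inv g z)\<close> by blast
qed

lemma aut_image_Compl: "g \<in> aut adj \<Longrightarrow> g ` (- h) = - g ` h"
  using bij_image_Compl_eq autD(1) by blast

lemma aut_image_image_inv:
  assumes "g \<in> aut adj"
  shows "g ` inv g ` h = h" "inv g ` g ` h = h"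
  using inv_cancel[OF autD(1)[OF assms]] by (auto simp: image_image)

lemma aut_halfspace:
  assumes g: "g \<in> aut adj" and h: "h \<in> H"
  shows "g ` h \<in> H"
proof -
  have "g ` h \<noteq> {}" "g ` (- h) \<noteq> {}" using halfspace_nonempty[OF h] by auto
  then show ?thesis
    using aut_gconvex[OF g, of h] aut_gconvex[OF g, of "- h"] h aut_image_Compl[OF g, of h]
    by (auto simp: halfspaces_def)
qed

lemma aut_halfspace_iff: "g \<in> aut adj \<Longrightarrow> g ` h \<in> H \<longleftrightarrow> h \<in> H"
  using aut_halfspace aut_image_image_inv aut_inv by metis

lemma aut_image_subset_iff: "g \<in> aut adj \<Longrightarrow> g ` h \<subseteq> g ` k \<longleftrightarrow> h \<subseteq> k"
  using autD(1) bij_is_inj inj_image_subset_iff by metis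

lemma aut_image_Int: "g \<in> aut adj \<Longrightarrow> g ` (h \<inter> k) = g ` h \<inter> g ` k"
  using autD(1) bij_is_inj image_Int by metis

lemma mem_ract_iff:
  assumes "g \<in> aut adj"
  shows "h \<in> ract g \<xi> \<longleftrightarrow> inv g ` h \<in> \<xi>"
proof
  assume "inv g ` h \<in> \<xi>"
  then have "g ` inv g ` h \<in> ract g \<xi>" unfolding ract_def by (rule imageI)
  then show "h \<in> ract g \<xi>" by (simp only: aut_image_image_inv[OF assms])
next
  assume "h \<in> ract g \<xi>"
  then obtain k where "k \<in> \<xi>" "h = g ` k" by (auto simp: ract_def)
  then show "inv g ` h \<in> \<xi>" by (simp only: aut_image_image_inv[OF assms])
qed

lemma image_mem_ract_iff: "g \<in> aut adj \<Longrightarrow> g ` h \<in> ract g \<xi> \<longleftrightarrow> h \<in> \<xi>"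
  by (simp add: mem_ract_iff aut_image_image_inv)

lemma ract_comp: "ract (g \<circ> h) \<xi> = ract g (ract h \<xi>)"
  by (simp add: ract_def image_image image_comp)

lemma ract_id [simp]: "ract id \<xi> = \<xi>"
  by (simp add: ract_def)

lemma ract_ract_inv:
  assumes "g \<in> aut adj"
  shows "ract g (ract (inv g) \<xi>) = \<xi>" "ract (inv g) (ract g \<xi>) = \<xi>"
  using aut_image_image_inv[OF assms] by (auto simp: ract_def image_image)

lemma ract_U: "g \<in> aut adj \<Longrightarrow> ract g (U v) = U (g v)"
proof (rule set_eqI)
  fix h assume g: "g \<in> aut adj"
  have "v \<in> inv g ` h \<longleftrightarrow> g v \<in> h"
    using inv_cancel[OF autD(1)[OF g]] by (metis image_iff)
  then show "h \<in> ract g (U v) \<longleftrightarrow> h \<in> U (g v)"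
    using mem_ract_iff[OF g] aut_halfspace_iff[OF aut_inv[OF g]] by (auto simp: Uv_def)
qed

lemma ract_Int: "g \<in> aut adj \<Longrightarrow> ract g (\<xi> \<inter> \<eta>) = ract g \<xi> \<inter> ract g \<eta>"
  by (auto simp: mem_ract_iff)

lemma ract_mono: "\<xi> \<subseteq> \<eta> \<Longrightarrow> ract g \<xi> \<subseteq> ract g \<eta>"
  by (auto simp: ract_def)

lemma ract_roller:
  assumes g: "g \<in> aut adj" and xi: "\<xi> \<in> roller adj"
  shows "ract g \<xi> \<in> roller adj"
  unfolding roller_iff
proof (intro conjI ballI)
  show "ract g \<xi> \<subseteq> H" using aut_halfspace[OF g] rollerD(1)[OF xi] by (auto simp: ract_def)
next
  fix h assume "h \<in> H"
  then have "inv g ` h \<in> H" using aut_halfspace aut_inv[OF g] by blast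
  then show "(- h \<in> ract g \<xi>) = (h \<notin> ract g \<xi>)"
    using mem_ract_iff[OF g] aut_image_Compl[OF aut_inv[OF g]] rollerD(2)[OF xi] by simp
next
  fix h k assume "h \<in> ract g \<xi>" "k \<in> ract g \<xi>"
  then obtain h' k' where "h' \<in> \<xi>" "k' \<in> \<xi>" "h = g ` h'" "k = g ` k'" by (auto simp: ract_def)
  then show "h \<inter> k \<noteq> {}"
    using rollerD(3)[OF xi, of h' k'] aut_image_Int[OF g, of h' k'] by auto
qed

lemma subgroupD:
  assumes "aut_subgroup adj \<Gamma>"
  shows "g \<in> \<Gamma> \<Longrightarrow> g \<in> aut adj" "id \<in> \<Gamma>" "g \<in> \<Gamma> \<Longrightarrow> h \<in> \<Gamma> \<Longrightarrow> g \<circ> h \<in> \<Gamma>" "g \<in> \<Gamma> \<Longrightarrow> inv g \<in> \<Gamma>"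
  using assms by (auto simp: aut_subgroup_def)

lemma halfspace_edge:
  assumes h: "h \<in> H"
  obtains x y where "adj x y" "x \<in> h" "y \<notin> h"
proof -
  obtain a b where "a \<in> h" "b \<notin> h" using halfspace_nonempty[OF h] by blast
  then have "\<exists>x y. adj x y \<and> x \<in> h \<and> y \<notin> h"
  proof (induction "d a b" arbitrary: a)
    case (Suc n)
    then obtain a' where "adj a a'" "d a b = Suc (d a' b)" using d_step by metis
    then show ?case using Suc by (cases "a' \<in> h") auto
  qed auto
  then show thesis using that by blast
qed

text \<open>The image is the side of the image edge. This makes the action on each single half-space
  continuous for pointwise convergence on vertices.\<close>

lemma aut_image_halfspace_cong:
  assumes "g \<in> aut adj" "g' \<in> aut adj" "h \<in> H" "adj x y" "x \<in> h" "y \<notin> h" "g x = g' x" "g y = g' y"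
  shows "g ` h = g' ` h"
proof -
  have "f ` h = side (f x) (f y)" if "f \<in> aut adj" for f
  proof (rule halfspace_eq_side)
    show "f y \<notin> f ` h"
      using assms(6) bij_is_inj[OF autD(1)[OF that]] by (simp add: inj_image_mem_iff)
  qed (use that assms autD aut_halfspace in auto)
  then show ?thesis using assms by metis
qed

section \<open>Intervals\<close>

definition undecided :: "'v set set \<Rightarrow> 'v set set" where
  "undecided W = {h \<in> H. h \<notin> W \<and> - h \<notin> W}"

lemma undecided_compl: "- h \<in> undecided W \<longleftrightarrow> h \<in> undecided W"
  by (auto simp: undecided_def halfspace_compl)

text \<open>A partial consistent orientation; upward closure makes its members meet every undecided
  half-space.\<close>

definition pairwise_meeting :: "'v set set \<Rightarrow> bool" where
  "pairwise_meeting W \<longleftrightarrow> W \<subseteq> H \<and> (\<forall>h\<in>W. \<forall>k\<in>W. h \<inter> k \<noteq> {}) \<and> (\<forall>h\<in>W. \<forall>k\<in>H. h \<subseteq> k \<longrightarrow> k \<in> W)"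

lemma pairwise_meetingD:
  assumes "pairwise_meeting W"
  shows "h \<in> W \<Longrightarrow> h \<in> H" "h \<in> W \<Longrightarrow> k \<in> W \<Longrightarrow> h \<inter> k \<noteq> {}"
    "h \<in> W \<Longrightarrow> h \<subseteq> k \<Longrightarrow> k \<in> H \<Longrightarrow> k \<in> W"
  using assms by (auto simp: pairwise_meeting_def)

text \<open>Disjoint undecided \<open>h\<close> and \<open>k\<close> satisfy
  \<open>h \<subseteq> - k\<close>, so monotonicity forbids selecting both. Upward closure of
  \<open>W\<close> settles the mixed case.\<close>

lemma orientation_roller:
  assumes W: "pairwise_meeting W"
    and compl: "\<And>h. h \<in> undecided W \<Longrightarrow> P (- h) \<longleftrightarrow> \<not> P h"
    and mono: "\<And>h k. h \<in> undecided W \<Longrightarrow> k \<in> undecided W \<Longrightarrow> h \<subseteq> k \<Longrightarrow> P h \<Longrightarrow> P k"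
  shows "W \<union> {h \<in> undecided W. P h} \<in> roller adj"
  unfolding roller_iff
proof (intro conjI ballI)
  show "W \<union> {h \<in> undecided W. P h} \<subseteq> H"
    using pairwise_meetingD(1)[OF W] by (auto simp: undecided_def)
next
  fix h assume h: "h \<in> H"
  show "(- h \<in> W \<union> {h \<in> undecided W. P h}) = (h \<notin> W \<union> {h \<in> undecided W. P h})"
  proof (cases "h \<in> undecided W")
    case True
    then show ?thesis using compl undecided_compl by (auto simp: undecided_def)
  next
    case False
    then show ?thesis
      using pairwise_meetingD(2)[OF W, of h "- h"] undecided_compl[of h W] h
      by (auto simp: undecided_def)
  qed
next
  have WP: "h \<inter> k \<noteq> {}" if "h \<in> W" "k \<in> undecided W" for h k
    using pairwise_meetingD(3)[OF W that(1), of "- k"] that halfspace_compl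
    by (auto simp: undecided_def)
  fix h k assume hk: "h \<in> W \<union> {h \<in> undecided W. P h}" "k \<in> W \<union> {h \<in> undecided W. P h}"
  then consider "h \<in> W" "k \<in> W" | "h \<in> W" "k \<in> undecided W" | "h \<in> undecided W" "k \<in> W"
    | "h \<in> undecided W" "P h" "k \<in> undecided W" "P k" by auto
  then show "h \<inter> k \<noteq> {}"
  proof cases
    case 4
    then have "\<not> h \<subseteq> - k" using mono[of h "- k"] compl undecided_compl by auto
    then show ?thesis by blast
  next
    case 3
    then show ?thesis using WP[of k h] by (simp add: Int_commute)
  qed (use pairwise_meetingD(2)[OF W] WP in auto)
qed

text \<open>One orientation selects, for each undecided hyperplane, a class among \<open>cls h\<close> and
  \<open>cls (- h)\<close>; the other orientation is the opposite selection.\<close>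

lemma interval_of_classes:
  assumes W: "pairwise_meeting W"
    and nested: "\<And>h k. h \<in> undecided W \<Longrightarrow> k \<in> undecided W \<Longrightarrow> h \<subseteq> k \<Longrightarrow> cls h = cls k"
    and compl: "\<And>h. h \<in> undecided W \<Longrightarrow> cls h \<noteq> cls (- h)"
  obtains a b where "a \<in> roller adj" "b \<in> roller adj" "a \<inter> b = W"
proof -
  \<comment> \<open>The choice depends on the unordered pair of classes only, so \<open>h\<close>
    and \<open>- h\<close> receive the same selected class.\<close>
  define sel where "sel h = (SOME c. c \<in> {cls h, cls (- h)})" for h
  have sel: "sel h \<in> {cls h, cls (- h)}" for h
    unfolding sel_def by (rule someI[of _ "cls h"]) auto
  have sel_compl: "sel (- h) = sel h" for h by (simp add: sel_def insert_commute)
  have sel_mono: "sel h = sel k" "cls h = cls k"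
    if "h \<in> undecided W" "k \<in> undecided W" "h \<subseteq> k" for h k
  proof -
    show "cls h = cls k" using nested that by blast
    moreover have "cls (- k) = cls (- h)" using nested[of "- k" "- h"] that undecided_compl by auto
    ultimately show "sel h = sel k" by (simp add: sel_def)
  qed
  let ?a = "W \<union> {h \<in> undecided W. cls h = sel h}" and ?b = "W \<union> {h \<in> undecided W. cls h \<noteq> sel h}"
  have "?a \<in> roller adj"
  proof (rule orientation_roller[OF W])
    show "(cls (- h) = sel (- h)) \<longleftrightarrow> \<not> cls h = sel h" if "h \<in> undecided W" for h
      using sel[of h] compl[OF that] unfolding sel_compl by (elim insertE) auto
  qed (use sel_mono in metis)
  moreover have "?b \<in> roller adj"
  proof (rule orientation_roller[OF W])
    show "(cls (- h) \<noteq> sel (- h)) \<longleftrightarrow> \<not> cls h \<noteq> sel h" if "h \<in> undecided W" for h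
      using sel[of h] compl[OF that] unfolding sel_compl by (elim insertE) auto
  qed (use sel_mono in metis)
  moreover have "?a \<inter> ?b = W" by auto
  ultimately show thesis using that by blast
qed

text \<open>The inclusion for inverses gives equality, and then the points containing
  \<open>a \<inter> b\<close> are permuted, although \<open>a\<close> and \<open>b\<close>
  themselves may move within the interval.\<close>

lemma preserves_interval_if_invariant:
  assumes G: "aut_subgroup adj \<Gamma>" and ab: "a \<in> roller adj" "b \<in> roller adj"
    and inv: "\<And>g. g \<in> \<Gamma> \<Longrightarrow> ract g (a \<inter> b) \<subseteq> a \<inter> b"
  shows "preserves_interval adj \<Gamma>"
proof -
  let ?I = "rinterval adj a b"
  have eq: "ract g (a \<inter> b) = a \<inter> b" if g: "g \<in> \<Gamma>" for g
  proof -
    have "ract g (ract (inv g) (a \<inter> b)) \<subseteq> ract g (a \<inter> b)"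
      using inv subgroupD(4)[OF G g] ract_mono by blast
    then show ?thesis
      using inv[OF g] ract_ract_inv subgroupD(1)[OF G g] by auto
  qed
  have sub: "ract g ` ?I \<subseteq> ?I" if g: "g \<in> \<Gamma>" for g
  proof safe
    fix m assume m: "m \<in> ?I"
    have "ract g (a \<inter> b) \<subseteq> ract g m"
      using m by (intro ract_mono) (auto simp: rinterval_def)
    then show "ract g m \<in> ?I"
      using eq[OF g] m ract_roller subgroupD(1)[OF G g] by (auto simp: rinterval_def)
  qed
  have "ract g ` ?I = ?I" if g: "g \<in> \<Gamma>" for g
  proof
    show "?I \<subseteq> ract g ` ?I"
    proof
      fix m assume "m \<in> ?I"
      then have "ract (inv g) m \<in> ?I" using sub[OF subgroupD(4)[OF G g]] by blast
      then show "m \<in> ract g ` ?I"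
        using ract_ract_inv(1)[OF subgroupD(1)[OF G g], of m] by (metis imageI)
    qed
  qed (rule sub[OF g])
  then show ?thesis unfolding preserves_interval_def is_interval_def using ab by blast
qed

section \<open>From invariant means to invariant intervals\<close>

text \<open>These are the locally constant functions on the product space of all subsets of
  \<open>H\<close>. They suffice because only half-spaces and symmetric differences of two
  half-spaces are measured.\<close>

definition cylinder :: "('v set set \<Rightarrow> real) \<Rightarrow> bool" where
  "cylinder \<phi> \<longleftrightarrow> (\<exists>F. finite F \<and> F \<subseteq> H \<and> (\<forall>\<xi> \<eta>. \<xi> \<inter> F = \<eta> \<inter> F \<longrightarrow> \<phi> \<xi> = \<phi> \<eta>))"

lemma cylinder_const: "cylinder (\<lambda>_. c)"
  by (auto simp: cylinder_def)

lemma cylinder_mem: "h \<in> H \<Longrightarrow> cylinder (\<lambda>\<xi>. of_bool (h \<in> \<xi>))"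
  unfolding cylinder_def by (intro exI[of _ "{h}"]) auto

lemma cylinder_map2:
  assumes "cylinder \<phi>" "cylinder \<psi>"
  shows "cylinder (\<lambda>\<xi>. f (\<phi> \<xi>) (\<psi> \<xi>))"
proof -
  obtain F K where F: "finite F" "F \<subseteq> H" "\<And>\<xi> \<eta>. \<xi> \<inter> F = \<eta> \<inter> F \<Longrightarrow> \<phi> \<xi> = \<phi> \<eta>"
    and K: "finite K" "K \<subseteq> H" "\<And>\<xi> \<eta>. \<xi> \<inter> K = \<eta> \<inter> K \<Longrightarrow> \<psi> \<xi> = \<psi> \<eta>"
    using assms unfolding cylinder_def by metis
  have "f (\<phi> \<xi>) (\<psi> \<xi>) = f (\<phi> \<eta>) (\<psi> \<eta>)" if "\<xi> \<inter> (F \<union> K) = \<eta> \<inter> (F \<union> K)" for \<xi> \<eta>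
  proof -
    have "\<xi> \<inter> F = \<eta> \<inter> F" "\<xi> \<inter> K = \<eta> \<inter> K" using that by blast+
    then show ?thesis using F(3) K(3) by metis
  qed
  then show ?thesis
    unfolding cylinder_def using F(1,2) K(1,2)
    by (intro exI[of _ "F \<union> K"] conjI allI impI finite_UnI Un_least)
qed

text \<open>The half-spaces of measure above \<open>1/2\<close> meet pairwise. Nested half-spaces of measure exactly
  \<open>1/2\<close> agree almost everywhere, so that classes modulo null sets satisfy
  \<open>interval_of_classes\<close>.\<close>

lemma invariant_mean_preserves_interval:
  fixes E :: "('v set set \<Rightarrow> real) \<Rightarrow> real"
  assumes G: "aut_subgroup adj \<Gamma>"
    and lin: "\<And>\<phi> \<psi> s t. cylinder \<phi> \<Longrightarrow> cylinder \<psi> \<Longrightarrow>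
      E (\<lambda>\<xi>. s * \<phi> \<xi> + t * \<psi> \<xi>) = s * E \<phi> + t * E \<psi>"
    and one: "E (\<lambda>_. 1) = 1"
    and pos: "\<And>\<phi>. cylinder \<phi> \<Longrightarrow> (\<And>\<xi>. \<xi> \<in> roller adj \<Longrightarrow> 0 \<le> \<phi> \<xi>) \<Longrightarrow> 0 \<le> E \<phi>"
    and inv: "\<And>\<phi> g. cylinder \<phi> \<Longrightarrow> g \<in> \<Gamma> \<Longrightarrow> E (\<lambda>\<xi>. \<phi> (ract g \<xi>)) = E \<phi>"
  shows "preserves_interval adj \<Gamma>"
proof -
  define i :: "'v set \<Rightarrow> 'v set set \<Rightarrow> real" where "i h \<xi> = of_bool (h \<in> \<xi>)" for h \<xi>
  have cyl: "cylinder (i h)" if "h \<in> H" for h using cylinder_mem[OF that] by (simp add: i_def[abs_def])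
  have mono: "E \<phi> \<le> E \<psi>"
    if "cylinder \<phi>" "cylinder \<psi>" "\<And>\<xi>. \<xi> \<in> roller adj \<Longrightarrow> \<phi> \<xi> \<le> \<psi> \<xi>" for \<phi> \<psi>
  proof -
    have "0 \<le> E (\<lambda>\<xi>. 1 * \<psi> \<xi> + (- 1) * \<phi> \<xi>)"
      using that by (intro pos cylinder_map2[of \<psi> \<phi> "\<lambda>a b. 1 * a + (- 1) * b"]) auto
    then show ?thesis using lin[OF that(2,1), of 1 "- 1"] by simp
  qed
  have add: "E (\<lambda>\<xi>. \<phi> \<xi> + \<psi> \<xi>) = E \<phi> + E \<psi>" if "cylinder \<phi>" "cylinder \<psi>" for \<phi> \<psi>
    using lin[OF that, of 1 1] by simp
  \<comment> \<open>The measure of the symmetric difference, a pseudometric on half-spaces; null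
    distance defines the classes.\<close>
  define dd where "dd h k = E (\<lambda>\<xi>. \<bar>i h \<xi> - i k \<xi>\<bar>)" for h k
  have cyld: "cylinder (\<lambda>\<xi>. \<bar>i h \<xi> - i k \<xi>\<bar>)" if "h \<in> H" "k \<in> H" for h k
    using cylinder_map2[OF cyl cyl, OF that, of "\<lambda>a b. \<bar>a - b\<bar>"] .
  have dd_sym: "dd h k = dd k h" for h k by (simp add: dd_def abs_minus_commute)
  have dd_pos: "0 \<le> dd h k" if "h \<in> H" "k \<in> H" for h k
    unfolding dd_def using cyld[OF that] by (rule pos) auto
  have dd_tri: "dd h l \<le> dd h k + dd k l" if "h \<in> H" "k \<in> H" "l \<in> H" for h k l
    unfolding dd_def using that
    by (subst add[symmetric]) (auto intro!: mono cyld cylinder_map2[of _ _ "\<lambda>a b. a + b"])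
  define \<mu> where "\<mu> h = E (i h)" for h
  have mu_mono: "\<mu> h \<le> \<mu> k" if "h \<in> H" "k \<in> H" "h \<subseteq> k" for h k
    unfolding \<mu>_def using that roller_up
    by (intro mono cyl) (auto simp: i_def)
  have mu_compl: "\<mu> h + \<mu> (- h) = 1" if h: "h \<in> H" for h
  proof -
    have h': "- h \<in> H" using h halfspace_compl by blast
    have c: "cylinder (\<lambda>\<xi>. i h \<xi> + i (- h) \<xi>)"
      using cylinder_map2[OF cyl[OF h] cyl[OF h'], of "\<lambda>a b. a + b"] .
    have "\<xi> \<in> roller adj \<Longrightarrow> i h \<xi> + i (- h) \<xi> = 1" for \<xi>
      using rollerD(2)[of \<xi> h] h by (auto simp: i_def)
    then have "E (\<lambda>\<xi>. i h \<xi> + i (- h) \<xi>) = E (\<lambda>_. 1)"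
      by (intro antisym mono c cylinder_const) auto
    then show ?thesis using one add[OF cyl cyl, OF h h'] by (simp add: \<mu>_def)
  qed
  have mu_inv: "\<mu> (g ` h) = \<mu> h" if "g \<in> \<Gamma>" "h \<in> H" for g h
  proof -
    have g: "g \<in> aut adj" using subgroupD(1)[OF G that(1)] .
    have "i (g ` h) (ract g \<xi>) = i h \<xi>" for \<xi>
      using image_mem_ract_iff[OF g] by (simp add: i_def)
    then show ?thesis
      using inv[OF cyl[OF aut_halfspace[OF g that(2)]] that(1)] by (simp add: \<mu>_def)
  qed
  define W where "W = {h \<in> H. \<mu> h > 1/2}"
  have W: "pairwise_meeting W"
    unfolding pairwise_meeting_def
  proof (intro conjI ballI impI)
    fix h k assume hk: "h \<in> W" "k \<in> W"
    show "h \<inter> k \<noteq> {}"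
    proof
      assume "h \<inter> k = {}"
      then have "\<mu> h \<le> \<mu> (- k)" using hk halfspace_compl by (intro mu_mono) (auto simp: W_def)
      then show False using hk mu_compl[of k] by (auto simp: W_def)
    qed
  next
    fix h k assume "h \<in> W" "k \<in> H" "h \<subseteq> k"
    then show "k \<in> W" using mu_mono[of h k] by (auto simp: W_def)
  qed (auto simp: W_def)
  have und: "undecided W = {h \<in> H. \<mu> h = 1/2}"
    using mu_compl halfspace_compl by (fastforce simp: undecided_def W_def)
  define cls where "cls h = {k \<in> undecided W. dd h k = 0}" for h
  have nested: "cls h = cls k" if hk: "h \<in> undecided W" "k \<in> undecided W" "h \<subseteq> k" for h k
  proof -
    have HH: "h \<in> H" "k \<in> H" using hk und by auto
    have "dd h k \<le> E (\<lambda>\<xi>. 1 * i k \<xi> + (- 1) * i h \<xi>)"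
      unfolding dd_def
      using HH roller_up[of _ h k] hk(3) cylinder_map2[OF cyl cyl, OF HH(2,1), of "\<lambda>a b. 1 * a + (- 1) * b"]
      by (intro mono cyld) (auto simp: i_def)
    also have "\<dots> = 0" using lin[OF cyl cyl, OF HH(2,1), of 1 "- 1"] hk und by (simp add: \<mu>_def)
    finally have 0: "dd h k = 0" using dd_pos[OF HH] by simp
    have "dd h l = 0 \<longleftrightarrow> dd k l = 0" if "l \<in> undecided W" for l
    proof -
      have l: "l \<in> H" using that und by auto
      show ?thesis
        using dd_tri[OF HH(1) HH(2) l] dd_tri[OF HH(2) HH(1) l] 0 dd_sym[of k h]
          dd_pos[OF HH(1) l] dd_pos[OF HH(2) l] by linarith
    qed
    then show ?thesis by (auto simp: cls_def)
  qed
  have compl: "cls h \<noteq> cls (- h)" if h: "h \<in> undecided W" for h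
  proof -
    have HH: "h \<in> H" "- h \<in> H" using h und halfspace_compl by auto
    \<comment> \<open>Zero is written as a linear combination of constants, so that linearity gives
      it mean 0.\<close>
    have "dd h h = E (\<lambda>_. 0 * 1 + 0 * 1)" by (simp add: dd_def)
    also have "\<dots> = 0" using lin[OF cylinder_const cylinder_const, of 0 1 0 1] by simp
    finally have "h \<in> cls h" using h by (simp add: cls_def)
    moreover have "E (\<lambda>_. 1) \<le> dd (- h) h"
      unfolding dd_def
      using rollerD(2) HH by (intro mono cyld cylinder_const) (auto simp: i_def)
    then have "h \<notin> cls (- h)" using one by (auto simp: cls_def)
    ultimately show ?thesis by blast
  qed
  obtain a b where ab: "a \<in> roller adj" "b \<in> roller adj" "a \<inter> b = W"
    using interval_of_classes[OF W, of cls] nested compl by blast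
  have "ract g W \<subseteq> W" if "g \<in> \<Gamma>" for g
    using mu_inv[OF that] aut_halfspace subgroupD(1)[OF G that] by (auto simp: W_def ract_def)
  then show ?thesis using preserves_interval_if_invariant[OF G ab(1,2)] ab(3) by simp
qed

lemma ract_orbit_bij:
  assumes G: "aut_subgroup adj \<Gamma>" and g: "g \<in> \<Gamma>"
  shows "bij_betw (ract g) ((\<lambda>g. ract g \<xi>) ` \<Gamma>) ((\<lambda>g. ract g \<xi>) ` \<Gamma>)"
proof (rule bij_betwI)
  have "ract f \<eta> \<in> (\<lambda>g. ract g \<xi>) ` \<Gamma>" if f: "f \<in> \<Gamma>" and eta: "\<eta> \<in> (\<lambda>g. ract g \<xi>) ` \<Gamma>" for f \<eta>
  proof -
    obtain f' where "f' \<in> \<Gamma>" "\<eta> = ract f' \<xi>" using eta by blast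
    then show ?thesis using subgroupD(3)[OF G f, of f'] by (auto simp: ract_comp[symmetric])
  qed
  then show "ract g \<in> (\<lambda>g. ract g \<xi>) ` \<Gamma> \<rightarrow> (\<lambda>g. ract g \<xi>) ` \<Gamma>"
    "ract (inv g) \<in> (\<lambda>g. ract g \<xi>) ` \<Gamma> \<rightarrow> (\<lambda>g. ract g \<xi>) ` \<Gamma>"
    using g subgroupD(4)[OF G g] by blast+
qed (use ract_ract_inv subgroupD(1)[OF G g] in auto)

text \<open>The uniform probability measure on the orbit is an invariant mean.\<close>

lemma finite_orbit_preserves_interval:
  assumes G: "aut_subgroup adj \<Gamma>" and xi: "\<xi> \<in> roller adj"
    and fin: "finite ((\<lambda>g. ract g \<xi>) ` \<Gamma>)"
  shows "preserves_interval adj \<Gamma>"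
proof -
  let ?O = "(\<lambda>g. ract g \<xi>) ` \<Gamma>"
  have ne: "card ?O > 0" using fin subgroupD(2)[OF G] by (auto simp: card_gt_0_iff)
  have OR: "?O \<subseteq> roller adj" using ract_roller[OF subgroupD(1)[OF G] xi] by blast
  define E :: "('v set set \<Rightarrow> real) \<Rightarrow> real" where "E \<phi> = (\<Sum>\<eta>\<in>?O. \<phi> \<eta>) / real (card ?O)" for \<phi>
  show ?thesis
  proof (rule invariant_mean_preserves_interval[OF G, of E])
    show "E (\<lambda>\<xi>. s * \<phi> \<xi> + t * \<psi> \<xi>) = s * E \<phi> + t * E \<psi>" for \<phi> \<psi> s t
      by (simp add: E_def sum.distrib sum_distrib_left add_divide_distrib)
    show "E (\<lambda>_. 1) = 1" using ne by (simp add: E_def)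
    show "0 \<le> E \<phi>" if "\<And>\<xi>. \<xi> \<in> roller adj \<Longrightarrow> 0 \<le> \<phi> \<xi>" for \<phi>
      unfolding E_def using that OR by (intro divide_nonneg_nonneg sum_nonneg) auto
    show "E (\<lambda>\<xi>. \<phi> (ract g \<xi>)) = E \<phi>" if "g \<in> \<Gamma>" for \<phi> g
      unfolding E_def using sum.reindex_bij_betw[OF ract_orbit_bij[OF G that], of \<phi>] by simp
  qed
qed

text \<open>The mean is pushed forward along the orbit map of a vertex. A cylinder function pulls
  back to a function unchanged by left multiplication with elements that fix, for each half-space
  involved, the ends of one edge across its wall.\<close>

lemma amenable_closure_preserves_interval:
  assumes G: "aut_subgroup adj \<Gamma>" and am: "amenable_perm_group (aut_closure adj \<Gamma>)"
  shows "preserves_interval adj \<Gamma>"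
proof -
  let ?C = "aut_closure adj \<Gamma>"
  have GC: "\<Gamma> \<subseteq> ?C" using subgroupD(1)[OF G] by (auto simp: aut_closure_def)
  have Caut: "?C \<subseteq> aut adj" by (auto simp: aut_closure_def)
  obtain m :: "(('v \<Rightarrow> 'v) \<Rightarrow> real) \<Rightarrow> real" where
    lin: "\<forall>f g a b. ruc ?C f \<and> ruc ?C g \<longrightarrow> m (\<lambda>x. a * f x + b * g x) = a * m f + b * m g"
    and one: "m (\<lambda>_. 1) = 1"
    and pos: "\<forall>f. ruc ?C f \<and> (\<forall>x\<in>?C. 0 \<le> f x) \<longrightarrow> 0 \<le> m f"
    and inv: "\<forall>f h. ruc ?C f \<and> h \<in> ?C \<longrightarrow> m (\<lambda>x. f (h \<circ> x)) = m f"
    using am unfolding amenable_perm_group_def by (elim exE conjE) (rule that)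
  fix x0 :: 'v
  define \<xi> where "\<xi> = U x0"
  have ruc: "ruc ?C (\<lambda>g. \<phi> (ract g \<xi>))" if phi: "cylinder \<phi>" for \<phi>
  proof -
    obtain F where F: "finite F" "F \<subseteq> H" "\<And>\<xi> \<eta>. \<xi> \<inter> F = \<eta> \<inter> F \<Longrightarrow> \<phi> \<xi> = \<phi> \<eta>"
      using phi unfolding cylinder_def by metis
    \<comment> \<open>Only the trace on \<open>F\<close> matters, so \<open>\<phi>\<close> takes
      finitely many values and is bounded.\<close>
    have "range \<phi> \<subseteq> \<phi> ` Pow F"
    proof safe
      fix \<eta> :: "'v set set"
      have "\<phi> \<eta> = \<phi> (\<eta> \<inter> F)" by (rule F(3)) auto
      then show "\<phi> \<eta> \<in> \<phi> ` Pow F" by auto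
    qed
    then have "finite ((\<lambda>x. \<bar>x\<bar>) ` range \<phi>)" using F(1) finite_subset by blast
    then have bound: "\<bar>\<phi> \<eta>\<bar> \<le> Max ((\<lambda>x. \<bar>x\<bar>) ` range \<phi>)" for \<eta>
      by (intro Max_ge) auto
    have "\<exists>e. \<forall>h\<in>F. adj (fst (e h)) (snd (e h)) \<and> fst (e h) \<in> h \<and> snd (e h) \<notin> h"
      using F(2) halfspace_edge by (intro bchoice) (metis fst_conv snd_conv subsetD)
    then obtain e where e: "\<And>h. h \<in> F \<Longrightarrow> adj (fst (e h)) (snd (e h)) \<and> fst (e h) \<in> h \<and> snd (e h) \<notin> h"
      by blast
    let ?P = "(fst \<circ> e) ` F \<union> (snd \<circ> e) ` F"
    have "\<phi> (ract (v \<circ> x) \<xi>) = \<phi> (ract x \<xi>)"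
      if "v \<in> ?C" "x \<in> ?C" "\<forall>p\<in>?P. v p = p" for v x
    proof (rule F(3))
      have v: "v \<in> aut adj" using that Caut by blast
      have "h \<in> ract v (ract x \<xi>) \<longleftrightarrow> h \<in> ract x \<xi>" if "h \<in> F" for h
      proof -
        have "v ` h = id ` h"
          using \<open>h \<in> F\<close> F(2) e[of h] v aut_id \<open>\<forall>p\<in>?P. v p = p\<close>
          by (intro aut_image_halfspace_cong[of _ _ _ "fst (e h)" "snd (e h)"]) auto
        then show ?thesis using image_mem_ract_iff[OF v, of h "ract x \<xi>"] by simp
      qed
      then show "ract (v \<circ> x) \<xi> \<inter> F = ract x \<xi> \<inter> F" by (auto simp: ract_comp)
    qed
    then have "\<exists>F. finite F \<and> (\<forall>x\<in>?C. \<forall>v\<in>?C. (\<forall>p\<in>F. v p = p) \<longrightarrow>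
        \<bar>\<phi> (ract (v \<circ> x) \<xi>) - \<phi> (ract x \<xi>)\<bar> < \<epsilon>)" if "\<epsilon> > 0" for \<epsilon>
      using that F(1) by (intro exI[of _ ?P]) auto
    then show ?thesis
      unfolding ruc_def using bound by blast
  qed
  show ?thesis
  proof (rule invariant_mean_preserves_interval[OF G, of "\<lambda>\<phi>. m (\<lambda>g. \<phi> (ract g \<xi>))"])
    show "m (\<lambda>g. s * \<phi> (ract g \<xi>) + t * \<psi> (ract g \<xi>)) =
        s * m (\<lambda>g. \<phi> (ract g \<xi>)) + t * m (\<lambda>g. \<psi> (ract g \<xi>))"
      if "cylinder \<phi>" "cylinder \<psi>" for \<phi> \<psi> s t
      using lin ruc[OF that(1)] ruc[OF that(2)] by simp
    show "0 \<le> m (\<lambda>g. \<phi> (ract g \<xi>))"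
      if "cylinder \<phi>" "\<And>\<xi>. \<xi> \<in> roller adj \<Longrightarrow> 0 \<le> \<phi> \<xi>" for \<phi>
      using that ract_roller Caut U_roller ruc[OF that(1)]
      by (intro pos[rule_format] conjI ballI) (auto simp: \<xi>_def)
    show "m (\<lambda>f. \<phi> (ract g (ract f \<xi>))) = m (\<lambda>g. \<phi> (ract g \<xi>))" if "cylinder \<phi>" "g \<in> \<Gamma>" for \<phi> g
      using inv[rule_format, OF conjI, OF ruc[OF that(1)], of g] that(2) GC
      by (auto simp: ract_comp)
  qed (rule one)
qed

section \<open>From invariant intervals to finite orbits\<close>

lemma rinterval_Inter:
  assumes "a \<in> roller adj" "b \<in> roller adj"
  shows "\<Inter>(rinterval adj a b) = a \<inter> b"
  using assms by (auto simp: rinterval_def)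

definition dim_le :: "nat \<Rightarrow> bool" where
  "dim_le N \<longleftrightarrow> (\<forall>S\<subseteq>H. (\<forall>h\<in>S. \<forall>k\<in>S. h \<noteq> k \<longrightarrow> transverse h k) \<longrightarrow> finite S \<and> card S \<le> N)"

lemma dim_leD:
  assumes "dim_le N" "S \<subseteq> H" "\<And>h k. h \<in> S \<Longrightarrow> k \<in> S \<Longrightarrow> h \<noteq> k \<Longrightarrow> transverse h k"
  shows "finite S" "card S \<le> N"
  using assms unfolding dim_le_def by meson+

lemma finite_dimE:
  assumes "finite_dim adj"
  obtains N where "dim_le N"
  using assms unfolding finite_dim_def dim_le_def by blast

text \<open>If \<open>a' \<inter> b' = a \<inter> b\<close>, then \<open>a'\<close> is determined by the set of half-spaces in \<open>b - a\<close> that it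
  contains, and this set is a union of components of the comparability graph of \<open>b - a\<close>; the
  number of components is at most the dimension.\<close>

lemma finite_interval_corners:
  assumes fd: "finite_dim adj" and a: "a \<in> roller adj" and b: "b \<in> roller adj"
  shows "finite {a' \<in> roller adj. \<exists>b'\<in>roller adj. a' \<inter> b' = a \<inter> b}" (is "finite ?A")
proof -
  \<comment> \<open>The walls separating \<open>a\<close> from \<open>b\<close>, each represented by
    its side towards \<open>b\<close>.\<close>
  define P where "P = b - a"
  define R where "R = {(h, k). h \<in> P \<and> k \<in> P \<and> (h \<subseteq> k \<or> k \<subseteq> h)}"
  define C where "C h = {k. (h, k) \<in> R\<^sup>*}" for h
  have PH: "P \<subseteq> H" using rollerD(1)[OF b] by (auto simp: P_def)
  have "sym R" by (auto simp: R_def sym_def)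
  then have symR: "sym (R\<^sup>*)" by (rule sym_rtrancl)
  have C_eq: "C h = C k" if "(h, k) \<in> R\<^sup>*" for h k
    using that symD[OF symR that] by (auto simp: C_def intro: rtrancl_trans)
  define rep where "rep c = (SOME h. h \<in> P \<and> C h = c)" for c
  have rep: "rep (C h) \<in> P" "C (rep (C h)) = C h" if "h \<in> P" for h
    using someI[of "\<lambda>k. k \<in> P \<and> C k = C h" h] that by (auto simp: rep_def)
  have "finite (rep ` C ` P)"
  proof -
    have trans: "transverse h k" if "h \<in> rep ` C ` P" "k \<in> rep ` C ` P" "h \<noteq> k" for h k
    proof -
      have hk: "h \<in> P" "k \<in> P" using that rep by auto
      have "C h \<noteq> C k" using that rep by auto
      then have "(h, k) \<notin> R" using C_eq by blast
      then have "\<not> h \<subseteq> k" "\<not> k \<subseteq> h" using hk by (auto simp: R_def)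
      moreover have "h \<inter> k \<noteq> {}" using hk rollerD(3)[OF b] by (auto simp: P_def)
      moreover have "- h \<in> a" "- k \<in> a" using hk rollerD(2)[OF a] PH by (auto simp: P_def)
      then have "- h \<inter> - k \<noteq> {}" using rollerD(3)[OF a] by blast
      ultimately show ?thesis using nested_or_transverse[of h k] by metis
    qed
    have "rep ` C ` P \<subseteq> H" using rep PH by auto
    moreover obtain N where "dim_le N" using finite_dimE[OF fd] .
    ultimately show ?thesis using dim_leD(1) trans by metis
  qed
  moreover have "inj_on rep (C ` P)" using rep(2) by (intro inj_on_inverseI[of _ C]) auto
  ultimately have fin: "finite (C ` P)" by (rule finite_imageD)
  have union: "a' \<inter> P \<in> Union ` Pow (C ` P)" if a': "a' \<in> ?A" for a'
  proof -
    obtain b' where b': "b' \<in> roller adj" "a' \<inter> b' = a \<inter> b" using a' by blast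
    have a'R: "a' \<in> roller adj" using a' by blast
    \<comment> \<open>The choice made by \<open>a'\<close> cannot change between comparable members
      of \<open>P\<close>: otherwise the larger one would lie in both \<open>a'\<close> and
      \<open>b'\<close>, hence in \<open>a\<close>.\<close>
    have closed: "k \<in> a' \<inter> P" if "h \<in> a' \<inter> P" "(h, k) \<in> R" for h k
    proof -
      have k: "h \<in> P" "k \<in> P" "h \<subseteq> k \<or> k \<subseteq> h" using that by (auto simp: R_def)
      have "k \<in> a'"
      proof (rule ccontr)
        assume "k \<notin> a'"
        then have "\<not> h \<subseteq> k" using roller_up[OF a'R] that k PH by blast
        have "- k \<in> a'" using \<open>k \<notin> a'\<close> rollerD(2)[OF a'R] k PH by blast
        moreover have "- k \<notin> a \<inter> b" using rollerD(2)[OF b, of k] k PH by (auto simp: P_def)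
        ultimately have "k \<in> b'" using rollerD(2)[OF b'(1), of k] b'(2) k PH by blast
        then have "h \<in> b'" using roller_up[OF b'(1), of k h] k PH \<open>\<not> h \<subseteq> k\<close> by blast
        then have "h \<in> a \<inter> b" using that b'(2) by blast
        then show False using k by (auto simp: P_def)
      qed
      then show ?thesis using k by blast
    qed
    have "k \<in> a' \<inter> P" if "h \<in> a' \<inter> P" "(h, k) \<in> R\<^sup>*" for h k
      using that(2,1) by (induction rule: rtrancl_induct) (assumption, rule closed)
    then have "C h \<subseteq> a' \<inter> P" if "h \<in> a' \<inter> P" for h using that unfolding C_def by blast
    moreover have "h \<in> C h" for h by (simp add: C_def)
    ultimately have "a' \<inter> P = \<Union>(C ` (a' \<inter> P))" by blast
    then show ?thesis by blast
  qed
  \<comment> \<open>A wall not separating \<open>a\<close> from \<open>b\<close> is decided by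
    \<open>a \<inter> b\<close>, which every such \<open>a'\<close> contains; every other wall has
    one side in \<open>P\<close>.\<close>
  have "inj_on (\<lambda>a'. a' \<inter> P) ?A"
  proof (rule inj_onI)
    fix a1 a2 assume A: "a1 \<in> ?A" "a2 \<in> ?A" and eq: "a1 \<inter> P = a2 \<inter> P"
    have sub: "h \<in> a2" if A: "a1 \<in> ?A" "a2 \<in> ?A" and eq: "a1 \<inter> P = a2 \<inter> P" and h: "h \<in> a1"
      for a1 a2 h
    proof -
      have R: "a1 \<in> roller adj" "a2 \<in> roller adj" using A by auto
      have hH: "h \<in> H" using h rollerD(1)[OF R(1)] by blast
      have W: "a \<inter> b \<subseteq> a1" "a \<inter> b \<subseteq> a2" using A by blast+
      consider "h \<in> a \<inter> b" | "h \<in> P" | "- h \<in> P" | "- h \<in> a \<inter> b"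
        using rollerD(2)[OF a hH] rollerD(2)[OF b hH] by (auto simp: P_def)
      then show ?thesis
      proof cases
        case 3
        then have "- h \<notin> a2" using eq h rollerD(2)[OF R(1) hH] by blast
        then show ?thesis using rollerD(2)[OF R(2) hH] by blast
      qed (use W eq h rollerD(2)[OF R(1) hH] in blast)+
    qed
    show "a1 = a2" using sub[OF A eq] sub[OF A(2,1) eq[symmetric]] by blast
  qed
  moreover have "finite ((\<lambda>a'. a' \<inter> P) ` ?A)"
  proof (rule finite_subset)
    show "(\<lambda>a'. a' \<inter> P) ` ?A \<subseteq> Union ` Pow (C ` P)" by (rule image_subsetI) (rule union)
  qed (use fin in simp)
  ultimately show ?thesis by (rule finite_imageD[rotated])
qed

lemma preserves_intervalE:
  assumes G: "aut_subgroup adj \<Gamma>" and pres: "preserves_interval adj \<Gamma>"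
  obtains a b where "a \<in> roller adj" "b \<in> roller adj" "\<forall>g\<in>\<Gamma>. ract g (a \<inter> b) = a \<inter> b"
proof -
  obtain a b where ab: "a \<in> roller adj" "b \<in> roller adj"
    and I: "\<And>g. g \<in> \<Gamma> \<Longrightarrow> ract g ` rinterval adj a b = rinterval adj a b"
    using pres unfolding preserves_interval_def is_interval_def by metis
  have "ract g (a \<inter> b) = a \<inter> b" if g: "g \<in> \<Gamma>" for g
  proof -
    have "ract g (a \<inter> b) = \<Inter>(ract g ` rinterval adj a b)"
      using rinterval_Inter[OF ab, symmetric] by (auto simp: mem_ract_iff[OF subgroupD(1)[OF G g]])
    then show ?thesis using I[OF g] rinterval_Inter[OF ab] by simp
  qed
  then show thesis using that ab by blast
qed

lemma preserves_interval_finite_orbit: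
  assumes G: "aut_subgroup adj \<Gamma>" and fd: "finite_dim adj" and pres: "preserves_interval adj \<Gamma>"
  obtains \<xi> where "\<xi> \<in> roller adj" "finite ((\<lambda>g. ract g \<xi>) ` \<Gamma>)"
proof -
  obtain a b where ab: "a \<in> roller adj" "b \<in> roller adj"
    and inv: "\<forall>g\<in>\<Gamma>. ract g (a \<inter> b) = a \<inter> b"
    by (rule preserves_intervalE[OF G pres])
  have "ract g a \<in> {a' \<in> roller adj. \<exists>b'\<in>roller adj. a' \<inter> b' = a \<inter> b}" if g: "g \<in> \<Gamma>" for g
    using inv g ract_Int[OF subgroupD(1)[OF G g], of a b] ract_roller[OF subgroupD(1)[OF G g]] ab by auto
  then have "finite ((\<lambda>g. ract g a) ` \<Gamma>)"
    using finite_interval_corners[OF fd ab] by (intro finite_subset[OF image_subsetI])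
  then show thesis using that ab by blast
qed

section \<open>The closure of the group\<close>

lemma aut_closure_approx:
  assumes "g \<in> aut_closure adj \<Gamma>" "finite F"
  obtains p where "p \<in> \<Gamma>" "\<forall>v\<in>F. p v = g v"
  using assms unfolding aut_closure_def by (elim CollectE conjE allE[of _ F]) blast

lemma aut_closure_subgroup:
  assumes G: "aut_subgroup adj \<Gamma>"
  shows "aut_subgroup adj (aut_closure adj \<Gamma>)"
  unfolding aut_subgroup_def
proof (intro conjI ballI)
  show "id \<in> aut_closure adj \<Gamma>"
    unfolding aut_closure_def using subgroupD(2)[OF G] aut_id
    by (intro CollectI conjI allI impI bexI[of _ id]) auto
next
  fix g h assume g: "g \<in> aut_closure adj \<Gamma>" and h: "h \<in> aut_closure adj \<Gamma>"
  have "\<exists>p\<in>\<Gamma>. \<forall>v\<in>F. p v = (g \<circ> h) v" if F: "finite F" for F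
  proof -
    obtain q where q: "q \<in> \<Gamma>" "\<forall>v\<in>F. q v = h v" by (rule aut_closure_approx[OF h F])
    obtain p where p: "p \<in> \<Gamma>" "\<forall>v\<in>h ` F. p v = g v"
      by (rule aut_closure_approx[OF g finite_imageI[OF F]])
    then have "p \<circ> q \<in> \<Gamma>" "\<forall>v\<in>F. (p \<circ> q) v = (g \<circ> h) v"
      using q subgroupD(3)[OF G] by auto
    then show ?thesis by blast
  qed
  then show "g \<circ> h \<in> aut_closure adj \<Gamma>"
    using g h aut_comp by (simp add: aut_closure_def)
next
  fix g assume g: "g \<in> aut_closure adj \<Gamma>"
  then have ga: "g \<in> aut adj" by (simp add: aut_closure_def)
  have "\<exists>p\<in>\<Gamma>. \<forall>v\<in>F. p v = inv g v" if F: "finite F" for F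
  proof -
    \<comment> \<open>Approximating \<open>inv g\<close> on \<open>F\<close> amounts to
      approximating \<open>g\<close> on the preimages of the points of \<open>F\<close>.\<close>
    obtain p where p: "p \<in> \<Gamma>" "\<forall>v\<in>inv g ` F. p v = g v"
      by (rule aut_closure_approx[OF g finite_imageI[OF F]])
    have "inv p v = inv g v" if "v \<in> F" for v
    proof -
      have "p (inv g v) = v" using p(2) that inv_cancel(1)[OF autD(1)[OF ga]] by auto
      then show ?thesis
        using inv_cancel(2)[OF autD(1)[OF subgroupD(1)[OF G p(1)]], of "inv g v"] by simp
    qed
    then show ?thesis using subgroupD(4)[OF G p(1)] by blast
  qed
  then show "inv g \<in> aut_closure adj \<Gamma>" using aut_inv[OF ga] by (simp add: aut_closure_def)
qed (auto simp: aut_closure_def)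

text \<open>An element of the closure moves a given half-space exactly as some element of \<Gamma>
  does, since two vertices determine the image.\<close>

lemma aut_closure_preserves_interval:
  assumes G: "aut_subgroup adj \<Gamma>" and pres: "preserves_interval adj \<Gamma>"
  shows "preserves_interval adj (aut_closure adj \<Gamma>)"
proof -
  obtain a b where ab: "a \<in> roller adj" "b \<in> roller adj"
    and inv: "\<forall>g\<in>\<Gamma>. ract g (a \<inter> b) = a \<inter> b"
    by (rule preserves_intervalE[OF G pres])
  show ?thesis
  proof (rule preserves_interval_if_invariant[OF aut_closure_subgroup[OF G] ab])
    fix g assume g: "g \<in> aut_closure adj \<Gamma>"
    show "ract g (a \<inter> b) \<subseteq> a \<inter> b"
    proof
      fix k assume "k \<in> ract g (a \<inter> b)"
      then obtain h where h: "h \<in> a \<inter> b" "k = g ` h" by (auto simp: ract_def)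
      then have hH: "h \<in> H" using rollerD(1)[OF ab(1)] by blast
      then obtain x y where e: "adj x y" "x \<in> h" "y \<notin> h" by (rule halfspace_edge)
      have "finite {x, y}" by simp
      then obtain p where p: "p \<in> \<Gamma>" "\<forall>v\<in>{x, y}. p v = g v"
        by (rule aut_closure_approx[OF g])
      then have "k = p ` h"
        using aut_image_halfspace_cong[OF _ _ hH e, of g p] g subgroupD(1)[OF G p(1)] h(2)
        by (simp add: aut_closure_def)
      then have "k \<in> ract p (a \<inter> b)" using h(1) unfolding ract_def by blast
      then show "k \<in> a \<inter> b" using inv p(1) by blast
    qed
  qed
qed

end

section \<open>Ping-pong\<close>

abbreviation letter :: "('v \<Rightarrow> 'v) \<times> bool \<Rightarrow> 'v \<Rightarrow> 'v" where
  "letter x \<equiv> if snd x then fst x else inv (fst x)"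

abbreviation flip :: "'a \<times> bool \<Rightarrow> 'a \<times> bool" where
  "flip x \<equiv> (fst x, \<not> snd x)"

lemma word_eval_Nil [simp]: "word_eval [] = id"
  and word_eval_Cons [simp]: "word_eval (x # w) = letter x \<circ> word_eval w"
  by (auto simp: word_eval_def split_beta)

lemma word_eval_append [simp]: "word_eval (u @ w) = word_eval u \<circ> word_eval w"
  by (induction u) auto

lemma reduced_word_iff: "reduced_word w \<longleftrightarrow> successively (\<lambda>x y. y \<noteq> flip x) w"
  unfolding reduced_word_def successively_conv_nth
  by (auto simp: prod_eq_iff less_diff_conv)

context median_gr
begin

lemma word_eval_subgroup:
  assumes "aut_subgroup adj \<Gamma>" "fst ` set w \<subseteq> \<Gamma>"
  shows "word_eval w \<in> \<Gamma>"
  using assms(2) by (induction w) (simp_all add: subgroupD[OF assms(1)] del: comp_apply)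

lemma letter_flip:
  assumes "fst x \<in> aut adj"
  shows "letter x (letter (flip x) v) = v" "letter (flip x) (letter x v) = v"
  using inv_cancel[OF autD(1)[OF assms]] by auto

text \<open>Bridges the two kinds of words: a free action concerns all nontrivial words, ping-pong
  only reduced ones.\<close>

lemma reduce_word:
  assumes "fst ` set w \<subseteq> aut adj"
  obtains w' where "reduced_word w'" "word_eval w' = word_eval w" "set w' \<subseteq> fst ` set w \<times> UNIV"
proof -
  have "\<exists>w'. reduced_word w' \<and> word_eval w' = word_eval w \<and> set w' \<subseteq> fst ` set w \<times> UNIV"
    using assms
  proof (induction w)
    case Nil
    show ?case by (intro exI[of _ "[]"]) (simp add: reduced_word_def)
  next
    case (Cons x w)
    then obtain w' where w': "reduced_word w'" "word_eval w' = word_eval w"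
      "set w' \<subseteq> fst ` set w \<times> UNIV" by auto
    show ?case
    proof (cases "w' \<noteq> [] \<and> hd w' = flip x")
      case True
      then obtain u where u: "w' = flip x # u" by (metis list.collapse)
      have "word_eval u = letter x \<circ> word_eval w'"
        unfolding u using letter_flip(1)[of x] Cons.prems by (intro ext) simp
      moreover have "reduced_word u"
        using w'(1) unfolding u reduced_word_iff by (cases u) auto
      ultimately show ?thesis using w' u by (intro exI[of _ u]) auto
    next
      case False
      then have "reduced_word (x # w')"
        using w'(1) unfolding reduced_word_iff by (cases w') auto
      moreover have "x \<in> fst ` set (x # w) \<times> UNIV" by (cases x) auto
      ultimately show ?thesis using w' by (intro exI[of _ "x # w'"]) auto
    qed
  qed
  then show thesis using that by blast
qed

lemma aut_funpow: "g \<in> aut adj \<Longrightarrow> g ^^ n \<in> aut adj"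
  by (induction n) (auto simp: aut_id aut_comp simp del: comp_apply)

text \<open>The translates \<open>g ^^ n ` h\<close> would all separate a fixed vertex in \<open>h\<close> from a vertex
  outside \<open>h\<close>.\<close>

lemma skewer_no_fixed_vertex:
  assumes g: "g \<in> aut adj" and h: "h \<in> H" "g ` h \<subset> h"
  shows "g v \<noteq> v"
proof -
  have *: False if g: "g \<in> aut adj" and h: "h \<in> H" "g ` h \<subset> h" and v: "v \<in> h" "g v = v" for g h v
  proof -
    obtain u where u: "u \<notin> h" using halfspace_nonempty[OF h(1)] by blast
    have step: "(g ^^ Suc n) ` h \<subset> (g ^^ n) ` h" for n
    proof -
      have "inj (g ^^ n)" using autD(1)[OF aut_funpow[OF g]] bij_is_inj by blast
      then have "(g ^^ n) ` g ` h \<subset> (g ^^ n) ` h"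
        using h(2) by (simp add: psubset_eq inj_image_eq_iff image_mono)
      then show ?thesis by (simp add: funpow_swap1 image_comp)
    qed
    \<comment> \<open>Complements turn the decreasing chain into an increasing one, to which
      \<open>lift_Suc_mono_less\<close> applies.\<close>
    have "- (g ^^ n) ` h < - (g ^^ Suc n) ` h" for n using step[of n] by auto
    then have "- (g ^^ m) ` h < - (g ^^ n) ` h" if "m < n" for m n
      using lift_Suc_mono_less[of "\<lambda>n. - (g ^^ n) ` h", OF _ that] by blast
    then have "inj (\<lambda>n. - (g ^^ n) ` h)" by (intro linorder_injI) (metis less_irrefl)
    then have inj: "inj (\<lambda>n. (g ^^ n) ` h)" by (auto simp: inj_on_def)
    have "(g ^^ n) v = v" for n by (induction n) (auto simp: v)
    then have v_mem: "v \<in> (g ^^ n) ` h" for n using v(1) by (metis imageI)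
    have sub: "(g ^^ n) ` h \<subseteq> h" for n
    proof (induction n)
      case (Suc n)
      then show ?case using step[of n] by blast
    qed simp
    have "(g ^^ n) ` h \<in> H" for n using aut_halfspace[OF aut_funpow[OF g] h(1)] .
    moreover have "u \<notin> (g ^^ n) ` h" for n using sub[of n] u by blast
    ultimately have "(g ^^ n) ` h \<in> {l \<in> H. v \<in> l \<and> u \<notin> l}" for n using v_mem[of n] by blast
    then have "range (\<lambda>n. (g ^^ n) ` h) \<subseteq> {l \<in> H. v \<in> l \<and> u \<notin> l}"
      by (rule image_subsetI)
    then have "finite (range (\<lambda>n. (g ^^ n) ` h))" by (rule finite_subset[OF _ finite_sep])
    then show False using finite_imageD[OF _ inj] infinite_UNIV_nat by blast
  qed
  show ?thesis
  proof
    assume v: "g v = v"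
    show False
    proof (cases "v \<in> h")
      case False
      \<comment> \<open>A fixed vertex outside \<open>h\<close> lies in \<open>- h\<close>, and that
        half-space is skewered by \<open>inv g\<close>.\<close>
      have "inv g ` g ` h \<subset> inv g ` h"
        using h(2) bij_is_inj[OF autD(1)[OF aut_inv[OF g]]]
        by (simp add: psubset_eq inj_image_eq_iff image_mono)
      then have "inv g ` (- h) \<subset> - h"
        using aut_image_Compl[OF aut_inv[OF g], of h] aut_image_image_inv(2)[OF g, of h] by auto
      moreover have "inv g v = v" using v inv_cancel(2)[OF autD(1)[OF g], of v] by simp
      ultimately show ?thesis
        using *[of "inv g" "- h" v] False h(1) halfspace_compl aut_inv[OF g] by blast
    qed (use *[OF g h _ v] in blast)
  qed
qed

text \<open>The ping-pong table: the letter \<open>x\<close> repels from \<open>T (flip x)\<close>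
  and attracts to \<open>T x\<close>.\<close>

context
  fixes S :: "('v \<Rightarrow> 'v) set" and T :: "('v \<Rightarrow> 'v) \<times> bool \<Rightarrow> 'v set"
  assumes S: "S \<subseteq> aut adj"
    and T_all: "\<forall>x. fst x \<in> S \<longrightarrow> T x \<in> H"
    and disj_all: "\<forall>x y. fst x \<in> S \<longrightarrow> fst y \<in> S \<longrightarrow> x \<noteq> y \<longrightarrow> T x \<inter> T y = {}"
    and ping_pong_all: "\<forall>x. fst x \<in> S \<longrightarrow> letter x ` (- T (flip x)) \<subseteq> T x"
begin

lemmas T = T_all[rule_format] and disj = disj_all[rule_format] and ping_pong = ping_pong_all[rule_format]

text \<open>Letters act from right to left. Reducedness makes the set reached by one letter disjoint
  from the only set on which the next letter is not controlled.\<close>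

lemma reduced_word_ping_pong:
  assumes "reduced_word w" "w \<noteq> []" "fst ` set w \<subseteq> S"
  shows "word_eval w ` (- T (flip (last w))) \<subseteq> T (hd w)"
  using assms
proof (induction w)
  case (Cons x w)
  show ?case
  proof (cases w)
    case Nil
    then show ?thesis using ping_pong[of x] Cons.prems by simp
  next
    case (Cons y u)
    have red: "reduced_word w" "y \<noteq> flip x"
      using Cons.prems(1) unfolding reduced_word_iff Cons by auto
    have "word_eval w ` (- T (flip (last w))) \<subseteq> T y"
      using Cons.IH red Cons.prems(3) Cons by simp
    also have "\<dots> \<subseteq> - T (flip x)"
      using disj[of y "flip x"] red Cons.prems(3) Cons by auto
    finally have "letter x ` word_eval w ` (- T (flip (last w))) \<subseteq> T x"
      using ping_pong[of x] Cons.prems(3) by fastforce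
    then show ?thesis using Cons by (simp add: image_comp)
  qed
qed auto

text \<open>Up to conjugation the word is cyclically reduced, and then it skewers \<open>T (hd w)\<close>.\<close>

lemma reduced_word_no_fixed_vertex:
  assumes st: "s \<in> S" "t \<in> S" "s \<noteq> t"
    and "reduced_word w" "w \<noteq> []" "fst ` set w \<subseteq> S"
  shows "word_eval w v \<noteq> v"
  using assms(4-)
proof (induction "length w" arbitrary: w v rule: less_induct)
  case less
  let ?x = "hd w" and ?y = "flip (last w)"
  have xy: "fst ?x \<in> S" "fst ?y \<in> S" using less.prems by auto
  show ?case
  proof (cases "?x = ?y")
    case False
    \<comment> \<open>Of three letters one differs from both \<open>?x\<close> and
      \<open>?y\<close>; its set makes the inclusion of \<open>T ?x\<close> in the complement of
      \<open>T ?y\<close> strict.\<close>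
    have "(s, True) \<noteq> ?x \<and> (s, True) \<noteq> ?y \<or> (s, False) \<noteq> ?x \<and> (s, False) \<noteq> ?y
      \<or> (t, True) \<noteq> ?x \<and> (t, True) \<noteq> ?y"
      using st(3) by (cases ?x; cases ?y) auto
    then obtain z where z: "fst z \<in> S" "z \<noteq> ?x" "z \<noteq> ?y" using st by (metis fst_conv)
    have "T ?x \<subseteq> - T ?y" using disj[OF xy False] by blast
    moreover have "T z \<subseteq> - T ?y - T ?x"
      using disj[OF z(1) xy(1) z(2)] disj[OF z(1) xy(2) z(3)] by blast
    ultimately have "T ?x \<subset> - T ?y" using halfspace_nonempty(1)[OF T[OF z(1)]] by blast
    moreover have a: "word_eval w \<in> aut adj"
    proof -
      have "fst x \<in> aut adj" if "x \<in> set w" for x using that less.prems(3) S by auto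
      then show ?thesis by (induction w) (auto simp: aut_id aut_comp aut_inv simp del: comp_apply)
    qed
    then have "inj (word_eval w)" using autD(1) bij_is_inj by blast
    ultimately have "word_eval w ` T ?x \<subset> word_eval w ` (- T ?y)"
      by (simp add: psubset_eq inj_image_eq_iff image_mono)
    also have "\<dots> \<subseteq> T ?x" using reduced_word_ping_pong less.prems by blast
    finally show ?thesis using skewer_no_fixed_vertex[OF a T[OF xy(1)]] by blast
  next
    case True
    obtain x u where u: "w = x # u" using less.prems(2) by (cases w) auto
    have "u \<noteq> []" using True u by (cases x) auto
    then obtain u' y where u': "u = u' @ [y]" by (metis rev_exhaust)
    have y: "y = flip x" using True u u' by (cases y) auto
    \<comment> \<open>An empty middle part would leave the unreduced word of \<open>x\<close> and
      \<open>flip x\<close>.\<close>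
    have ne: "u' \<noteq> []"
      using less.prems(1) y unfolding u u' reduced_word_iff by auto
    have "reduced_word u'"
      using less.prems(1) ne unfolding u u' reduced_word_iff
      by (auto simp: successively_Cons successively_append_iff)
    moreover have "length u' < length w" "fst ` set u' \<subseteq> S" using u u' less.prems(3) by auto
    ultimately have IH: "word_eval u' v' \<noteq> v'" for v' using less.hyps ne by blast
    have x: "fst x \<in> aut adj" using less.prems(3) S u by auto
    have "word_eval w v = letter x (word_eval u' (letter y v))" by (simp add: u u')
    then show ?thesis using IH[of "letter y v"] letter_flip(2)[OF x] y by metis
  qed
qed

end

text \<open>The conditions on the inverse generators follow by complementation. Reduced words fix no
  vertex, and reduction passes this on to all words that are not trivial in the group.\<close>

lemma ping_pong_free_action:
  assumes G: "aut_subgroup adj \<Gamma>" and ab: "a \<in> \<Gamma>" "b \<in> \<Gamma>"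
    and k: "k1 \<in> H" "k2 \<in> H" "k3 \<in> H" "k4 \<in> H"
    and disj: "k1 \<inter> k2 = {}" "k1 \<inter> k3 = {}" "k1 \<inter> k4 = {}" "k2 \<inter> k3 = {}" "k2 \<inter> k4 = {}" "k3 \<inter> k4 = {}"
    and pp: "a ` (- k2) \<subseteq> k1" "b ` (- k4) \<subseteq> k3"
  shows "has_free_nonabelian_free_action \<Gamma>"
proof -
  have auts: "a \<in> aut adj" "b \<in> aut adj" using ab subgroupD(1)[OF G] by auto
  have inv_pp: "inv g ` (- l) \<subseteq> l'" if "g \<in> aut adj" "g ` (- l') \<subseteq> l" for g l l'
  proof -
    have "inv g z \<in> l'" if "z \<notin> l" for z
    proof (rule ccontr)
      assume "inv g z \<notin> l'"
      then have "g (inv g z) \<in> l" using \<open>g ` (- l') \<subseteq> l\<close> by blast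
      then show False using that inv_cancel(1)[OF autD(1)[OF \<open>g \<in> aut adj\<close>], of z] by simp
    qed
    then show ?thesis by blast
  qed
  \<comment> \<open>A point of \<open>k1\<close> avoids \<open>k2\<close> and \<open>k4\<close>, so
    \<open>a\<close> and \<open>b\<close> send it to disjoint sets and must differ.\<close>
  obtain z where "z \<in> k1" using halfspace_nonempty[OF k(1)] by blast
  then have "z \<in> - k2" "z \<in> - k4" using disj by auto
  then have "a z \<in> k1" "b z \<in> k3" using pp by auto
  then have neq: "a \<noteq> b" using disj by auto
  define T where "T x = (if fst x = a then if snd x then k1 else k2 else if snd x then k3 else k4)" for x
  let ?S = "{a, b}"
  have S: "?S \<subseteq> aut adj" using auts by simp
  have T: "\<forall>x. fst x \<in> ?S \<longrightarrow> T x \<in> H" using k by (simp add: T_def)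
  have Tdisj: "\<forall>x y. fst x \<in> ?S \<longrightarrow> fst y \<in> ?S \<longrightarrow> x \<noteq> y \<longrightarrow> T x \<inter> T y = {}"
    using disj neq by (auto simp: T_def Int_commute)
  have "letter x ` (- T (flip x)) \<subseteq> T x" if "fst x \<in> ?S" for x
    using that pp inv_pp[OF auts(1) pp(1)] inv_pp[OF auts(2) pp(2)] neq
    by (cases "snd x"; cases "fst x = a") (simp_all add: T_def)
  then have Tpp: "\<forall>x. fst x \<in> ?S \<longrightarrow> letter x ` (- T (flip x)) \<subseteq> T x" by blast
  note no_fix = reduced_word_no_fixed_vertex[OF S T Tdisj Tpp, of a b]
  have free: "word_eval w v \<noteq> v" if "w \<noteq> []" "set (map fst w) \<subseteq> ?S" "reduced_word w" for w v
    using no_fix[of w v] that neq by auto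
  show ?thesis
    unfolding has_free_nonabelian_free_action_def
  proof (intro exI[of _ ?S] conjI allI impI)
    show "\<exists>s\<in>?S. \<exists>t\<in>?S. s \<noteq> t" using neq by blast
    show "word_eval w \<noteq> id" if "w \<noteq> [] \<and> set (map fst w) \<subseteq> ?S \<and> reduced_word w" for w
      using free[of w z] that by auto
    fix w v assume w: "set (map fst w) \<subseteq> ?S \<and> word_eval w \<noteq> id"
    then obtain w' where w': "reduced_word w'" "word_eval w' = word_eval w" "set w' \<subseteq> fst ` set w \<times> UNIV"
      using reduce_word[of w] S by auto
    moreover have "w' \<noteq> []" using w w'(2) by auto
    moreover have "set (map fst w') \<subseteq> fst ` set w" using w'(3) by auto
    then have "set (map fst w') \<subseteq> ?S" using w by auto
    ultimately show "word_eval w v \<noteq> v" using free by metis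
  qed (use ab in simp)
qed

section \<open>Maximal invariant families and flipping\<close>

text \<open>Zorn's lemma, starting from the empty family; all conditions involve at most two members
  and so pass to unions of chains.\<close>

lemma maximal_invariant_family:
  assumes G: "aut_subgroup adj \<Gamma>"
  obtains W where "pairwise_meeting W" "\<forall>g\<in>\<Gamma>. ract g W \<subseteq> W"
    "\<forall>W'. pairwise_meeting W' \<longrightarrow> (\<forall>g\<in>\<Gamma>. ract g W' \<subseteq> W') \<longrightarrow> W \<subseteq> W' \<longrightarrow> W' = W"
proof -
  let ?A = "{W. pairwise_meeting W \<and> (\<forall>g\<in>\<Gamma>. ract g W \<subseteq> W)}"
  have "{} \<in> ?A" by (auto simp: pairwise_meeting_def ract_def)
  moreover have "\<Union>C \<in> ?A" if C: "subset.chain ?A C" for C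
  proof -
    have CA: "C \<subseteq> ?A" and lin: "\<And>X Y. X \<in> C \<Longrightarrow> Y \<in> C \<Longrightarrow> X \<subseteq> Y \<or> Y \<subseteq> X"
      using C by (auto simp: subset_chain_def)
    have "pairwise_meeting (\<Union>C)"
      unfolding pairwise_meeting_def
    proof (intro conjI ballI impI)
      show "\<Union>C \<subseteq> H" using CA by (auto simp: pairwise_meeting_def)
      fix h assume "h \<in> \<Union>C"
      then obtain X where X: "X \<in> C" "h \<in> X" by blast
      {
        fix k assume "k \<in> \<Union>C"
        then obtain Y where Y: "Y \<in> C" "k \<in> Y" by blast
        have "pairwise_meeting X" "pairwise_meeting Y" using X Y CA by auto
        then show "h \<inter> k \<noteq> {}"
          using lin[OF X(1) Y(1)] X Y pairwise_meetingD(2) by blast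
      next
        fix k assume "k \<in> H" "h \<subseteq> k"
        then show "k \<in> \<Union>C" using X CA pairwise_meetingD(3)[of X h k] by blast
      }
    qed
    moreover have "ract g (\<Union>C) \<subseteq> \<Union>C" if "g \<in> \<Gamma>" for g
    proof
      fix h assume "h \<in> ract g (\<Union>C)"
      then obtain X k where X: "X \<in> C" "k \<in> X" "h = g ` k" by (auto simp: ract_def)
      then have "h \<in> ract g X" by (simp add: ract_def)
      then show "h \<in> \<Union>C" using X(1) CA that by blast
    qed
    ultimately show ?thesis by blast
  qed
  ultimately obtain W where "W \<in> ?A" "\<forall>X\<in>?A. W \<subseteq> X \<longrightarrow> X = W"
    using subset_Zorn_nonempty[of ?A] by blast
  then show thesis by (intro that[of W]) simp_all
qed

text \<open>Without a flip, all half-spaces above translates of \<open>- h\<close> could be added to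
  \<open>W\<close>: two disjoint translates would produce a flip, and a translate disjoint from a
  member of \<open>W\<close> would force \<open>h\<close> into \<open>W\<close>. The enlarged family
  contains \<open>- h\<close>, against maximality.\<close>

lemma flip_exists:
  assumes G: "aut_subgroup adj \<Gamma>" and W: "pairwise_meeting W"
    and inv: "\<forall>g\<in>\<Gamma>. ract g W \<subseteq> W"
    and max: "\<forall>W'. pairwise_meeting W' \<longrightarrow> (\<forall>g\<in>\<Gamma>. ract g W' \<subseteq> W') \<longrightarrow> W \<subseteq> W' \<longrightarrow> W' = W"
    and h: "h \<in> undecided W"
  shows "\<exists>g\<in>\<Gamma>. g ` (- h) \<subseteq> h"
proof (rule ccontr)
  assume no: "\<not> ?thesis"
  have aut: "g \<in> aut adj" if "g \<in> \<Gamma>" for g using subgroupD(1)[OF G that] .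
  have hH: "h \<in> H" "- h \<in> H" using h halfspace_compl by (auto simp: undecided_def)
  define W' where "W' = W \<union> {k \<in> H. \<exists>g\<in>\<Gamma>. g ` (- h) \<subseteq> k}"
  have meet1: "g ` (- h) \<inter> w \<noteq> {}" if "g \<in> \<Gamma>" "w \<in> W" for g w
  proof
    assume "g ` (- h) \<inter> w = {}"
    then have "w \<subseteq> g ` h" using aut_image_Compl[OF aut[OF that(1)], of h] by auto
    then have "g ` h \<in> W"
      using pairwise_meetingD(3)[OF W that(2)] aut_halfspace[OF aut[OF that(1)] hH(1)] by blast
    then have "inv g ` g ` h \<in> W"
      using inv subgroupD(4)[OF G that(1)] by (auto simp: ract_def)
    then show False
      using h aut_image_image_inv(2)[OF aut[OF that(1)]] by (simp add: undecided_def)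
  qed
  have meet2: "f ` (- h) \<inter> g ` (- h) \<noteq> {}" if "f \<in> \<Gamma>" "g \<in> \<Gamma>" for f g
  proof
    let ?p = "inv f \<circ> g"
    assume "f ` (- h) \<inter> g ` (- h) = {}"
    then have "inv f ` (f ` (- h) \<inter> g ` (- h)) = {}" by simp
    then have "- h \<inter> ?p ` (- h) = {}"
      unfolding aut_image_Int[OF aut_inv[OF aut[OF that(1)]]] aut_image_image_inv(2)[OF aut[OF that(1)]]
      by (simp add: image_comp)
    then have "?p ` (- h) \<subseteq> h" by blast
    moreover have "?p \<in> \<Gamma>" using subgroupD(3)[OF G] subgroupD(4)[OF G] that by blast
    ultimately show False using no by blast
  qed
  have "pairwise_meeting W'"
    unfolding pairwise_meeting_def
  proof (intro conjI ballI impI)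
    show "W' \<subseteq> H" using pairwise_meetingD(1)[OF W] by (auto simp: W'_def)
    fix k l assume k: "k \<in> W'"
    show "k \<inter> l \<noteq> {}" if l: "l \<in> W'"
    proof -
      consider "k \<in> W" "l \<in> W" | g where "k \<in> W" "g \<in> \<Gamma>" "g ` (- h) \<subseteq> l"
        | f where "f \<in> \<Gamma>" "f ` (- h) \<subseteq> k" "l \<in> W"
        | f g where "f \<in> \<Gamma>" "f ` (- h) \<subseteq> k" "g \<in> \<Gamma>" "g ` (- h) \<subseteq> l"
        using k l unfolding W'_def by blast
      then show ?thesis
      proof cases
        case 1 then show ?thesis using pairwise_meetingD(2)[OF W] by blast
      next
        case 2 then show ?thesis using meet1[of g k] by blast
      next
        case 3 then show ?thesis using meet1[of f l] by blast
      next
        case 4 then show ?thesis using meet2[of f g] by blast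
      qed
    qed
    show "l \<in> W'" if "l \<in> H" "k \<subseteq> l"
      using k that pairwise_meetingD(3)[OF W] unfolding W'_def by blast
  qed
  moreover have "ract f W' \<subseteq> W'" if f: "f \<in> \<Gamma>" for f
  proof
    fix k assume "k \<in> ract f W'"
    then obtain l where l: "l \<in> W'" "k = f ` l" by (auto simp: ract_def)
    show "k \<in> W'"
    proof (cases "l \<in> W")
      case True
      then have "k \<in> ract f W" using l(2) by (simp add: ract_def)
      then show ?thesis using inv f by (auto simp: W'_def)
    next
      case False
      then obtain g where g: "l \<in> H" "g \<in> \<Gamma>" "g ` (- h) \<subseteq> l" using l(1) by (auto simp: W'_def)
      then have "(f \<circ> g) ` (- h) \<subseteq> k" using l(2) by auto
      then show ?thesis
        using g l(2) subgroupD(3)[OF G f g(2)] aut_halfspace[OF aut[OF f] g(1)] unfolding W'_def by blast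
    qed
  qed
  ultimately have "W' = W" using max by (auto simp: W'_def)
  moreover have "- h \<in> W'" using hH subgroupD(2)[OF G] by (force simp: W'_def)
  ultimately show False using h by (simp add: undecided_def)
qed

context
  fixes \<Gamma> :: "('v \<Rightarrow> 'v) set" and W :: "'v set set"
  assumes G: "aut_subgroup adj \<Gamma>" and W: "pairwise_meeting W"
    and inv: "\<forall>g\<in>\<Gamma>. ract g W \<subseteq> W"
    and flip: "\<forall>h\<in>undecided W. \<exists>g\<in>\<Gamma>. g ` (- h) \<subseteq> h"
begin

lemma undecided_image:
  assumes "g \<in> \<Gamma>" "h \<in> undecided W"
  shows "g ` h \<in> undecided W"
proof -
  have g: "g \<in> aut adj" using subgroupD(1)[OF G assms(1)] .
  have mem_W: "k \<in> W" if "g ` k \<in> W" for k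
  proof -
    have "inv g ` g ` k \<in> ract (inv g) W" unfolding ract_def using that by (rule imageI)
    then show ?thesis
      using inv subgroupD(4)[OF G assms(1)] aut_image_image_inv(2)[OF g, of k] by auto
  qed
  have "g ` h \<notin> W" "- g ` h \<notin> W"
    using assms(2) mem_W[of h] mem_W[of "- h"] aut_image_Compl[OF g, of h] by (auto simp: undecided_def)
  then show ?thesis using assms(2) aut_halfspace[OF g] by (auto simp: undecided_def)
qed

text \<open>Two flips: \<open>p\<close> takes \<open>k\<close> into \<open>- k\<close>, which lies
  in \<open>- h\<close>, and \<open>q\<close> takes \<open>- h\<close> into
  \<open>h\<close>.\<close>

lemma double_skewer:
  assumes "h \<in> undecided W" "k \<in> undecided W" "h \<subseteq> k"
  obtains g where "g \<in> \<Gamma>" "g ` k \<subseteq> h"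
proof -
  obtain p where p: "p \<in> \<Gamma>" "p ` k \<subseteq> - k"
    using flip[rule_format, of "- k"] assms(2) undecided_compl by auto
  obtain q where q: "q \<in> \<Gamma>" "q ` (- h) \<subseteq> h" using flip assms(1) by blast
  have "(q \<circ> p) ` k \<subseteq> h" using p q assms(3) by (auto simp: image_subset_iff)
  then show thesis using that subgroupD(3)[OF G q(1) p(1)] by blast
qed

text \<open>An element flipping \<open>h1\<close> carries \<open>h2\<close> and \<open>h3\<close>
  into \<open>h1\<close>, which yields four disjoint half-spaces. Double skewering within each of
  the two pairs gives the two ping-pong players.\<close>

lemma facing_triple_free_action:
  assumes h: "h1 \<in> undecided W" "h2 \<in> undecided W" "h3 \<in> undecided W"
    and disj: "h1 \<inter> h2 = {}" "h1 \<inter> h3 = {}" "h2 \<inter> h3 = {}"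
  shows "has_free_nonabelian_free_action \<Gamma>"
proof -
  obtain g where g: "g \<in> \<Gamma>" "g ` (- h1) \<subseteq> h1" using flip h(1) by blast
  have ga: "g \<in> aut adj" using subgroupD(1)[OF G g(1)] .
  have gh: "g ` h2 \<subseteq> h1" "g ` h3 \<subseteq> h1" "g ` h2 \<inter> g ` h3 = {}"
    using g(2) disj aut_image_Int[OF ga, of h2 h3] by auto
  have und: "g ` h2 \<in> undecided W" "g ` h3 \<in> undecided W" using undecided_image g h by auto
  obtain a where a: "a \<in> \<Gamma>" "a ` (- h3) \<subseteq> h2"
    using double_skewer[of h2 "- h3"] h undecided_compl disj by blast
  obtain b where b: "b \<in> \<Gamma>" "b ` (- g ` h3) \<subseteq> g ` h2"
    using double_skewer[of "g ` h2" "- g ` h3"] und undecided_compl gh(3) by blast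
  show ?thesis
    by (rule ping_pong_free_action[OF G a(1) b(1) _ _ _ _ _ _ _ _ _ _ a(2) b(2)])
      (use h und gh disj in \<open>auto simp: undecided_def\<close>)
qed

text \<open>Choose \<open>g\<close> with \<open>g ` h1 \<subseteq> h0\<close>. By finite dimension some \<open>(g ^^ p) ` h2\<close> is not transverse
  to \<open>h2\<close>; both lie in \<open>h1\<close>, so without facing triples they are nested, and the smaller one
  is contained in \<open>h0 \<inter> h2\<close>.\<close>

lemma common_lower_bound:
  assumes fd: "finite_dim adj"
    and no_triple: "\<not> (\<exists>h\<in>undecided W. \<exists>k\<in>undecided W. \<exists>l\<in>undecided W.
      h \<inter> k = {} \<and> h \<inter> l = {} \<and> k \<inter> l = {})"
    and h: "h0 \<in> undecided W" "h1 \<in> undecided W" "h2 \<in> undecided W" "h0 \<subseteq> h1" "h2 \<subseteq> h1"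
  obtains l where "l \<in> undecided W" "l \<subseteq> h0 \<inter> h2"
proof -
  obtain g where g: "g \<in> \<Gamma>" "g ` h1 \<subseteq> h0" using double_skewer h by blast
  have gn: "g ^^ n \<in> \<Gamma>" for n
    by (induction n) (simp_all add: subgroupD(2,3)[OF G] g id_def[symmetric] del: comp_apply)
  have und: "(g ^^ n) ` h2 \<in> undecided W" for n using undecided_image[OF gn h(3)] .
  have sub: "(g ^^ Suc n) ` h1 \<subseteq> h0" for n
  proof (induction n)
    case (Suc n)
    have "(g ^^ Suc (Suc n)) ` h1 = g ` (g ^^ Suc n) ` h1" by (simp add: image_comp)
    also have "\<dots> \<subseteq> h0" using Suc g(2) h(4) by blast
    finally show ?case .
  qed (use g in simp)
  obtain N where N: "dim_le N" by (rule finite_dimE[OF fd])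
  have "\<exists>i j. i < j \<and> \<not> transverse ((g ^^ i) ` h2) ((g ^^ j) ` h2)"
  proof (rule ccontr)
    assume "\<not> ?thesis"
    then have tr: "transverse ((g ^^ i) ` h2) ((g ^^ j) ` h2)" if "i \<noteq> j" for i j
      using that by (metis Int_commute linorder_neqE_nat transverse_def)
    then have "inj (\<lambda>n. (g ^^ n) ` h2)"
      by (intro injI) (metis Compl_disjoint transverse_def)
    then have "infinite (range (\<lambda>n. (g ^^ n) ` h2))" using finite_imageD infinite_UNIV_nat by blast
    moreover have "finite (range (\<lambda>n. (g ^^ n) ` h2))"
    proof (rule dim_leD(1)[OF N])
      show "range (\<lambda>n. (g ^^ n) ` h2) \<subseteq> H" using und by (auto simp: undecided_def)
      show "transverse h k" if hk: "h \<in> range (\<lambda>n. (g ^^ n) ` h2)"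
        "k \<in> range (\<lambda>n. (g ^^ n) ` h2)" "h \<noteq> k" for h k
      proof -
        obtain i where i: "h = (g ^^ i) ` h2" using hk(1) by blast
        obtain j where "k = (g ^^ j) ` h2" using hk(2) by blast
        with i show ?thesis using tr[of i j] hk(3) by metis
      qed
    qed
    ultimately show False by blast
  qed
  then obtain i p where ip: "\<not> transverse ((g ^^ i) ` h2) ((g ^^ (i + Suc p)) ` h2)"
    by (metis less_iff_Suc_add add_Suc_right)
  let ?k = "(g ^^ Suc p) ` h2"
  have gi: "g ^^ i \<in> aut adj" using subgroupD(1)[OF G gn] .
  \<comment> \<open>Transversality is invariant under \<open>g ^^ i\<close>, so the pair can be
    moved back to \<open>h2\<close> and a positive power. Positivity of the exponent places
    \<open>?k\<close> inside \<open>h0\<close>.\<close>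
  have "(g ^^ (i + Suc p)) ` h2 = (g ^^ i) ` ?k" by (simp only: funpow_add image_comp)
  then have nt: "\<not> transverse h2 ?k"
    using ip unfolding transverse_def
    by (simp only: aut_image_Int[OF gi, symmetric] aut_image_Compl[OF gi, symmetric] image_is_empty) simp
  have k: "?k \<in> undecided W" "?k \<subseteq> h0" using und sub[of p] h(5) by blast+
  \<comment> \<open>If \<open>h2\<close> and \<open>?k\<close> were disjoint, they would form a
    facing triple with \<open>- h1\<close>.\<close>
  have "?k \<subseteq> h1" "- h1 \<in> undecided W" using k(2) h undecided_compl by auto
  moreover from this have "h2 \<inter> - h1 = {}" "?k \<inter> - h1 = {}" using h(5) by auto
  ultimately have "h2 \<inter> ?k \<noteq> {}" using no_triple h(3) k(1) by meson
  moreover have "- h1 \<noteq> {}" using h(2) halfspace_nonempty(2) by (auto simp: undecided_def)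
  ultimately have ne: "- h1 \<noteq> {}" "h2 \<inter> ?k \<noteq> {}" by simp_all
  then have "- h2 \<inter> - ?k \<noteq> {}" using h k by blast
  then consider "h2 \<subseteq> ?k" | "?k \<subseteq> h2" using nested_or_transverse[OF ne(2)] nt by blast
  then show thesis
  proof cases
    case 1
    then show ?thesis using that[OF h(3)] k by blast
  next
    case 2
    then show ?thesis using that[OF k(1)] k by blast
  qed
qed

lemma no_facing_triple_interval:
  assumes fd: "finite_dim adj"
    and no_triple: "\<not> (\<exists>h\<in>undecided W. \<exists>k\<in>undecided W. \<exists>l\<in>undecided W.
      h \<inter> k = {} \<and> h \<inter> l = {} \<and> k \<inter> l = {})"
  shows "preserves_interval adj \<Gamma>"
proof -
  define cls where "cls h = {k \<in> undecided W. \<exists>l\<in>undecided W. l \<subseteq> h \<inter> k}" for h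
  have nested: "cls h = cls k" if hk: "h \<in> undecided W" "k \<in> undecided W" "h \<subseteq> k" for h k
  proof -
    have "m \<in> cls h" if m: "m \<in> cls k" for m
    proof -
      obtain l where l: "l \<in> undecided W" "l \<subseteq> k" "l \<subseteq> m" using m by (auto simp: cls_def)
      \<comment> \<open>Both \<open>l\<close> and \<open>h\<close> lie in \<open>k\<close>, so they
        have a common lower bound, and it lies in \<open>m\<close> because \<open>l\<close>
        does.\<close>
      obtain l' where "l' \<in> undecided W" "l' \<subseteq> l \<inter> h"
        using common_lower_bound[OF fd no_triple l(1) hk(2) hk(1) l(2) hk(3)] by blast
      then show ?thesis using m l(3) by (auto simp: cls_def)
    qed
    moreover have "cls h \<subseteq> cls k" using hk(3) unfolding cls_def by blast
    ultimately show ?thesis by blast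
  qed
  have compl: "cls h \<noteq> cls (- h)" if h: "h \<in> undecided W" for h
  proof -
    have "h \<in> cls h" using h by (auto simp: cls_def)
    moreover have "h \<notin> cls (- h)"
      using halfspace_nonempty(1) by (auto simp: cls_def undecided_def)
    ultimately show ?thesis by blast
  qed
  obtain a b where "a \<in> roller adj" "b \<in> roller adj" "a \<inter> b = W"
    by (rule interval_of_classes[OF W, of cls]) (erule nested compl; assumption)+
  then show ?thesis using preserves_interval_if_invariant[OF G, of a b] inv by simp
qed

end

lemma free_action_if_no_interval:
  assumes G: "aut_subgroup adj \<Gamma>" and fd: "finite_dim adj" and no: "\<not> preserves_interval adj \<Gamma>"
  shows "has_free_nonabelian_free_action \<Gamma>"
proof -
  obtain W where W: "pairwise_meeting W" "\<forall>g\<in>\<Gamma>. ract g W \<subseteq> W"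
    "\<forall>W'. pairwise_meeting W' \<longrightarrow> (\<forall>g\<in>\<Gamma>. ract g W' \<subseteq> W') \<longrightarrow> W \<subseteq> W' \<longrightarrow> W' = W"
    using maximal_invariant_family[OF G] by blast
  have flip: "\<forall>h\<in>undecided W. \<exists>g\<in>\<Gamma>. g ` (- h) \<subseteq> h" using flip_exists[OF G W] by blast
  show ?thesis
    using no_facing_triple_interval[OF G W(1,2) flip fd] facing_triple_free_action[OF G W(1,2) flip] no
    by blast
qed

end

section \<open>Growth of intervals\<close>

text \<open>A small subset is listed by a word of length exactly \<open>k\<close>, padded with the
  dummy letter \<open>z\<close> from outside \<open>A\<close>.\<close>

lemma card_subsets_le:
  assumes "finite A" "card A \<le> m" "z \<notin> A"
  shows "finite {T. T \<subseteq> A \<and> card T \<le> k}" "card {T. T \<subseteq> A \<and> card T \<le> k} \<le> (m + 1) ^ k"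
proof -
  let ?L = "{xs. set xs \<subseteq> insert z A \<and> length xs = k}"
  have sub: "{T. T \<subseteq> A \<and> card T \<le> k} \<subseteq> (\<lambda>xs. set xs \<inter> A) ` ?L"
  proof safe
    fix T assume T: "T \<subseteq> A" "card T \<le> k"
    obtain xs where xs: "set xs = T" "distinct xs"
      using finite_distinct_list T(1) assms(1) finite_subset by metis
    then have "length xs \<le> k" using T(2) distinct_card by metis
    then have "xs @ replicate (k - length xs) z \<in> ?L" using xs T(1) by auto
    moreover have "T = set (xs @ replicate (k - length xs) z) \<inter> A"
      using xs T(1) assms(3) by auto
    ultimately show "T \<in> (\<lambda>xs. set xs \<inter> A) ` ?L" by blast
  qed
  have fin: "finite ?L" using assms(1) by (simp add: finite_lists_length_eq)
  then show "finite {T. T \<subseteq> A \<and> card T \<le> k}" 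
    using finite_subset[OF sub] by blast
  have "card {T. T \<subseteq> A \<and> card T \<le> k} \<le> card ?L" using surj_card_le[OF fin sub] .
  also have "\<dots> = (card A + 1) ^ k"
    using assms(1,3) by (simp add: card_lists_length_eq)
  also have "\<dots> \<le> (m + 1) ^ k" using assms(2) by (intro power_mono) auto
  finally show "card {T. T \<subseteq> A \<and> card T \<le> k} \<le> (m + 1) ^ k" .
qed

lemma poly_less_exponential: "\<exists>n. C * (A * n + 1) ^ k < (2::nat) ^ n"
proof -
  define D where "D = C * (A + 1) ^ k"
  have "((\<lambda>n. (real n + 1) ^ k / 2 ^ n) \<longlongrightarrow> 0) at_top"
    by real_asymp
  then have "((\<lambda>n. real D * ((real n + 1) ^ k / 2 ^ n)) \<longlongrightarrow> real D * 0) at_top"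
    by (rule tendsto_mult_left)
  then have "eventually (\<lambda>n. real D * ((real n + 1) ^ k / 2 ^ n) < 1) at_top"
    by (rule order_tendstoD) auto
  then obtain n where "real D * ((real n + 1) ^ k / 2 ^ n) < 1"
    by (auto simp: eventually_at_top_linorder)
  then have "real (D * (n + 1) ^ k) < real (2 ^ n)" by (simp add: field_simps)
  then have "D * (n + 1) ^ k < 2 ^ n" unfolding of_nat_less_iff .
  moreover have "(A * n + 1) ^ k \<le> ((A + 1) * (n + 1)) ^ k" by (rule power_mono) auto
  then have "C * (A * n + 1) ^ k \<le> D * (n + 1) ^ k"
    unfolding power_mult_distrib D_def mult.assoc by (rule mult_left_mono) simp
  ultimately show ?thesis by (meson le_less_trans)
qed

context median_gr
begin

text \<open>The vertices of the interval between \<open>U x\<close> and \<xi>.\<close>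

definition ray :: "'v set set \<Rightarrow> 'v \<Rightarrow> 'v set" where
  "ray \<xi> x = {v. U x \<inter> \<xi> \<subseteq> U v}"

definition ray_ball :: "'v set set \<Rightarrow> 'v \<Rightarrow> nat \<Rightarrow> 'v set" where
  "ray_ball \<xi> x n = {v \<in> ray \<xi> x. d x v \<le> n}"

lemma ray_diff_subset:
  assumes xi: "\<xi> \<in> roller adj" and v: "v \<in> ray \<xi> x"
  shows "U v - U x \<subseteq> \<xi> - U x"
proof
  fix h assume h: "h \<in> U v - U x"
  then have hH: "h \<in> H" using U_sub by blast
  have "- h \<in> U x" "- h \<notin> U v" using h hH U_compl by auto
  then have "- h \<notin> \<xi>" using v by (auto simp: ray_def)
  then show "h \<in> \<xi> - U x" using rollerD(2)[OF xi hH] h by blast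
qed

lemma U_eq_if_diff_eq:
  assumes "U v - U x = U w - U x"
  shows "v = w"
proof -
  have "h \<in> U v \<longleftrightarrow> h \<in> U w" for h
  proof (cases "h \<in> U x")
    case True
    then have h: "h \<in> H" "- h \<notin> U x" using U_sub U_compl by auto
    then have "- h \<in> U v \<longleftrightarrow> - h \<in> U w" using assms by blast
    then show ?thesis using U_compl[OF h(1)] by blast
  qed (use assms in blast)
  then show ?thesis using U_inj by blast
qed

text \<open>Both half-spaces contain \<xi> and both complements contain \<open>x\<close>, so
  inclusion is the only alternative to transversality. This is how the dimension bounds antichains
  along a ray.\<close>

lemma transverse_in_diff:
  assumes xi: "\<xi> \<in> roller adj" and hk: "h \<in> \<xi> - U x" "k \<in> \<xi> - U x" "\<not> h \<subseteq> k" "\<not> k \<subseteq> h"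
  shows "transverse h k"
proof -
  have "x \<in> - h" "x \<in> - k" using hk rollerD(1)[OF xi] by (auto simp: Uv_def)
  then have "- h \<inter> - k \<noteq> {}" by blast
  then show ?thesis
    using nested_or_transverse[OF rollerD(3)[OF xi, of h k]] hk by blast
qed

text \<open>A vertex of the ray is determined by the minimal elements of \<open>U v - U x\<close>, which form an
  antichain of half-spaces of height at most \<open>d x v\<close>; the half-spaces of a given height again
  form an antichain.\<close>

lemma ray_ball_growth:
  assumes N: "dim_le N" and xi: "\<xi> \<in> roller adj"
  shows "finite (ray_ball \<xi> x n)" "card (ray_ball \<xi> x n) \<le> (N * n + 1) ^ N"
proof -
  define P where "P = \<xi> - U x"
  have PH: "P \<subseteq> H" using rollerD(1)[OF xi] by (auto simp: P_def)
  have tr: "transverse h k" if "h \<in> P" "k \<in> P" "\<not> h \<subseteq> k" "\<not> k \<subseteq> h" for h k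
    using transverse_in_diff[OF xi] that by (auto simp: P_def)
  define up where "up h = {k \<in> P. h \<subseteq> k}" for h
  have fin_up: "finite (up h)" if "h \<in> P" for h
  proof -
    have "h \<noteq> {}" using halfspace_nonempty(1) that PH by blast
    then obtain y where "y \<in> h" by blast
    then have "up h \<subseteq> {k \<in> H. y \<in> k \<and> x \<notin> k}" using PH by (auto simp: up_def P_def Uv_def)
    then show ?thesis by (rule finite_subset[OF _ finite_sep])
  qed
  define L where "L j = {h \<in> P. card (up h) = j}" for j
  have L: "finite (L j)" "card (L j) \<le> N" for j
  proof -
    have "transverse h k" if "h \<in> L j" "k \<in> L j" "h \<noteq> k" for h k
    proof -
      have lt: "card (up b) < card (up a)" if "a \<in> P" "b \<in> P" "a \<subset> b" for a b
        using that fin_up[OF that(1)] by (intro psubset_card_mono) (auto simp: up_def)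
      show ?thesis using tr[of h k] lt[of h k] lt[of k h] that by (auto simp: L_def)
    qed
    moreover have "L j \<subseteq> H" using PH by (auto simp: L_def)
    ultimately show "finite (L j)" "card (L j) \<le> N" using dim_leD[OF N] by metis+
  qed
  define A where "A = (\<Union>j\<in>{1..n}. L j)"
  have finA: "finite A" using L by (auto simp: A_def)
  have "card A \<le> (\<Sum>j\<in>{1..n}. card (L j))" unfolding A_def by (rule card_UN_le) simp
  also have "\<dots> \<le> (\<Sum>j\<in>{1..n}. N)" by (rule sum_mono) (rule L)
  finally have cardA: "card A \<le> N * n" by (simp add: mult.commute)
  \<comment> \<open>\<open>UNIV\<close> is not a half-space and serves as padding letter in
    \<open>card_subsets_le\<close>.\<close>
  have UNIVA: "UNIV \<notin> A" using PH by (auto simp: A_def L_def halfspaces_def)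
  define mins where "mins v = {h \<in> U v - U x. \<forall>k\<in>U v - U x. k \<subseteq> h \<longrightarrow> k = h}" for v
  have SP: "U v - U x \<subseteq> P" if "v \<in> ray_ball \<xi> x n" for v
    using ray_diff_subset[OF xi, of v x] that by (auto simp: P_def ray_ball_def)
  \<comment> \<open>A member of \<open>P\<close> above \<open>h\<close> contains \<open>v\<close>
    and misses \<open>x\<close>; hence the height of \<open>h\<close> is at most
    \<open>d x v\<close>.\<close>
  have up_sub: "up h \<subseteq> U v - U x" if "h \<in> U v - U x" for h v
    using that PH by (auto simp: up_def P_def Uv_def)
  have mins: "mins v \<in> {T. T \<subseteq> A \<and> card T \<le> N}" if v: "v \<in> ray_ball \<xi> x n" for v
  proof -
    have "mins v \<subseteq> A"
    proof
      fix h assume "h \<in> mins v"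
      then have h: "h \<in> U v - U x" by (auto simp: mins_def)
      then have hP: "h \<in> P" using SP[OF v] by blast
      have "card (up h) \<le> card (U v - U x)" by (intro card_mono finite_U_diff up_sub h)
      also have "\<dots> \<le> n" using v by (simp add: card_U_diff d_sym ray_ball_def)
      finally have "card (up h) \<le> n" .
      moreover have "h \<in> up h" using hP by (simp add: up_def)
      then have "card (up h) \<ge> 1" using fin_up[OF hP] by (metis One_nat_def Suc_leI card_gt_0_iff empty_iff)
      ultimately show "h \<in> A" using hP by (auto simp: A_def L_def)
    qed
    moreover have "card (mins v) \<le> N"
    proof (rule dim_leD(2)[OF N])
      show "mins v \<subseteq> H" using U_sub by (auto simp: mins_def)
      fix h k assume "h \<in> mins v" "k \<in> mins v" "h \<noteq> k"
      then show "transverse h k" using SP[OF v] by (intro tr) (auto simp: mins_def)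
    qed
    ultimately show ?thesis by blast
  qed
  \<comment> \<open>\<open>U v - U x\<close> is recovered as the upward closure in \<open>P\<close>
    of its minimal elements.\<close>
  have inj: "inj_on mins (ray_ball \<xi> x n)"
  proof (rule inj_onI)
    fix v w assume v: "v \<in> ray_ball \<xi> x n" and w: "w \<in> ray_ball \<xi> x n" and eq: "mins v = mins w"
    have *: "U v - U x \<subseteq> U w - U x" if "v \<in> ray_ball \<xi> x n" "mins v = mins w" for v w
    proof
      fix h assume h: "h \<in> U v - U x"
      obtain m where m: "m \<in> U v - U x" "m \<subseteq> h" "\<forall>k\<in>U v - U x. k \<subseteq> m \<longrightarrow> m = k"
        using finite_has_minimal2[OF finite_U_diff h] by blast
      then have "m \<in> mins v" by (auto simp: mins_def)
      then have "m \<in> U w - U x" using that(2) by (auto simp: mins_def)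
      moreover have "h \<in> up m" using m(2) h SP[OF that(1)] by (auto simp: up_def)
      ultimately show "h \<in> U w - U x" using up_sub by blast
    qed
    have "U v - U x = U w - U x" using *[OF v eq] *[OF w eq[symmetric]] by blast
    then show "v = w" by (rule U_eq_if_diff_eq)
  qed
  have sub: "mins ` ray_ball \<xi> x n \<subseteq> {T. T \<subseteq> A \<and> card T \<le> N}"
    by (rule image_subsetI) (rule mins)
  note cs = card_subsets_le[OF finA cardA UNIVA, of N]
  show "finite (ray_ball \<xi> x n)" using inj_on_finite[OF inj sub cs(1)] .
  have "card (ray_ball \<xi> x n) \<le> card {T. T \<subseteq> A \<and> card T \<le> N}"
    using card_inj_on_le[OF inj sub cs(1)] .
  then show "card (ray_ball \<xi> x n) \<le> (N * n + 1) ^ N" using cs(2) by linarith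
qed

text \<open>\<xi> is replaced by a vertex \<open>z\<close> on the same side of the finitely many
  walls between \<open>x\<close> and \<open>y\<close>. A half-space containing both \<open>x\<close>
  and \<open>y\<close> contains \<open>m\<close> anyway.\<close>

lemma median_with_roller_point:
  assumes xi: "\<xi> \<in> roller adj"
  obtains m where "m \<in> ray \<xi> x" "m \<in> ray \<xi> y" "m \<in> gint adj x y"
proof -
  define F where "F = {h \<in> H. x \<in> h \<and> y \<notin> h} \<union> {h \<in> H. y \<in> h \<and> x \<notin> h}"
  have "finite F" "F \<subseteq> H" using finite_sep by (auto simp: F_def)
  then obtain z where z: "U z \<inter> F = \<xi> \<inter> F" by (rule roller_approx[OF xi])
  obtain m where m: "m \<in> gint adj x y" "m \<in> gint adj y z" "m \<in> gint adj x z"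
    using median_ex1 by metis
  have *: "h \<in> U m" if h: "h \<in> U u \<inter> \<xi>" "u \<in> {x, y}" "w \<in> {x, y}" "u \<noteq> w" for h u w
  proof -
    have hH: "h \<in> H" "u \<in> h" using h by (auto simp: Uv_def)
    have "m \<in> h"
    proof (cases "w \<in> h")
      case True
      then have "x \<in> h" "y \<in> h" using hH h by auto
      then show ?thesis using halfspace_convex[OF hH(1) _ _ m(1)] by blast
    next
      case False
      then have "h \<in> F" using hH h by (auto simp: F_def)
      then have "z \<in> h" using z h by (auto simp: Uv_def)
      then show ?thesis using halfspace_convex[OF hH(1,2)] m h(2) by auto
    qed
    then show ?thesis using hH by (simp add: Uv_def)
  qed
  show thesis
  proof (cases "x = y")
    case True
    then show ?thesis by (intro that[of x]) (auto simp: ray_def gint_iff)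
  next
    case False
    then show ?thesis using *[of _ x y] *[of _ y x] m(1) by (intro that[of m]) (auto simp: ray_def)
  qed
qed

lemma ract_ray:
  assumes "g \<in> aut adj"
  shows "g v \<in> ray (ract g \<xi>) (g x) \<longleftrightarrow> v \<in> ray \<xi> x"
proof -
  have "ract g (U x \<inter> \<xi>) \<subseteq> ract g (U v) \<longleftrightarrow> U x \<inter> \<xi> \<subseteq> U v"
    using ract_mono ract_ract_inv(2)[OF assms] by metis
  then show ?thesis by (simp add: ray_def ract_Int[OF assms] ract_U[OF assms])
qed

section \<open>Free actions have infinite orbits\<close>

text \<open>Inverting \<open>vs\<close> reverses it, so the only place where letters could cancel is
  between the two last letters.\<close>

lemma reduced_positive_negative:
  assumes "us \<noteq> [] \<Longrightarrow> vs \<noteq> [] \<Longrightarrow> last us \<noteq> last vs"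
  shows "reduced_word (map (\<lambda>s. (s, True)) us @ map (\<lambda>s. (s, False)) (rev vs))"
proof -
  have "successively (\<lambda>_ _. True) xs" for xs :: "'b list" by (induction xs rule: induct_list012) auto
  then show ?thesis
    using assms
    by (auto simp: reduced_word_iff successively_append_iff successively_map last_map hd_map hd_rev)
qed

lemma word_eval_inverse:
  assumes "set vs \<subseteq> aut adj"
  shows "word_eval (map (\<lambda>s. (s, False)) (rev vs)) = inv (word_eval (map (\<lambda>s. (s, True)) vs))"
  using assms
proof (induction vs)
  case (Cons v vs)
  have "word_eval (map (\<lambda>s. (s, True)) vs) \<in> aut adj"
    using Cons.prems by (induction vs) (auto simp: aut_id aut_comp simp del: comp_apply)
  then show ?case
    using Cons by (simp add: o_inv_distrib[symmetric] autD(1) bij_is_surj del: comp_apply)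
qed simp

lemma free_action_infinite_orbits:
  assumes G: "aut_subgroup adj \<Gamma>" and fd: "finite_dim adj"
    and free: "has_free_nonabelian_free_action \<Gamma>" and xi: "\<xi> \<in> roller adj"
  shows "infinite ((\<lambda>g. ract g \<xi>) ` \<Gamma>)"
proof
  let ?O = "(\<lambda>g. ract g \<xi>) ` \<Gamma>"
  assume fin: "finite ?O"
  obtain N where N: "dim_le N" using finite_dimE[OF fd] .
  obtain S s t where S: "S \<subseteq> \<Gamma>" and st: "s \<in> S" "t \<in> S" "s \<noteq> t"
    and red: "\<forall>w. w \<noteq> [] \<and> set (map fst w) \<subseteq> S \<and> reduced_word w \<longrightarrow> word_eval w \<noteq> id"
    and nofix: "\<forall>w. set (map fst w) \<subseteq> S \<and> word_eval w \<noteq> id \<longrightarrow> (\<forall>v. word_eval w v \<noteq> v)"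
    using free unfolding has_free_nonabelian_free_action_def by metis
  define ev where "ev xs = word_eval (map (\<lambda>s. (s, True)) xs)" for xs :: "('v \<Rightarrow> 'v) list"
  have ev_G: "ev xs \<in> \<Gamma>" if "set xs \<subseteq> S" for xs
    unfolding ev_def using that S by (intro word_eval_subgroup[OF G]) auto
  have ev_aut: "ev xs \<in> aut adj" if "set xs \<subseteq> S" for xs
    using ev_G[OF that] subgroupD(1)[OF G] by blast
  have quot: "word_eval (map (\<lambda>s. (s, True)) xs @ map (\<lambda>s. (s, False)) (rev ys)) = ev xs \<circ> inv (ev ys)"
    if "set ys \<subseteq> S" for xs ys
  proof -
    have "set ys \<subseteq> aut adj" using that S subgroupD(1)[OF G] by blast
    then show ?thesis by (simp add: word_eval_inverse ev_def)
  qed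
  \<comment> \<open>Equal last letters are stripped; different ones make the quotient of the two
    words a nonempty reduced word.\<close>
  have ev_neq: "ev xs \<noteq> ev ys" if "length xs = length ys" "set xs \<subseteq> S" "set ys \<subseteq> S" "xs \<noteq> ys" for xs ys
    using that
  proof (induction xs ys rule: rev_induct2)
    case (4 x xs y ys)
    show ?case
    proof (cases "x = y")
      case True
      have "surj x" using 4 True S subgroupD(1)[OF G] autD(1) bij_is_surj by (metis insert_subset list.simps(15) set_append subsetD le_sup_iff)
      have "ev xs \<noteq> ev ys" using 4 True by auto
      then obtain v where v: "ev xs v \<noteq> ev ys v" by blast
      obtain u where "v = x u" using \<open>surj x\<close> by blast
      then have "ev (xs @ [x]) u \<noteq> ev (ys @ [y]) u" using v True by (simp add: ev_def)
      then show ?thesis by metis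
    next
      case False
      let ?w = "map (\<lambda>s. (s, True)) (xs @ [x]) @ map (\<lambda>s. (s, False)) (rev (ys @ [y]))"
      have "reduced_word ?w" using False by (intro reduced_positive_negative) simp
      then have "word_eval ?w \<noteq> id" using red 4 by (intro red[rule_format]) auto
      then have "ev (xs @ [x]) \<circ> inv (ev (ys @ [y])) \<noteq> id" using quot 4 by metis
      then show ?thesis
        using inv_cancel(1)[OF autD(1)[OF ev_aut[OF 4(4)]]] by (metis comp_apply eq_id_iff)
    qed
  qed auto
  fix x :: 'v
  \<comment> \<open>The larger displacement of \<open>x\<close> by a generator, so that a word of
    length \<open>n\<close> moves \<open>x\<close> by at most \<open>L * n\<close>.\<close>
  define L where "L = max (d x (s x)) (d x (t x))"
  have dist: "d x (ev xs x) \<le> L * length xs" if "set xs \<subseteq> {s, t}" for xs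
    using that
  proof (induction xs)
    case (Cons a xs)
    have a: "a \<in> aut adj" using Cons.prems st S subgroupD(1)[OF G] by auto
    have "d x (ev (a # xs) x) \<le> d x (a x) + d (a x) (a (ev xs x))"
      using d_triangle by (simp add: ev_def)
    also have "\<dots> = d x (a x) + d x (ev xs x)" using aut_dist[OF a] by simp
    also have "d x (a x) \<le> L" using Cons.prems by (auto simp: L_def)
    finally show ?case using Cons by simp
  qed (simp add: ev_def)
  \<comment> \<open>Each of the two vertices contributes a factor of degree \<open>N\<close>; the
    second one ranges over rays to all points of the orbit, whence \<open>card ?O\<close>.\<close>
  have bound: "2 ^ n \<le> card ?O * (N * L * n + 1) ^ (N + N)" for n
  proof -
    let ?X = "{xs. set xs \<subseteq> {s, t} \<and> length xs = n}"
    let ?B = "\<lambda>\<zeta>. ray_ball \<zeta> x (L * n)"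
    have O: "\<zeta> \<in> roller adj" if "\<zeta> \<in> ?O" for \<zeta>
      using that ract_roller xi subgroupD(1)[OF G] by auto
    have B: "finite (?B \<zeta>)" "card (?B \<zeta>) \<le> (N * L * n + 1) ^ N" if "\<zeta> \<in> roller adj" for \<zeta>
      using ray_ball_growth[OF N that, of x "L * n"] by (simp_all add: mult.assoc)
    have "\<exists>m. m \<in> ?B \<xi> \<and> inv (ev xs) m \<in> (\<Union>\<zeta>\<in>?O. ?B \<zeta>)" if xs: "xs \<in> ?X" for xs
    proof -
      let ?g = "ev xs"
      have gS: "set xs \<subseteq> S" "?g \<in> aut adj" "inv ?g \<in> \<Gamma>"
        using xs st ev_aut ev_G subgroupD(4)[OF G] by auto
      have ig: "inv ?g \<in> aut adj" using gS aut_inv by blast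
      have dx: "d x (?g x) \<le> L * n" using dist xs by auto
      obtain m where m: "m \<in> ray \<xi> x" "m \<in> ray \<xi> (?g x)" "m \<in> gint adj x (?g x)"
        by (rule median_with_roller_point[OF xi])
      have "m \<in> ?B \<xi>" using m dx by (auto simp: ray_ball_def gint_iff)
      moreover have gx: "inv ?g (?g x) = x" using inv_cancel(2)[OF autD(1)[OF gS(2)]] .
      have "inv ?g m \<in> ray (ract (inv ?g) \<xi>) x"
        using ract_ray[OF ig, of m \<xi> "?g x"] m(2) gx by simp
      moreover have "d x (inv ?g m) = d (?g x) m"
        using aut_dist[OF ig, of "?g x" m] gx by simp
      then have "d x (inv ?g m) \<le> L * n" using m(3) dx by (simp add: gint_iff d_sym)
      ultimately show ?thesis using gS(3) by (auto simp: ray_ball_def)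
    qed
    then have "\<forall>xs\<in>?X. \<exists>m. m \<in> ?B \<xi> \<and> inv (ev xs) m \<in> (\<Union>\<zeta>\<in>?O. ?B \<zeta>)" by (rule ballI)
    from bchoice[OF this] obtain m where
      m: "\<forall>xs\<in>?X. m xs \<in> ?B \<xi> \<and> inv (ev xs) (m xs) \<in> (\<Union>\<zeta>\<in>?O. ?B \<zeta>)" ..
    let ?f = "\<lambda>xs. (m xs, inv (ev xs) (m xs))"
    \<comment> \<open>If two words yield the same pair, then
      \<open>ev xs \<circ> inv (ev ys)\<close> fixes \<open>m xs\<close>; it is not the identity,
      against freeness of the action.\<close>
    have "inj_on ?f ?X"
    proof (rule inj_onI, rule ccontr)
      fix xs ys assume xs: "xs \<in> ?X" and ys: "ys \<in> ?X" and eq: "?f xs = ?f ys" and ne: "xs \<noteq> ys"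
      have S': "set xs \<subseteq> S" "set ys \<subseteq> S" using xs ys st by auto
      note bij = autD(1)[OF ev_aut[OF S'(1)]] autD(1)[OF ev_aut[OF S'(2)]]
      let ?w = "map (\<lambda>s. (s, True)) xs @ map (\<lambda>s. (s, False)) (rev ys)"
      have "ev xs \<noteq> ev ys" using ev_neq xs ys S' ne by auto
      then obtain v where "ev xs v \<noteq> ev ys v" by blast
      then have "word_eval ?w (ev ys v) \<noteq> ev ys v"
        unfolding quot[OF S'(2)] using inv_cancel(2)[OF bij(2)] by simp
      then have "word_eval ?w \<noteq> id" by (metis id_apply)
      moreover have "set (map fst ?w) \<subseteq> S" using S' by auto
      ultimately have "word_eval ?w (m xs) \<noteq> m xs" using nofix by blast
      moreover have "inv (ev ys) (m xs) = inv (ev xs) (m xs)" using eq by auto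
      then have "word_eval ?w (m xs) = m xs"
        unfolding quot[OF S'(2)] using inv_cancel(1)[OF bij(1)] by simp
      ultimately show False by blast
    qed
    moreover have "?f ` ?X \<subseteq> ?B \<xi> \<times> (\<Union>\<zeta>\<in>?O. ?B \<zeta>)"
    proof (rule image_subsetI)
      show "?f xs \<in> ?B \<xi> \<times> (\<Union>\<zeta>\<in>?O. ?B \<zeta>)" if "xs \<in> ?X" for xs
        using bspec[OF m that] by (simp only: mem_Times_iff fst_conv snd_conv)
    qed
    moreover have finB: "finite (?B \<xi>)" "finite (\<Union>\<zeta>\<in>?O. ?B \<zeta>)" using B xi O fin by blast+
    ultimately have "card ?X \<le> card (?B \<xi> \<times> (\<Union>\<zeta>\<in>?O. ?B \<zeta>))" by (intro card_inj_on_le) auto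
    also have "\<dots> = card (?B \<xi>) * card (\<Union>\<zeta>\<in>?O. ?B \<zeta>)" by (rule card_cartesian_product)
    also have "\<dots> \<le> (N * L * n + 1) ^ N * (card ?O * (N * L * n + 1) ^ N)"
    proof (rule mult_mono)
      have "card (\<Union>\<zeta>\<in>?O. ?B \<zeta>) \<le> (\<Sum>\<zeta>\<in>?O. card (?B \<zeta>))" using fin by (rule card_UN_le)
      also have "\<dots> \<le> (\<Sum>\<zeta>\<in>?O. (N * L * n + 1) ^ N)" using B(2) O by (intro sum_mono) auto
      finally show "card (\<Union>\<zeta>\<in>?O. ?B \<zeta>) \<le> card ?O * (N * L * n + 1) ^ N" by simp
    qed (use B(2)[OF xi] in auto)
    also have "card ?X = 2 ^ n"
      using card_lists_length_eq[of "{s, t}" n] st(3) by (simp add: numeral_2_eq_2)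
    finally show ?thesis by (simp add: power_add algebra_simps)
  qed
  obtain n where "card ?O * (N * L * n + 1) ^ (N + N) < 2 ^ n"
    using poly_less_exponential by blast
  then show False using bound[of n] by linarith
qed

end

section \<open>Amenability\<close>

lemma sum_Pow_power:
  fixes a :: "'a :: comm_ring_1"
  assumes "finite B"
  shows "(\<Sum>A\<in>Pow B. a ^ card A) = (1 + a) ^ card B"
proof -
  have "(\<Prod>x\<in>B. a + 1) = (\<Sum>A\<in>Pow B. (\<Prod>x\<in>A. a) * (\<Prod>x\<in>B - A. 1))"
    using assms by (rule prod_add)
  then show ?thesis by (simp add: add.commute)
qed

lemma summable_poly_times_geometric:
  fixes z :: real
  assumes z: "0 < z" "z < 1"
  shows "summable (\<lambda>n. real ((A * n + 1) ^ k) * z ^ n)"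
proof -
  have "summable (\<lambda>n. (real n + 1) ^ k * z ^ n)"
  proof -
    have "((\<lambda>n. ((real n + 2) / (real n + 1)) ^ k * z) \<longlongrightarrow> 1 ^ k * z) at_top"
      by (intro tendsto_intros) real_asymp
    then have "eventually (\<lambda>n. ((real n + 2) / (real n + 1)) ^ k * z < (1 + z) / 2) at_top"
      by (rule order_tendstoD) (use z in simp)
    then obtain M where M: "\<And>n. n \<ge> M \<Longrightarrow> ((real n + 2) / (real n + 1)) ^ k * z < (1 + z) / 2"
      by (auto simp: eventually_at_top_linorder)
    show ?thesis
    proof (rule summable_ratio_test[of "(1 + z) / 2" M])
      fix n assume n: "M \<le> n"
      have "(real (Suc n) + 1) ^ k * z ^ Suc n =
          (((real n + 2) / (real n + 1)) ^ k * z) * ((real n + 1) ^ k * z ^ n)"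
        by (simp add: power_divide add.commute)
      also have "\<dots> \<le> (1 + z) / 2 * ((real n + 1) ^ k * z ^ n)"
        using M[OF n] z by (intro mult_right_mono) auto
      finally show "norm ((real (Suc n) + 1) ^ k * z ^ Suc n) \<le> (1 + z) / 2 * norm ((real n + 1) ^ k * z ^ n)"
        using z by simp
    qed (use z in simp)
  qed
  then have "summable (\<lambda>n. real ((A + 1) ^ k) * ((real n + 1) ^ k * z ^ n))"
    by (rule summable_mult)
  then show ?thesis
  proof (rule summable_comparison_test'[where N = 0])
    fix n :: nat
    have "(A * n + 1) ^ k \<le> ((A + 1) * (n + 1)) ^ k" by (rule power_mono) auto
    then have "real ((A * n + 1) ^ k) \<le> real ((A + 1) ^ k) * (real n + 1) ^ k"
      unfolding power_mult_distrib by (metis Suc_eq_plus1 of_nat_Suc of_nat_le_iff of_nat_mult of_nat_power add.commute)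
    then show "norm (real ((A * n + 1) ^ k) * z ^ n) \<le> real ((A + 1) ^ k) * ((real n + 1) ^ k * z ^ n)"
      using z mult_right_mono[of "real ((A * n + 1) ^ k)" "real ((A + 1) ^ k) * (real n + 1) ^ k" "z ^ n"]
      by (simp add: mult.assoc)
  qed
qed

text \<open>Zorn's lemma for the reversed order: what holds eventually for the infimum of a chain
  already does so for a member, so the infimum stays proper.\<close>

lemma exists_ultrafilter:
  assumes "F \<noteq> bot"
  obtains G where "G \<le> F" "G \<noteq> bot" "\<And>P. eventually P G \<or> eventually (\<lambda>x. \<not> P x) G"
proof -
  let ?A = "{G. G \<le> F \<and> G \<noteq> bot}"
  let ?P = "\<lambda>G H :: 'a filter. H \<le> G"
  have "\<exists>G\<in>?A. \<forall>H\<in>?A. ?P G H \<longrightarrow> H = G"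
  proof (rule predicate_Zorn)
    show "partial_order_on ?A (relation_of ?P ?A)"
      by (rule partial_order_on_relation_ofI) auto
    fix C assume C: "C \<in> Chains (relation_of ?P ?A)"
    then have CA: "C \<subseteq> ?A" by (auto simp: Chains_def relation_of_def)
    have lin: "G \<le> H \<or> H \<le> G" if "G \<in> C" "H \<in> C" for G H
      using C that by (auto simp: Chains_def relation_of_def)
    show "\<exists>U\<in>?A. \<forall>G\<in>C. U \<le> G"
    proof (cases "C = {}")
      case True
      then show ?thesis using assms by blast
    next
      case False
      have "eventually P (Inf C) \<longleftrightarrow> (\<exists>G\<in>C. eventually P G)" for P
        using False lin by (intro eventually_Inf_base) (metis inf.absorb1 inf.absorb2 order_refl)+
      then have "Inf C \<noteq> bot" using CA by (auto simp: trivial_limit_def)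
      moreover obtain G where "G \<in> C" using False by blast
      then have "Inf C \<le> F" using CA by (blast intro: Inf_lower2)
      ultimately show ?thesis by (auto intro: Inf_lower)
    qed
  qed
  then obtain G where G: "G \<le> F" "G \<noteq> bot" and max: "\<forall>H\<in>?A. H \<le> G \<longrightarrow> H = G" by blast
  have "eventually P G" if "\<not> eventually (\<lambda>x. \<not> P x) G" for P
  proof -
    have "inf G (principal {x. P x}) \<noteq> bot"
      using that by (auto simp: trivial_limit_def eventually_inf_principal)
    moreover have "inf G (principal {x. P x}) \<le> F" using G(1) by (rule le_infI1)
    ultimately have "inf G (principal {x. P x}) = G" using max by simp
    moreover have "eventually P (inf G (principal {x. P x}))" by (simp add: eventually_inf_principal)
    ultimately show ?thesis by simp
  qed
  then show thesis using that G by blast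
qed

text \<open>The limit along an ultrafilter finer than \<open>sequentially\<close>: by compactness a
  bounded sequence has a cluster point, and along an ultrafilter it converges to it.\<close>

lemma exists_generalized_limit:
  obtains L :: "(nat \<Rightarrow> real) \<Rightarrow> real" where
    "\<forall>s t a b. Bseq s \<and> Bseq t \<longrightarrow> L (\<lambda>n. a * s n + b * t n) = a * L s + b * L t"
    "\<forall>s. Bseq s \<and> (\<forall>n. 0 \<le> s n) \<longrightarrow> 0 \<le> L s"
    "\<forall>s c. s \<longlonglongrightarrow> c \<longrightarrow> L s = c"
proof -
  obtain F :: "nat filter" where F: "F \<le> sequentially" "F \<noteq> bot"
    "\<And>P. eventually P F \<or> eventually (\<lambda>x. \<not> P x) F"
    using exists_ultrafilter[OF sequentially_bot] by metis
  have conv: "(s \<longlongrightarrow> Lim F s) F" if s: "Bseq s" for s :: "nat \<Rightarrow> real"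
  proof -
    obtain B where B: "\<And>n. \<bar>s n\<bar> \<le> B" using BseqE[OF s] by auto
    have "eventually (\<lambda>x. x \<in> {-B..B}) (filtermap s F)"
      using B by (auto simp: eventually_filtermap abs_le_iff intro!: always_eventually) (metis minus_le_iff)
    moreover have "filtermap s F \<noteq> bot" using F(2) by (simp add: filtermap_bot_iff)
    moreover have "compact {-B..B}" by simp
    ultimately obtain x where x: "inf (nhds x) (filtermap s F) \<noteq> bot"
      unfolding compact_filter by metis
    have "(s \<longlongrightarrow> x) F"
    proof (rule topological_tendstoI)
      fix S assume S: "open S" "x \<in> S"
      show "eventually (\<lambda>n. s n \<in> S) F"
      proof (rule ccontr)
        assume "\<not> ?thesis"
        then have "eventually (\<lambda>y. y \<notin> S) (filtermap s F)"
          using F(3)[of "\<lambda>n. s n \<in> S"] by (simp add: eventually_filtermap)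
        moreover have "eventually (\<lambda>y. y \<in> S) (nhds x)" using S by (rule eventually_nhds_in_open)
        ultimately have "eventually (\<lambda>_. False) (inf (nhds x) (filtermap s F))"
          unfolding eventually_inf by blast
        then show False using x by (simp add: trivial_limit_def)
      qed
    qed
    then show ?thesis using tendsto_Lim[OF F(2)] by metis
  qed
  show thesis
  proof (rule that[of "Lim F"]; intro allI impI)
    fix s t :: "nat \<Rightarrow> real" and a b assume "Bseq s \<and> Bseq t"
    then show "Lim F (\<lambda>n. a * s n + b * t n) = a * Lim F s + b * Lim F t"
      using conv by (intro tendsto_Lim F(2) tendsto_intros) auto
  next
    fix s :: "nat \<Rightarrow> real" assume "Bseq s \<and> (\<forall>n. 0 \<le> s n)"
    then show "0 \<le> Lim F s"
      using conv F(2) by (intro tendsto_lowerbound[of s "Lim F s" F]) auto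
  next
    fix s :: "nat \<Rightarrow> real" and c assume "s \<longlonglongrightarrow> c"
    then show "Lim F s = c" using tendsto_mono[OF F(1)] tendsto_Lim[OF F(2)] by blast
  qed
qed

context median_gr
begin

section \<open>Random walks towards a Roller point\<close>

text \<open>The walls that can be crossed next on the way from \<open>v\<close> to \<xi>; any set of
  them can be crossed at once.\<close>

definition front :: "'v set set \<Rightarrow> 'v \<Rightarrow> 'v set set" where
  "front \<xi> v = {h \<in> \<xi> - U v. \<forall>k\<in>\<xi> - U v. h \<subseteq> k \<longrightarrow> k = h}"

text \<open>A random walker towards \<open>\<xi>\<close> who crosses each available hyperplane with probability \<open>z\<close>
  gets stuck at \<open>v\<close> with probability \<open>weight z \<xi> x v\<close>.\<close>

definition weight :: "real \<Rightarrow> 'v set set \<Rightarrow> 'v \<Rightarrow> 'v \<Rightarrow> real" where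
  "weight z \<xi> x v = (if v \<in> ray \<xi> x then z ^ d x v * (1 - z) ^ card (front \<xi> v) else 0)"

lemma front_finite:
  assumes N: "dim_le N" and xi: "\<xi> \<in> roller adj"
  shows "finite (front \<xi> v)" "card (front \<xi> v) \<le> N"
proof -
  have "transverse h k" if "h \<in> front \<xi> v" "k \<in> front \<xi> v" "h \<noteq> k" for h k
    using that by (intro transverse_in_diff[OF xi]) (auto simp: front_def)
  moreover have "front \<xi> v \<subseteq> H" using rollerD(1)[OF xi] by (auto simp: front_def)
  ultimately show "finite (front \<xi> v)" "card (front \<xi> v) \<le> N" using dim_leD[OF N] by metis+
qed

lemma ray_up_closed:
  assumes v: "h \<in> U v - U x" and k: "k \<in> \<xi> - U x" "h \<subseteq> k" and xi: "\<xi> \<in> roller adj"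
  shows "k \<in> U v - U x"
  using assms rollerD(1)[OF xi] by (auto simp: Uv_def)

text \<open>Reversing exactly the walls of \<open>I\<close> in the orientation of \<open>x\<close>
  keeps it consistent, and only finitely many sides change. So the vertices of a ray correspond to
  the finite upward closed subsets of \<open>\<xi> - U x\<close>.\<close>

lemma ray_vertex_exists:
  assumes xi: "\<xi> \<in> roller adj" and I: "finite I" "I \<subseteq> \<xi> - U x"
    and up: "\<And>h k. h \<in> I \<Longrightarrow> k \<in> \<xi> - U x \<Longrightarrow> h \<subseteq> k \<Longrightarrow> k \<in> I"
  obtains w where "w \<in> ray \<xi> x" "U w - U x = I"
proof -
  define \<eta> where "\<eta> = {h \<in> H. h \<in> I \<or> - h \<notin> I \<and> h \<in> U x}"
  have IH: "I \<subseteq> H" using I rollerD(1)[OF xi] by blast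
  have notI: "- h \<notin> I" if "h \<in> I" for h
    using that I rollerD(2)[OF xi, of h] IH by blast
  have "\<eta> \<in> roller adj"
    unfolding roller_iff
  proof (intro conjI ballI)
    show "\<eta> \<subseteq> H" by (auto simp: \<eta>_def)
  next
    fix h assume h: "h \<in> H"
    then show "(- h \<in> \<eta>) = (h \<notin> \<eta>)"
      using notI[of h] U_compl[OF h, of x] halfspace_compl[of h] by (auto simp: \<eta>_def)
  next
    have mixed: "h \<inter> k \<noteq> {}" if h: "h \<in> I" and k: "k \<in> U x" "- k \<notin> I" for h k
    proof
      assume "h \<inter> k = {}"
      then have sub: "h \<subseteq> - k" by blast
      have kH: "k \<in> H" "- k \<in> H" using k U_sub halfspace_compl by blast+
      have "- k \<in> \<xi>" using roller_up[OF xi _ sub kH(2)] h I by blast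
      moreover have "- k \<notin> U x" using k U_compl[OF kH(1)] by blast
      ultimately show False using up[OF h _ sub] k by blast
    qed
    fix h k assume "h \<in> \<eta>" "k \<in> \<eta>"
    then consider "h \<in> I" "k \<in> I" | "h \<in> I" "k \<in> U x" "- k \<notin> I" | "k \<in> I" "h \<in> U x" "- h \<notin> I"
      | "h \<in> U x" "k \<in> U x" by (auto simp: \<eta>_def)
    then show "h \<inter> k \<noteq> {}"
    proof cases
      case 1
      then show ?thesis using rollerD(3)[OF xi] I by blast
    next
      case 2
      then show ?thesis using mixed by blast
    next
      case 3
      then show ?thesis using mixed[of k h] by blast
    qed (auto simp: Uv_def)
  qed
  moreover have diff: "\<eta> - U x = I" using I IH by (auto simp: \<eta>_def)
  ultimately obtain w where w: "\<eta> = U w" using roller_finite_diff_vertex[of \<eta> x] I(1) by metis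
  have "U x \<inter> \<xi> \<subseteq> \<eta>"
  proof
    fix h assume h: "h \<in> U x \<inter> \<xi>"
    then have "h \<in> H" "- h \<notin> \<xi>" using rollerD(1,2)[OF xi] by blast+
    then show "h \<in> \<eta>" using h I by (auto simp: \<eta>_def)
  qed
  then show thesis using that[of w] diff w by (simp add: ray_def)
qed

text \<open>The counterpart of \<open>front\<close>: the walls that can be crossed back from
  \<open>w\<close> towards \<open>x\<close>.\<close>

definition behind :: "'v \<Rightarrow> 'v \<Rightarrow> 'v set set" where
  "behind x w = {h \<in> U w - U x. \<forall>k\<in>U w - U x. k \<subseteq> h \<longrightarrow> k = h}"

lemma behind_empty_iff: "behind x w = {} \<longleftrightarrow> w = x"
proof
  assume empty: "behind x w = {}"
  have "U w - U x = {}"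
  proof (rule ccontr)
    assume "U w - U x \<noteq> {}"
    then obtain m where "m \<in> U w - U x" "\<forall>k\<in>U w - U x. k \<subseteq> m \<longrightarrow> m = k"
      using finite_has_minimal[OF finite_U_diff] by blast
    then have "m \<in> behind x w" unfolding behind_def by blast
    then show False using empty by blast
  qed
  then have "d w x = 0" unfolding card_U_diff[symmetric] by (simp only: card.empty)
  then show "w = x" by simp
qed (auto simp: behind_def)

text \<open>Adding to \<open>U v - U x\<close> a subset \<open>A\<close> of \<open>front \<xi> v\<close> is the inverse of removing from
  \<open>U w - U x\<close> a subset \<open>A\<close> of \<open>behind x w\<close>.\<close>

lemma ray_add_front:
  assumes xi: "\<xi> \<in> roller adj" and v: "v \<in> ray \<xi> x" and A: "finite A" "A \<subseteq> front \<xi> v"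
  obtains w where "w \<in> ray \<xi> x" "U w - U x = (U v - U x) \<union> A" "A \<subseteq> behind x w"
proof -
  have Av: "A \<subseteq> \<xi> - U v" using A by (auto simp: front_def)
  have Ax: "A \<inter> U x = {}" using Av v by (auto simp: ray_def)
  obtain w where w: "w \<in> ray \<xi> x" "U w - U x = (U v - U x) \<union> A"
  proof (rule ray_vertex_exists[OF xi, of "(U v - U x) \<union> A" x])
    show "finite ((U v - U x) \<union> A)" using finite_U_diff A(1) by blast
    show "(U v - U x) \<union> A \<subseteq> \<xi> - U x" using ray_diff_subset[OF xi v] Av Ax by blast
    fix h k assume h: "h \<in> (U v - U x) \<union> A" and k: "k \<in> \<xi> - U x" "h \<subseteq> k"
    show "k \<in> (U v - U x) \<union> A"
    proof (cases "h \<in> A")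
      case True
      then show ?thesis using A(2) k by (cases "k \<in> U v") (auto simp: front_def)
    next
      case False
      then show ?thesis using ray_up_closed[OF _ k xi] h by blast
    qed
  qed (use that in blast)
  have "A \<subseteq> behind x w"
  proof
    fix h assume h: "h \<in> A"
    have "k = h" if k: "k \<in> U w - U x" "k \<subseteq> h" for k
    proof (cases "k \<in> A")
      case True
      then show ?thesis using A(2) h k(2) Av by (auto simp: front_def)
    next
      case False
      then have "k \<in> U v" using k w by blast
      then have "h \<in> U v" using k(2) h Av rollerD(1)[OF xi] by (auto simp: Uv_def)
      then show ?thesis using h Av by blast
    qed
    then show "h \<in> behind x w" using h w(2) Ax by (auto simp: behind_def)
  qed
  then show thesis using that w by blast
qed

lemma ray_remove_behind:
  assumes xi: "\<xi> \<in> roller adj" and w: "w \<in> ray \<xi> x" and A: "A \<subseteq> behind x w"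
  obtains v where "v \<in> ray \<xi> x" "U w - U x = (U v - U x) \<union> A" "A \<subseteq> front \<xi> v"
proof -
  have Aw: "A \<subseteq> U w - U x" using A by (auto simp: behind_def)
  obtain v where v: "v \<in> ray \<xi> x" "U v - U x = U w - U x - A"
  proof (rule ray_vertex_exists[OF xi, of "U w - U x - A" x])
    show "finite (U w - U x - A)" using finite_U_diff by blast
    show "U w - U x - A \<subseteq> \<xi> - U x" using ray_diff_subset[OF xi w] by blast
    fix h k assume h: "h \<in> U w - U x - A" and k: "k \<in> \<xi> - U x" "h \<subseteq> k"
    have "k \<in> U w - U x" using ray_up_closed[OF _ k xi] h by blast
    moreover have "k \<notin> A" using A h k(2) by (auto simp: behind_def)
    ultimately show "k \<in> U w - U x - A" by blast
  qed (use that in blast)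
  have "A \<subseteq> front \<xi> v"
  proof
    fix h assume h: "h \<in> A"
    then have hx: "h \<in> \<xi> - U v" using Aw v(2) ray_diff_subset[OF xi w] by blast
    have "k = h" if k: "k \<in> \<xi> - U v" "h \<subseteq> k" for k
    proof -
      have "k \<notin> U x" using k v(1) by (auto simp: ray_def)
      then have "k \<in> U w - U x" using ray_up_closed[of h w x k, OF _ _ k(2) xi] k h Aw by blast
      then have "k \<in> A" using v(2) k by blast
      then show ?thesis using A h k(2) by (auto simp: behind_def)
    qed
    then show "h \<in> front \<xi> v" using hx by (auto simp: front_def)
  qed
  then show thesis using that v Aw by blast
qed

text \<open>The growth bound makes the number of vertices at distance \<open>n\<close> polynomial in
  \<open>n\<close>, against the factor \<open>z ^ n\<close>.\<close>

lemma summable_ray: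
  assumes N: "dim_le N" and xi: "\<xi> \<in> roller adj" and z: "0 < z" "z < (1::real)"
  shows "(\<lambda>v. z ^ d x v) summable_on ray \<xi> x"
proof (rule nonneg_bdd_above_summable_on)
  let ?s = "\<lambda>n. real ((N * n + 1) ^ N) * z ^ n"
  have s: "summable ?s" using summable_poly_times_geometric[OF z] .
  show "bdd_above (sum (\<lambda>v. z ^ d x v) ` {F. F \<subseteq> ray \<xi> x \<and> finite F})"
  proof (rule bdd_aboveI2)
    fix F assume "F \<in> {F. F \<subseteq> ray \<xi> x \<and> finite F}"
    then have F: "F \<subseteq> ray \<xi> x" "finite F" by auto
    define M where "M = Suc (Max (insert 0 (d x ` F)))"
    have M: "d x v < M" if "v \<in> F" for v
      unfolding M_def using F(2) that by (intro le_imp_less_Suc Max_ge) auto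
    have "(\<Sum>v\<in>F. z ^ d x v) = (\<Sum>n<M. \<Sum>v\<in>{v \<in> F. d x v = n}. z ^ d x v)"
      using F(2) M by (intro sum.group[symmetric]) auto
    also have "\<dots> \<le> (\<Sum>n<M. ?s n)"
    proof (rule sum_mono)
      fix n
      have "card {v \<in> F. d x v = n} \<le> card (ray_ball \<xi> x n)"
        using F by (intro card_mono ray_ball_growth(1)[OF N xi]) (auto simp: ray_ball_def)
      also have "\<dots> \<le> (N * n + 1) ^ N" by (rule ray_ball_growth(2)[OF N xi])
      finally have "real (card {v \<in> F. d x v = n}) \<le> real ((N * n + 1) ^ N)" by (rule of_nat_mono)
      then show "(\<Sum>v\<in>{v \<in> F. d x v = n}. z ^ d x v) \<le> ?s n"
        using z by (simp add: mult_right_mono)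
    qed
    also have "\<dots> \<le> suminf ?s" using z by (intro sum_le_suminf s) auto
    finally show "(\<Sum>v\<in>F. z ^ d x v) \<le> suminf ?s" .
  qed
qed (use z in simp)

lemma weight_bounds:
  assumes "0 < z" "z < 1"
  shows "0 \<le> weight z \<xi> x v" "v \<in> ray \<xi> x \<Longrightarrow> weight z \<xi> x v \<le> z ^ d x v"
  using assms by (auto simp: weight_def mult_left_le power_le_one)

lemma weight_summable:
  assumes N: "dim_le N" and xi: "\<xi> \<in> roller adj" and z: "0 < z" "z < 1"
  shows "weight z \<xi> x summable_on UNIV"
proof -
  have "weight z \<xi> x summable_on ray \<xi> x"
    using summable_ray[OF N xi z]
    by (rule Infinite_Sum.summable_on_comparison_test) (use weight_bounds[OF z] in auto)
  then show ?thesis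
    by (rule summable_on_cong_neutral[THEN iffD1, rotated -1]) (auto simp: weight_def)
qed

text \<open>Expand \<open>(1 - z) ^ card (front \<xi> v)\<close> over the subsets of \<open>front \<xi> v\<close> and collect the terms by
  the vertex reached: all contributions cancel except the one of \<open>x\<close>.\<close>

lemma weight_total:
  assumes N: "dim_le N" and xi: "\<xi> \<in> roller adj" and z: "0 < z" "z < 1"
  shows "infsum (weight z \<xi> x) UNIV = 1"
proof -
  define R where "R = ray \<xi> x"
  \<comment> \<open>\<open>\<Sigma>1\<close> pairs a start vertex with the walls to be added,
    \<open>\<Sigma>2\<close> a reached vertex with the walls to be removed. \<open>g\<close> and
    \<open>g'\<close> are the same summand in these two descriptions, as each added wall contributes
    one factor \<open>z\<close> and one sign.\<close>
  define \<Sigma>1 where "\<Sigma>1 = Sigma R (\<lambda>v. Pow (front \<xi> v))"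
  define \<Sigma>2 where "\<Sigma>2 = Sigma R (\<lambda>w. Pow (behind x w))"
  define g where "g p = z ^ d x (fst p) * (- z) ^ card (snd p)" for p :: "'v \<times> 'v set set"
  define g' where "g' p = (- 1) ^ card (snd p) * z ^ d x (fst p)" for p :: "'v \<times> 'v set set"
  have fin_front: "finite (front \<xi> v)" for v using front_finite[OF N xi] by blast
  have fin_behind: "finite (behind x w)" for w
    using finite_U_diff[of w x] by (rule rev_finite_subset) (auto simp: behind_def)
  have dist: "d x v = card (U v - U x)" for v by (simp add: card_U_diff d_sym)
  \<comment> \<open>Over each vertex there are at most \<open>2 ^ N\<close> subsets; absolute
    summability permits the change in the order of summation.\<close>
  have summ: "g summable_on \<Sigma>1"
  proof -
    have "(\<lambda>p. norm (g p)) summable_on \<Sigma>1"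
      unfolding \<Sigma>1_def
    proof (rule abs_summable_on_Sigma_iff[THEN iffD2], intro conjI ballI)
      show "(\<lambda>A. norm (g (v, A))) summable_on Pow (front \<xi> v)" for v
        using fin_front by (intro summable_on_finite) simp
      have "norm (infsum (\<lambda>A. norm (g (v, A))) (Pow (front \<xi> v))) \<le> 2 ^ N * z ^ d x v" for v
      proof -
        have "infsum (\<lambda>A. norm (g (v, A))) (Pow (front \<xi> v)) = (\<Sum>A\<in>Pow (front \<xi> v). norm (g (v, A)))"
          using fin_front by (intro infsum_finite) simp
        also have "\<dots> \<le> (\<Sum>A\<in>Pow (front \<xi> v). z ^ d x v)"
          using z by (intro sum_mono) (auto simp: g_def abs_mult power_abs mult_left_le power_le_one)
        also have "\<dots> = 2 ^ card (front \<xi> v) * z ^ d x v" using fin_front by (simp add: card_Pow)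
        also have "\<dots> \<le> 2 ^ N * z ^ d x v"
          using front_finite(2)[OF N xi, of v] z by (intro mult_right_mono power_increasing) auto
        finally show ?thesis by (simp add: infsum_nonneg)
      qed
      then show "(\<lambda>v. norm (infsum (\<lambda>A. norm (g (v, A))) (Pow (front \<xi> v)))) summable_on R"
        unfolding R_def
        by (intro abs_summable_on_comparison_test'[OF summable_on_cmult_right[OF summable_ray[OF N xi z]]])
    qed
    then show ?thesis by (rule abs_summable_summable)
  qed
  have inner1: "infsum (\<lambda>A. g (v, A)) (Pow (front \<xi> v)) = weight z \<xi> x v" if "v \<in> R" for v
  proof -
    have "infsum (\<lambda>A. g (v, A)) (Pow (front \<xi> v)) = (\<Sum>A\<in>Pow (front \<xi> v). g (v, A))"
      using fin_front by (intro infsum_finite) simp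
    also have "\<dots> = z ^ d x v * (\<Sum>A\<in>Pow (front \<xi> v). (- z) ^ card A)"
      by (simp add: g_def sum_distrib_left)
    also have "\<dots> = weight z \<xi> x v"
      using that fin_front by (simp add: sum_Pow_power weight_def R_def)
    finally show ?thesis .
  qed
  \<comment> \<open>The alternating sum over all subsets vanishes unless \<open>behind x w\<close>
    is empty, which happens at \<open>w = x\<close> only.\<close>
  have inner2: "infsum (\<lambda>A. g' (w, A)) (Pow (behind x w)) = (if w = x then 1 else 0)" for w
  proof -
    have "infsum (\<lambda>A. g' (w, A)) (Pow (behind x w)) = (\<Sum>A\<in>Pow (behind x w). g' (w, A))"
      using fin_behind by (intro infsum_finite) simp
    also have "\<dots> = (\<Sum>A\<in>Pow (behind x w). (- 1) ^ card A) * z ^ d x w"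
      by (simp add: g'_def sum_distrib_right)
    also have "\<dots> = 0 ^ card (behind x w) * z ^ d x w"
      using fin_behind by (simp add: sum_Pow_power)
    also have "\<dots> = (if w = x then 1 else 0)"
      using fin_behind[of w] behind_empty_iff[of x w] by (auto simp: card_eq_0_iff)
    finally show ?thesis .
  qed
  define step where "step p = (THE w. U w - U x = (U (fst p) - U x) \<union> snd p)" for p
  have step: "step (v, A) = w" if "U w - U x = (U v - U x) \<union> A" for v A w
    unfolding step_def using that by (intro the_equality) (auto intro: U_eq_if_diff_eq)
  have bij: "bij_betw (\<lambda>p. (step p, snd p)) \<Sigma>1 \<Sigma>2"
    unfolding bij_betw_def
  proof (intro conjI inj_onI equalityI subsetI)
    fix p q assume p: "p \<in> \<Sigma>1" and q: "q \<in> \<Sigma>1" and eq: "(step p, snd p) = (step q, snd q)"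
    obtain v A where pv: "p = (v, A)" "v \<in> ray \<xi> x" "A \<subseteq> front \<xi> v" using p by (auto simp: \<Sigma>1_def R_def)
    obtain u where qu: "q = (u, A)" "u \<in> ray \<xi> x" "A \<subseteq> front \<xi> u"
      using q eq pv by (auto simp: \<Sigma>1_def R_def)
    have "finite A" using pv fin_front finite_subset by blast
    obtain w where w: "U w - U x = (U v - U x) \<union> A"
      using ray_add_front[OF xi pv(2) \<open>finite A\<close> pv(3)] by metis
    obtain w' where w': "U w' - U x = (U u - U x) \<union> A"
      using ray_add_front[OF xi qu(2) \<open>finite A\<close> qu(3)] by metis
    have "w = w'" using step[OF w] step[OF w'] eq pv qu by simp
    moreover have "A \<inter> U v = {}" "A \<inter> U u = {}" using pv qu by (auto simp: front_def)
    ultimately have "U v - U x = U u - U x" using w w' by blast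
    then show "p = q" using U_eq_if_diff_eq pv qu by blast
  next
    fix q assume "q \<in> (\<lambda>p. (step p, snd p)) ` \<Sigma>1"
    then obtain v A where v: "v \<in> ray \<xi> x" "A \<subseteq> front \<xi> v" "q = (step (v, A), A)"
      by (auto simp: \<Sigma>1_def R_def)
    have "finite A" using v fin_front finite_subset by blast
    then obtain w where "w \<in> ray \<xi> x" "U w - U x = (U v - U x) \<union> A" "A \<subseteq> behind x w"
      using ray_add_front[OF xi v(1) _ v(2)] by metis
    then show "q \<in> \<Sigma>2" using v(3) step by (auto simp: \<Sigma>2_def R_def)
  next
    fix q assume "q \<in> \<Sigma>2"
    then obtain w A where w: "w \<in> ray \<xi> x" "A \<subseteq> behind x w" "q = (w, A)" by (auto simp: \<Sigma>2_def R_def)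
    obtain v where v: "v \<in> ray \<xi> x" "U w - U x = (U v - U x) \<union> A" "A \<subseteq> front \<xi> v"
      using ray_remove_behind[OF xi w(1,2)] by metis
    then have "(v, A) \<in> \<Sigma>1" "q = (step (v, A), snd (v, A))"
      using w(3) step[OF v(2)] by (auto simp: \<Sigma>1_def R_def)
    then show "q \<in> (\<lambda>p. (step p, snd p)) ` \<Sigma>1" by blast
  qed
  have gg': "g' (step p, snd p) = g p" if p: "p \<in> \<Sigma>1" for p
  proof -
    obtain v A where v: "v \<in> ray \<xi> x" "A \<subseteq> front \<xi> v" "p = (v, A)"
      using p by (auto simp: \<Sigma>1_def R_def)
    have fA: "finite A" using v fin_front finite_subset by blast
    then obtain w where w: "U w - U x = (U v - U x) \<union> A"
      using ray_add_front[OF xi v(1) _ v(2)] by metis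
    have "A \<inter> U v = {}" using v by (auto simp: front_def)
    then have "d x w = d x v + card A"
      unfolding dist w using fA finite_U_diff by (intro card_Un_disjoint) auto
    then show ?thesis
      using step[OF w] v(3) by (simp add: g_def g'_def power_add power_minus[of z])
  qed
  have summ2: "g' summable_on \<Sigma>2"
    using summ summable_on_cong[of \<Sigma>1 "\<lambda>p. g' (step p, snd p)" g] gg'
      summable_on_reindex_bij_betw[OF bij, of g'] by simp
  have "infsum (weight z \<xi> x) UNIV = infsum (weight z \<xi> x) R"
    by (rule infsum_cong_neutral) (auto simp: weight_def R_def)
  also have "\<dots> = infsum (\<lambda>v. infsum (\<lambda>A. g (v, A)) (Pow (front \<xi> v))) R"
    by (rule infsum_cong) (simp add: inner1)
  also have "\<dots> = infsum g \<Sigma>1"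
    unfolding \<Sigma>1_def by (rule infsum_Sigma_banach) (use summ in \<open>simp add: \<Sigma>1_def\<close>)
  also have "\<dots> = infsum (\<lambda>p. g' (step p, snd p)) \<Sigma>1" by (rule infsum_cong) (simp add: gg')
  also have "\<dots> = infsum g' \<Sigma>2" by (rule infsum_reindex_bij_betw[OF bij])
  also have "\<dots> = infsum (\<lambda>w. infsum (\<lambda>A. g' (w, A)) (Pow (behind x w))) R"
    unfolding \<Sigma>2_def by (rule infsum_Sigma_banach[symmetric]) (use summ2 in \<open>simp add: \<Sigma>2_def\<close>)
  also have "\<dots> = infsum (\<lambda>w. if w = x then 1 else (0::real)) R" by (simp add: inner2)
  also have "\<dots> = infsum (\<lambda>w. if w = x then 1 else (0::real)) {x}"
    by (rule infsum_cong_neutral) (auto simp: R_def ray_def)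
  finally show ?thesis by simp
qed

end

section \<open>Means on uniformly continuous functions\<close>

lemma ruc_bounded:
  assumes "ruc G f"
  obtains B where "0 \<le> B" "\<forall>x\<in>G. \<bar>f x\<bar> \<le> B"
proof -
  obtain B where "\<forall>x\<in>G. \<bar>f x\<bar> \<le> B" using assms by (auto simp: ruc_def)
  then have "\<forall>x\<in>G. \<bar>f x\<bar> \<le> max B 0" by (simp add: le_max_iff_disj)
  then show thesis by (intro that[of "max B 0"]) simp_all
qed

lemma ruc_uniform:
  assumes "ruc G f" "\<epsilon> > 0"
  obtains F where "finite F" "\<forall>x\<in>G. \<forall>v\<in>G. (\<forall>p\<in>F. v p = p) \<longrightarrow> \<bar>f (v \<circ> x) - f x\<bar> < \<epsilon>"
  using assms unfolding ruc_def by (elim conjE allE[of _ \<epsilon>]) blast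

text \<open>The shape \<open>c * 1\<close> matches linearity of means with the constant function 1;
  the bound on \<open>a\<close> lets the finite set for \<open>f\<close> serve unchanged.\<close>

lemma ruc_affine:
  assumes f: "ruc G f" and a: "\<bar>a\<bar> \<le> 1"
  shows "ruc G (\<lambda>x. c * 1 + a * f x)"
  unfolding ruc_def
proof (intro conjI allI impI)
  obtain B where B: "0 \<le> B" "\<forall>x\<in>G. \<bar>f x\<bar> \<le> B" by (rule ruc_bounded[OF f])
  have "\<bar>c * 1 + a * f x\<bar> \<le> \<bar>c\<bar> + 1 * B" if "x \<in> G" for x
    using B that a mult_mono[of "\<bar>a\<bar>" 1 "\<bar>f x\<bar>" B] abs_triangle_ineq[of c "a * f x"]
    by (auto simp: abs_mult)
  then show "\<exists>B. \<forall>x\<in>G. \<bar>c * 1 + a * f x\<bar> \<le> B" by blast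
next
  fix \<epsilon> :: real assume "\<epsilon> > 0"
  obtain F where F: "finite F" "\<forall>x\<in>G. \<forall>v\<in>G. (\<forall>p\<in>F. v p = p) \<longrightarrow> \<bar>f (v \<circ> x) - f x\<bar> < \<epsilon>"
    by (rule ruc_uniform[OF f \<open>\<epsilon> > 0\<close>])
  have "\<bar>(c * 1 + a * s) - (c * 1 + a * t)\<bar> < \<epsilon>" if "\<bar>s - t\<bar> < \<epsilon>" for s t
  proof -
    have "\<bar>(c * 1 + a * s) - (c * 1 + a * t)\<bar> = \<bar>a\<bar> * \<bar>s - t\<bar>"
      by (simp add: abs_mult[symmetric] algebra_simps)
    also have "\<dots> \<le> 1 * \<bar>s - t\<bar>" using a by (intro mult_right_mono) auto
    finally show ?thesis using that by simp
  qed
  then show "\<exists>F. finite F \<and> (\<forall>x\<in>G. \<forall>v\<in>G. (\<forall>p\<in>F. v p = p) \<longrightarrow>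
      \<bar>(c * 1 + a * f (v \<circ> x)) - (c * 1 + a * f x)\<bar> < \<epsilon>)"
    using F by blast
qed

lemma ruc_one: "ruc G (\<lambda>_. 1)"
  unfolding ruc_def by (intro conjI exI[of _ "1 :: real"] allI impI exI[of _ "{}"]) auto

definition ruc_mean :: "('v \<Rightarrow> 'v) set \<Rightarrow> ((('v \<Rightarrow> 'v) \<Rightarrow> real) \<Rightarrow> real) \<Rightarrow> bool" where
  "ruc_mean G m \<longleftrightarrow>
     (\<forall>f g a b. ruc G f \<and> ruc G g \<longrightarrow> m (\<lambda>x. a * f x + b * g x) = a * m f + b * m g) \<and>
     m (\<lambda>_. 1) = 1 \<and>
     (\<forall>f. ruc G f \<and> (\<forall>x\<in>G. 0 \<le> f x) \<longrightarrow> 0 \<le> m f)"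

lemma ruc_meanD:
  assumes "ruc_mean G m"
  shows "ruc G f \<Longrightarrow> ruc G g \<Longrightarrow> m (\<lambda>x. a * f x + b * g x) = a * m f + b * m g"
    "m (\<lambda>_. 1) = 1"
    "ruc G f \<Longrightarrow> \<forall>x\<in>G. 0 \<le> f x \<Longrightarrow> 0 \<le> m f"
  using assms by (simp_all add: ruc_mean_def)

text \<open>Positivity applied to \<open>B + f\<close> and \<open>B - f\<close>.\<close>

lemma ruc_mean_bound:
  assumes m: "ruc_mean G m" and f: "ruc G f" and B: "\<forall>x\<in>G. \<bar>f x\<bar> \<le> B"
  shows "\<bar>m f\<bar> \<le> B"
proof -
  have *: "0 \<le> B + a * m f" if a: "a = 1 \<or> a = - 1" for a
  proof -
    have "0 \<le> m (\<lambda>x. B * 1 + a * f x)"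
    proof (rule ruc_meanD(3)[OF m])
      show "ruc G (\<lambda>x. B * 1 + a * f x)" using f a by (intro ruc_affine) auto
      show "\<forall>x\<in>G. 0 \<le> B * 1 + a * f x" using B a by (auto simp: abs_le_iff)
    qed
    also have "\<dots> = B * 1 + a * m f"
      using ruc_meanD(1)[OF m ruc_one f, of B a] ruc_meanD(2)[OF m] by simp
    finally show ?thesis by simp
  qed
  show ?thesis using *[of 1] *[of "- 1"] by auto
qed

context median_gr
begin

text \<open>Conjugation by \<open>h\<close> turns an element fixing the preimages of
  \<open>F\<close> under \<open>h\<close> into one fixing \<open>F\<close>.\<close>

lemma ruc_translate:
  assumes G: "aut_subgroup adj G" and f: "ruc G f" and h: "h \<in> G"
  shows "ruc G (\<lambda>x. f (h \<circ> x))"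
  unfolding ruc_def
proof (intro conjI allI impI)
  obtain B where "0 \<le> B" "\<forall>x\<in>G. \<bar>f x\<bar> \<le> B" by (rule ruc_bounded[OF f])
  then show "\<exists>B. \<forall>x\<in>G. \<bar>f (h \<circ> x)\<bar> \<le> B" using subgroupD(3)[OF G h] by blast
next
  fix \<epsilon> :: real assume "\<epsilon> > 0"
  obtain F where F: "finite F" "\<forall>x\<in>G. \<forall>v\<in>G. (\<forall>p\<in>F. v p = p) \<longrightarrow> \<bar>f (v \<circ> x) - f x\<bar> < \<epsilon>"
    by (rule ruc_uniform[OF f \<open>\<epsilon> > 0\<close>])
  note bij = autD(1)[OF subgroupD(1)[OF G h]]
  have "\<bar>f (h \<circ> (v \<circ> x)) - f (h \<circ> x)\<bar> < \<epsilon>"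
    if x: "x \<in> G" and v: "v \<in> G" and fix_F: "\<forall>p\<in>inv h ` F. v p = p" for x v
  proof -
    let ?v = "h \<circ> v \<circ> inv h"
    have "h \<circ> (v \<circ> x) = ?v \<circ> (h \<circ> x)" using inv_cancel(2)[OF bij] by (auto simp: fun_eq_iff)
    moreover have "?v \<in> G" "h \<circ> x \<in> G" using subgroupD(3,4)[OF G] h v x by blast+
    moreover have "\<forall>p\<in>F. ?v p = p" using fix_F inv_cancel(1)[OF bij] by auto
    ultimately show ?thesis using F(2) by metis
  qed
  then show "\<exists>F. finite F \<and> (\<forall>x\<in>G. \<forall>v\<in>G. (\<forall>p\<in>F. v p = p) \<longrightarrow>
      \<bar>f (h \<circ> (v \<circ> x)) - f (h \<circ> x)\<bar> < \<epsilon>)"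
    using F(1) by (intro exI[of _ "inv h ` F"]) auto
qed

lemma finite_ball:
  assumes lf: "locally_finite adj"
  shows "finite {v. d x v \<le> r}"
proof (induction r)
  case (Suc r)
  have "{v. d x v \<le> Suc r} \<subseteq> insert x (\<Union>w\<in>{v. d x v \<le> r}. {v. adj w v})"
  proof
    fix v assume v: "v \<in> {v. d x v \<le> Suc r}"
    show "v \<in> insert x (\<Union>w\<in>{v. d x v \<le> r}. {v. adj w v})"
    proof (cases "v = x")
      case False
      then obtain w where "adj v w" "d v x = Suc (d w x)" by (rule d_step)
      then have "adj w v" "d x w \<le> r" using v adj_sym by (auto simp: d_sym)
      then show ?thesis by blast
    qed simp
  qed
  moreover have "finite (insert x (\<Union>w\<in>{v. d x v \<le> r}. {v. adj w v}))"
    using Suc lf by (auto simp: locally_finite_def)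
  ultimately show ?case by (rule finite_subset)
qed auto

text \<open>The stabiliser of \<open>v0\<close> acts on each ball around \<open>v0\<close> through a finite group; average over
  representatives of this group and let the radius tend to infinity.\<close>

lemma stabiliser_mean:
  assumes G: "aut_subgroup adj G" and lf: "locally_finite adj"
  obtains m where "ruc_mean G m"
    "\<forall>f k. ruc G f \<longrightarrow> k \<in> G \<longrightarrow> k v0 = v0 \<longrightarrow> m (\<lambda>x. f (k \<circ> x)) = m f"
proof -
  define K where "K = {k \<in> G. k v0 = v0}"
  define B where "B r = {v. d v0 v \<le> r}" for r
  define Q where "Q r = (\<lambda>k. restrict k (B r)) ` K" for r
  define rep where "rep r \<sigma> = (SOME k. k \<in> K \<and> restrict k (B r) = \<sigma>)" for r \<sigma>
  define A :: "nat \<Rightarrow> (('v \<Rightarrow> 'v) \<Rightarrow> real) \<Rightarrow> real" where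
    "A r f = (\<Sum>\<sigma>\<in>Q r. f (rep r \<sigma>)) / real (card (Q r))" for r f
  obtain L :: "(nat \<Rightarrow> real) \<Rightarrow> real" where
    L_lin: "\<forall>s t a b. Bseq s \<and> Bseq t \<longrightarrow> L (\<lambda>n. a * s n + b * t n) = a * L s + b * L t" and
    L_pos: "\<forall>s. Bseq s \<and> (\<forall>n. 0 \<le> s n) \<longrightarrow> 0 \<le> L s" and
    L_lim: "\<forall>s c. s \<longlonglongrightarrow> c \<longrightarrow> L s = c" by (rule exists_generalized_limit)
  have KG: "k \<in> G" "k \<in> aut adj" "bij k" "k v0 = v0" if "k \<in> K" for k
    using that subgroupD(1)[OF G] autD(1) by (auto simp: K_def)
  have K_comp: "k \<circ> l \<in> K" if "k \<in> K" "l \<in> K" for k l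
    using that subgroupD(3)[OF G] by (auto simp: K_def)
  have K_inv: "inv k \<in> K" if "k \<in> K" for k
    using KG[OF that] inv_cancel(2)[OF KG(3)[OF that], of v0] subgroupD(4)[OF G] by (auto simp: K_def)
  have K_ball: "k v \<in> B r" if "k \<in> K" "v \<in> B r" for k v r
    using that aut_dist[OF KG(2)[OF that(1)], of v0 v] KG(4)[OF that(1)] by (simp add: B_def)
  have rep: "rep r \<sigma> \<in> K" "restrict (rep r \<sigma>) (B r) = \<sigma>" if "\<sigma> \<in> Q r" for r \<sigma>
    using that someI_ex[of "\<lambda>k. k \<in> K \<and> restrict k (B r) = \<sigma>"] by (auto simp: Q_def rep_def)
  have finQ: "finite (Q r)" for r
  proof (rule finite_subset)
    show "Q r \<subseteq> B r \<rightarrow>\<^sub>E B r" using K_ball by (auto simp: Q_def)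
    show "finite (B r \<rightarrow>\<^sub>E B r)" using finite_ball[OF lf] by (intro finite_PiE) (auto simp: B_def)
  qed
  have "id \<in> K" using subgroupD(2)[OF G] by (simp add: K_def)
  then have cardQ: "card (Q r) > 0" for r using finQ[of r] by (auto simp: Q_def card_gt_0_iff)
  have A_bound: "\<bar>A r f\<bar> \<le> C" if f: "\<forall>x\<in>K. \<bar>f x\<bar> \<le> C" for r f C
  proof -
    have "\<bar>\<Sum>\<sigma>\<in>Q r. f (rep r \<sigma>)\<bar> \<le> (\<Sum>\<sigma>\<in>Q r. C)"
      using f rep by (intro order_trans[OF sum_abs] sum_mono) auto
    then show ?thesis using cardQ[of r] by (simp add: A_def field_simps)
  qed
  have A_Bseq: "Bseq (\<lambda>r. A r f)" if f: "ruc G f" for f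
  proof -
    obtain C where "0 \<le> C" "\<forall>x\<in>G. \<bar>f x\<bar> \<le> C" by (rule ruc_bounded[OF f])
    then have "\<bar>A r f\<bar> \<le> C" for r using KG by (intro A_bound) auto
    then show ?thesis by (intro BseqI'[of _ C]) simp
  qed
  define m where "m f = L (\<lambda>r. A r f)" for f
  have "ruc_mean G m"
    unfolding ruc_mean_def
  proof (intro conjI allI impI)
    fix f g a b assume "ruc G f \<and> ruc G g"
    moreover have "A r (\<lambda>x. a * f x + b * g x) = a * A r f + b * A r g" for r
      by (simp add: A_def sum.distrib sum_distrib_left add_divide_distrib)
    ultimately show "m (\<lambda>x. a * f x + b * g x) = a * m f + b * m g"
      using L_lin A_Bseq by (simp add: m_def)
  next
    have "A r (\<lambda>_. 1) = 1" for r using cardQ[of r] by (simp add: A_def)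
    then show "m (\<lambda>_. 1) = 1" using L_lim by (simp add: m_def)
  next
    fix f assume f: "ruc G f \<and> (\<forall>x\<in>G. 0 \<le> f x)"
    then have "0 \<le> A r f" for r
      unfolding A_def using rep KG by (intro divide_nonneg_nonneg sum_nonneg) auto
    then show "0 \<le> m f" using L_pos A_Bseq f by (simp add: m_def)
  qed
  moreover have "m (\<lambda>x. f (k \<circ> x)) = m f" if f: "ruc G f" and k: "k \<in> G" "k v0 = v0" for f k
  proof -
    have kK: "k \<in> K" using k by (simp add: K_def)
    have fk: "ruc G (\<lambda>x. f (k \<circ> x))" using ruc_translate[OF G f k(1)] .
    have "(\<lambda>r. 1 * A r (\<lambda>x. f (k \<circ> x)) + (- 1) * A r f) \<longlonglongrightarrow> 0"
    proof (rule LIMSEQ_I)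
      fix \<epsilon> :: real assume \<epsilon>: "0 < \<epsilon>"
      obtain F where F: "finite F" "\<forall>x\<in>G. \<forall>v\<in>G. (\<forall>p\<in>F. v p = p) \<longrightarrow> \<bar>f (v \<circ> x) - f x\<bar> < \<epsilon> / 2"
        using ruc_uniform[OF f, of "\<epsilon> / 2"] \<epsilon> by auto
      define r0 where "r0 = Max (insert 0 (d v0 ` F))"
      have "\<bar>A r (\<lambda>x. f (k \<circ> x)) - A r f\<bar> < \<epsilon>" if r: "r \<ge> r0" for r
      proof -
        have FB: "F \<subseteq> B r"
        proof
          fix p assume "p \<in> F"
          then have "d v0 p \<le> r0" unfolding r0_def using F(1) by (intro Max_ge) auto
          then show "p \<in> B r" using r by (simp add: B_def)
        qed
        \<comment> \<open>Left multiplication by \<open>k\<close>, as a permutation of the finite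
          group of restrictions.\<close>
        define \<pi> where "\<pi> \<sigma> = restrict (k \<circ> rep r \<sigma>) (B r)" for \<sigma>
        have \<pi>Q: "\<pi> \<sigma> \<in> Q r" if "\<sigma> \<in> Q r" for \<sigma>
          using K_comp[OF kK rep(1)[OF that]] by (auto simp: \<pi>_def Q_def)
        have "inj_on \<pi> (Q r)"
        proof (rule inj_onI)
          fix \<sigma> \<tau> assume s: "\<sigma> \<in> Q r" "\<tau> \<in> Q r" and eq: "\<pi> \<sigma> = \<pi> \<tau>"
          have "rep r \<sigma> p = rep r \<tau> p" if "p \<in> B r" for p
          proof -
            have "k (rep r \<sigma> p) = k (rep r \<tau> p)"
              using fun_cong[OF eq, of p] that by (simp add: \<pi>_def)
            then show ?thesis using bij_is_inj[OF KG(3)[OF kK]] by (simp add: inj_eq)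
          qed
          then have "restrict (rep r \<sigma>) (B r) = restrict (rep r \<tau>) (B r)" by (rule restrict_ext)
          then show "\<sigma> = \<tau>" using rep(2) s by metis
        qed
        then have bij: "bij_betw \<pi> (Q r) (Q r)"
          using finQ \<pi>Q by (intro bij_betw_imageI endo_inj_surj) auto
        \<comment> \<open>The two elements agree on the ball, so they differ by left multiplication
          with an element fixing the ball, and hence \<open>F\<close>, pointwise.\<close>
        have close: "\<bar>f (k \<circ> rep r \<sigma>) - f (rep r (\<pi> \<sigma>))\<bar> \<le> \<epsilon> / 2" if s: "\<sigma> \<in> Q r" for \<sigma>
        proof -
          let ?y = "rep r (\<pi> \<sigma>)" and ?x = "k \<circ> rep r \<sigma>"
          have yK: "?y \<in> K" and xK: "?x \<in> K" using rep(1) \<pi>Q s K_comp kK by auto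
          have "?x p = ?y p" if "p \<in> B r" for p
            using fun_cong[OF rep(2)[OF \<pi>Q[OF s]], of p] that by (simp add: \<pi>_def)
          then have agree: "?x (inv ?y p) = p" if "p \<in> B r" for p
            using that K_ball[OF K_inv[OF yK] that] inv_cancel(1)[OF KG(3)[OF yK], of p] by auto
          have "?x = (?x \<circ> inv ?y) \<circ> ?y"
            using inv_cancel(2)[OF KG(3)[OF yK]] by (auto simp: fun_eq_iff)
          moreover have "\<bar>f ((?x \<circ> inv ?y) \<circ> ?y) - f ?y\<bar> < \<epsilon> / 2"
          proof (rule F(2)[rule_format])
            show "?y \<in> G" "?x \<circ> inv ?y \<in> G" using KG(1) yK K_comp[OF xK K_inv[OF yK]] by blast+
            show "(?x \<circ> inv ?y) p = p" if "p \<in> F" for p using agree that FB by auto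
          qed
          ultimately show ?thesis by simp
        qed
        have "A r f = (\<Sum>\<sigma>\<in>Q r. f (rep r (\<pi> \<sigma>))) / real (card (Q r))"
          using sum.reindex_bij_betw[OF bij, of "\<lambda>\<sigma>. f (rep r \<sigma>)"] by (simp add: A_def)
        then have "A r (\<lambda>x. f (k \<circ> x)) - A r f =
            (\<Sum>\<sigma>\<in>Q r. f (k \<circ> rep r \<sigma>) - f (rep r (\<pi> \<sigma>))) / real (card (Q r))"
          by (simp add: A_def sum_subtractf diff_divide_distrib)
        moreover have "\<bar>\<Sum>\<sigma>\<in>Q r. f (k \<circ> rep r \<sigma>) - f (rep r (\<pi> \<sigma>))\<bar> \<le> (\<Sum>\<sigma>\<in>Q r. \<epsilon> / 2)"
          using close by (intro order_trans[OF sum_abs] sum_mono) auto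
        then have "\<bar>\<Sum>\<sigma>\<in>Q r. f (k \<circ> rep r \<sigma>) - f (rep r (\<pi> \<sigma>))\<bar> / real (card (Q r)) \<le> \<epsilon> / 2"
          using cardQ[of r] by (simp add: field_simps)
        ultimately have "\<bar>A r (\<lambda>x. f (k \<circ> x)) - A r f\<bar> \<le> \<epsilon> / 2" by simp
        then show ?thesis using \<epsilon> by linarith
      qed
      then show "\<exists>no. \<forall>r\<ge>no. norm (1 * A r (\<lambda>x. f (k \<circ> x)) + (- 1) * A r f - 0) < \<epsilon>" by auto
    qed
    then have "L (\<lambda>r. 1 * A r (\<lambda>x. f (k \<circ> x)) + (- 1) * A r f) = 0" using L_lim by blast
    moreover have "L (\<lambda>r. 1 * A r (\<lambda>x. f (k \<circ> x)) + (- 1) * A r f) = 1 * m (\<lambda>x. f (k \<circ> x)) + (- 1) * m f"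
      unfolding m_def using A_Bseq[OF f] A_Bseq[OF fk] by (intro L_lin[rule_format]) simp
    ultimately show ?thesis by simp
  qed
  ultimately show thesis using that by blast
qed

text \<open>In each orbit the stabiliser mean of one base vertex is transported by a chosen element
  \<open>c v\<close>. Invariance under the stabiliser absorbs the arbitrariness of this
  choice.\<close>

lemma equivariant_means:
  assumes G: "aut_subgroup adj G" and lf: "locally_finite adj"
  obtains M where "\<forall>v. ruc_mean G (M v)"
    "\<forall>f h v. ruc G f \<longrightarrow> h \<in> G \<longrightarrow> M v (\<lambda>x. f (h \<circ> x)) = M (h v) f"
proof -
  have "\<forall>v. \<exists>m. ruc_mean G m \<and> (\<forall>f k. ruc G f \<longrightarrow> k \<in> G \<longrightarrow> k v = v \<longrightarrow> m (\<lambda>x. f (k \<circ> x)) = m f)"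
    using stabiliser_mean[OF G lf] by metis
  then obtain m0 where m0: "\<And>v. ruc_mean G (m0 v)"
    "\<And>v f k. ruc G f \<Longrightarrow> k \<in> G \<Longrightarrow> k v = v \<Longrightarrow> m0 v (\<lambda>x. f (k \<circ> x)) = m0 v f" by metis
  define orb where "orb v = (\<lambda>g. g v) ` G" for v
  define base where "base v = (SOME u. u \<in> orb v)" for v
  define c where "c v = (SOME g. g \<in> G \<and> g (base v) = v)" for v
  have c: "c v \<in> G" "c v (base v) = v" for v
  proof -
    have "id v \<in> orb v" unfolding orb_def using subgroupD(2)[OF G] by (rule imageI)
    then have "v \<in> orb v" by simp
    then have "base v \<in> orb v" unfolding base_def by (rule someI)
    then obtain g where g: "g \<in> G" "base v = g v" by (auto simp: orb_def)
    then have "inv g \<in> G \<and> inv g (base v) = v"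
      using subgroupD(4)[OF G g(1)] inv_cancel(2)[OF autD(1)[OF subgroupD(1)[OF G g(1)]]] by simp
    then have "c v \<in> G \<and> c v (base v) = v" unfolding c_def
      by (rule someI[of "\<lambda>g. g \<in> G \<and> g (base v) = v"])
    then show "c v \<in> G" "c v (base v) = v" by auto
  qed
  have base_eq: "base (h v) = base v" if h: "h \<in> G" for h v
  proof -
    have "orb (h v) \<subseteq> orb v" if "h \<in> G" for h v
    proof
      fix u assume "u \<in> orb (h v)"
      then obtain g where g: "g \<in> G" "u = (g \<circ> h) v" by (auto simp: orb_def)
      show "u \<in> orb v" unfolding orb_def g(2) using subgroupD(3)[OF G g(1) that] by (rule imageI)
    qed
    from this[OF h, of v] this[OF subgroupD(4)[OF G h], of "h v"] have "orb (h v) = orb v"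
      using inv_cancel(2)[OF autD(1)[OF subgroupD(1)[OF G h]]] by auto
    then show ?thesis by (simp add: base_def)
  qed
  define M where "M v f = m0 (base v) (\<lambda>x. f (c v \<circ> x))" for v f
  have "ruc_mean G (M v)" for v
    unfolding ruc_mean_def
  proof (intro conjI allI impI)
    fix f g a b assume "ruc G f \<and> ruc G g"
    then show "M v (\<lambda>x. a * f x + b * g x) = a * M v f + b * M v g"
      unfolding M_def using ruc_translate[OF G _ c(1)] by (intro ruc_meanD(1)[OF m0(1)]) auto
  next
    show "M v (\<lambda>_. 1) = 1" using ruc_meanD(2)[OF m0(1)] by (simp add: M_def)
  next
    fix f assume "ruc G f \<and> (\<forall>x\<in>G. 0 \<le> f x)"
    then show "0 \<le> M v f"
      unfolding M_def using ruc_translate[OF G _ c(1)] subgroupD(3)[OF G c(1)]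
      by (intro ruc_meanD(3)[OF m0(1)]) auto
  qed
  moreover have "M v (\<lambda>x. f (h \<circ> x)) = M (h v) f" if f: "ruc G f" and h: "h \<in> G" for f h v
  proof -
    \<comment> \<open>\<open>?k\<close> compares the two chosen ways from the base vertex to
      \<open>h v\<close> and fixes the base vertex.\<close>
    let ?k = "inv (c (h v)) \<circ> (h \<circ> c v)"
    note bij = autD(1)[OF subgroupD(1)[OF G c(1)]]
    have k: "?k \<in> G" using subgroupD(3,4)[OF G] c(1) h by blast
    have "inv (c (h v)) (h v) = base v"
      using inv_cancel(2)[OF bij, of "h v" "base (h v)"] c(2)[of "h v"] base_eq[OF h, of v] by simp
    then have kv: "?k (base v) = base v" using c(2) by simp
    have eq: "c (h v) \<circ> (?k \<circ> x) = h \<circ> (c v \<circ> x)" for x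
      using inv_cancel(1)[OF bij] by (auto simp: fun_eq_iff)
    have "M v (\<lambda>x. f (h \<circ> x)) = m0 (base v) (\<lambda>x. f (c (h v) \<circ> (?k \<circ> x)))"
      unfolding M_def eq ..
    also have "\<dots> = m0 (base v) (\<lambda>x. f (c (h v) \<circ> x))"
      by (rule m0(2)[OF ruc_translate[OF G f c(1)] k kv])
    also have "\<dots> = M (h v) f" by (simp only: M_def base_eq[OF h])
    finally show ?thesis .
  qed
  ultimately show thesis using that by blast
qed

section \<open>Asymptotic invariance of the weights\<close>

text \<open>\<open>y\<close> is one step closer to \<xi>: its ray lies in the ray of
  \<open>x\<close>, and each vertex there is one step farther from \<open>x\<close> than from
  \<open>y\<close>. So equality holds on the ray of \<open>y\<close>, and the left side vanishes
  elsewhere.\<close>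

lemma weight_step:
  assumes xi: "\<xi> \<in> roller adj" and xy: "adj x y" "side y x \<in> \<xi>" and z: "0 < z" "z < 1"
  shows "z * weight z \<xi> y v \<le> weight z \<xi> x v"
proof (cases "v \<in> ray \<xi> y")
  case True
  have yx: "adj y x" using xy(1) adj_sym by blast
  have "side y x \<in> U y \<inter> \<xi>" using side_halfspace[OF yx] side_refl[OF yx] xy(2) by (simp add: Uv_def)
  then have "v \<in> side y x" using True by (auto simp: ray_def Uv_def)
  then have "d x v = Suc (d y v)" using sideD[OF yx] by (simp add: d_sym)
  moreover have "U x \<inter> \<xi> \<subseteq> U y \<inter> \<xi>"
  proof
    fix h assume h: "h \<in> U x \<inter> \<xi>"
    have "h \<in> U y"
    proof (rule ccontr)
      assume "h \<notin> U y"
      then have "- h = side y x"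
        using h yx halfspace_compl by (intro halfspace_eq_side) (auto simp: Uv_def)
      then have "- h \<in> \<xi>" using xy(2) by simp
      moreover have "h \<in> H" using h U_sub by blast
      ultimately show False using h rollerD(2)[OF xi, of h] by blast
    qed
    then show "h \<in> U y \<inter> \<xi>" using h by blast
  qed
  then have "v \<in> ray \<xi> x" using True by (auto simp: ray_def)
  ultimately show ?thesis using True by (simp add: weight_def)
next
  case False
  then have "weight z \<xi> y v = 0" by (simp add: weight_def)
  then show ?thesis using weight_bounds(1)[OF z, of \<xi> x v] by simp
qed

lemma weighted_sum_summable:
  assumes N: "dim_le N" and xi: "\<xi> \<in> roller adj" and z: "0 < z" "z < 1" and F: "\<forall>v. \<bar>F v\<bar> \<le> C"
  shows "(\<lambda>v. weight z \<xi> x v * F v) summable_on UNIV"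
proof -
  have "(\<lambda>v. norm (weight z \<xi> x v * F v)) summable_on UNIV"
  proof (rule abs_summable_on_comparison_test')
    show "(\<lambda>v. weight z \<xi> x v * C) summable_on UNIV"
      using weight_summable[OF N xi z] by (rule summable_on_cmult_left)
    show "norm (weight z \<xi> x v * F v) \<le> weight z \<xi> x v * C" for v
      using weight_bounds(1)[OF z, of \<xi> x v] F[rule_format, of v] by (simp add: abs_mult mult_left_mono)
  qed
  then show ?thesis by (rule abs_summable_summable)
qed

definition wavg :: "real \<Rightarrow> 'v set set \<Rightarrow> 'v \<Rightarrow> ('v \<Rightarrow> real) \<Rightarrow> real" where
  "wavg z \<xi> x F = infsum (\<lambda>v. weight z \<xi> x v * F v) UNIV"

lemma wavg_linear:
  assumes "dim_le N" "\<xi> \<in> roller adj" "0 < z" "z < 1" "\<forall>v. \<bar>F v\<bar> \<le> C" "\<forall>v. \<bar>F' v\<bar> \<le> C'"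
  shows "wavg z \<xi> x (\<lambda>v. a * F v + b * F' v) = a * wavg z \<xi> x F + b * wavg z \<xi> x F'"
proof -
  note s = weighted_sum_summable[OF assms(1-5)] weighted_sum_summable[OF assms(1-4,6)]
  have "wavg z \<xi> x (\<lambda>v. a * F v + b * F' v) =
      infsum (\<lambda>v. a * (weight z \<xi> x v * F v) + b * (weight z \<xi> x v * F' v)) UNIV"
    by (simp add: wavg_def algebra_simps)
  also have "\<dots> = infsum (\<lambda>v. a * (weight z \<xi> x v * F v)) UNIV + infsum (\<lambda>v. b * (weight z \<xi> x v * F' v)) UNIV"
    by (intro infsum_add summable_on_cmult_right s)
  finally show ?thesis by (simp add: wavg_def infsum_cmult_right')
qed

lemma wavg_one:
  assumes "dim_le N" "\<xi> \<in> roller adj" "0 < z" "z < 1"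
  shows "wavg z \<xi> x (\<lambda>_. 1) = 1"
  using weight_total[OF assms] by (simp add: wavg_def)

lemma wavg_nonneg:
  assumes "0 < z" "z < 1" "\<And>v. 0 \<le> F v"
  shows "0 \<le> wavg z \<xi> x F"
  unfolding wavg_def using weight_bounds(1)[OF assms(1,2)] assms(3) by (intro infsum_nonneg) simp

lemma wavg_bound:
  assumes "dim_le N" "\<xi> \<in> roller adj" "0 < z" "z < 1" and F: "\<forall>v. \<bar>F v\<bar> \<le> C"
  shows "\<bar>wavg z \<xi> x F\<bar> \<le> C"
proof -
  have "0 \<le> C + a * wavg z \<xi> x F" if "a = 1 \<or> a = - 1" for a
  proof -
    have "0 \<le> wavg z \<xi> x (\<lambda>v. C * 1 + a * F v)"
    proof (rule wavg_nonneg[OF assms(3,4)])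
      show "0 \<le> C * 1 + a * F v" for v using F[rule_format, of v] that by auto
    qed
    also have "\<dots> = C * wavg z \<xi> x (\<lambda>_. 1) + a * wavg z \<xi> x F"
      by (rule wavg_linear[OF assms(1-4), of _ 1 _ C]) (use F in auto)
    finally show ?thesis using wavg_one[OF assms(1-4)] by simp
  qed
  from this[of 1] this[of "- 1"] show ?thesis by auto
qed

text \<open>If \<open>y\<close> is closer to \<xi>, the absolute difference of the weights is at
  most the weight from \<open>x\<close> minus \<open>z\<close> times the weight from
  \<open>y\<close>, which is nonnegative, plus \<open>1 - z\<close> times the weight from
  \<open>y\<close>. Both parts have total mass \<open>1 - z\<close>.\<close>

lemma wavg_adj:
  assumes N: "dim_le N" and xi: "\<xi> \<in> roller adj" and z: "0 < z" "z < 1" and F: "\<forall>v. \<bar>F v\<bar> \<le> C"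
    and xy: "adj x y"
  shows "\<bar>wavg z \<xi> x F - wavg z \<xi> y F\<bar> \<le> 2 * (1 - z) * C"
proof -
  have *: "\<bar>wavg z \<xi> x F - wavg z \<xi> y F\<bar> \<le> 2 * (1 - z) * C" if xy: "adj x y" "side y x \<in> \<xi>" for x y
  proof -
    let ?w = "weight z \<xi>"
    let ?D = "\<lambda>v. (?w x v + (1 - 2 * z) * ?w y v) * C"
    have C: "0 \<le> C" using F[rule_format, of x] by linarith
    note sx = weight_summable[OF N xi z, of x] and sy = weight_summable[OF N xi z, of y]
    have sD: "?D summable_on UNIV"
      by (intro summable_on_cmult_left summable_on_add summable_on_cmult_right sx sy)
    have D: "norm (?w x v * F v - ?w y v * F v) \<le> ?D v" for v
    proof -
      have "\<bar>?w x v - ?w y v\<bar> \<le> ?w x v + (1 - 2 * z) * ?w y v"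
      proof -
        have "z * ?w y v \<le> ?w y v"
          using weight_bounds(1)[OF z, of \<xi> y v] z by (simp add: mult_left_le_one_le)
        then show ?thesis
          using weight_step[OF xi xy z, of v] by (simp add: abs_le_iff algebra_simps)
      qed
      then have "\<bar>?w x v - ?w y v\<bar> * \<bar>F v\<bar> \<le> ?D v"
        using F[rule_format, of v] by (intro mult_mono) auto
      then show ?thesis by (simp add: abs_mult[symmetric] left_diff_distrib)
    qed
    have summ: "(\<lambda>v. norm (?w x v * F v - ?w y v * F v)) summable_on UNIV"
      by (rule abs_summable_on_comparison_test'[OF sD D])
    have sFx: "(\<lambda>v. ?w x v * F v) summable_on UNIV" and sFy: "(\<lambda>v. - (?w y v * F v)) summable_on UNIV"
      using weighted_sum_summable[OF N xi z F] by (simp_all only: summable_on_uminus)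
    have "wavg z \<xi> x F - wavg z \<xi> y F = infsum (\<lambda>v. ?w x v * F v + - (?w y v * F v)) UNIV"
      unfolding wavg_def infsum_add[OF sFx sFy] by (simp add: infsum_uminus)
    then have "\<bar>wavg z \<xi> x F - wavg z \<xi> y F\<bar> \<le> infsum (\<lambda>v. norm (?w x v * F v - ?w y v * F v)) UNIV"
      using norm_infsum_bound[OF summ] by simp
    also have "\<dots> \<le> infsum ?D UNIV" by (rule infsum_mono[OF summ sD D])
    also have "\<dots> = (infsum (?w x) UNIV + (1 - 2 * z) * infsum (?w y) UNIV) * C"
      by (simp only: infsum_cmult_left' infsum_cmult_right' infsum_add[OF sx summable_on_cmult_right[OF sy]])
    also have "\<dots> = 2 * (1 - z) * C" by (simp add: weight_total[OF N xi z])
    finally show ?thesis .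
  qed
  have "side y x \<in> \<xi> \<or> side x y \<in> \<xi>"
    using side_halfspace[OF xy] side_compl[OF xy] rollerD(2)[OF xi, of "side x y"] by metis
  then show ?thesis
    using *[OF xy] *[of y x] xy adj_sym by (metis abs_minus_commute)
qed

lemma wavg_dist:
  assumes N: "dim_le N" and xi: "\<xi> \<in> roller adj" and z: "0 < z" "z < 1" and F: "\<forall>v. \<bar>F v\<bar> \<le> C"
  shows "\<bar>wavg z \<xi> x F - wavg z \<xi> y F\<bar> \<le> 2 * (1 - z) * C * real (d x y)"
proof (induction "d x y" arbitrary: x)
  case 0
  then show ?case by simp
next
  case (Suc n)
  then have "x \<noteq> y" by auto
  then obtain x' where x': "adj x x'" "d x y = Suc (d x' y)" by (rule d_step)
  then have "\<bar>wavg z \<xi> x' F - wavg z \<xi> y F\<bar> \<le> 2 * (1 - z) * C * real (d x' y)"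
    using Suc by simp
  moreover have "2 * (1 - z) * C * real (d x y) = 2 * (1 - z) * C + 2 * (1 - z) * C * real (d x' y)"
    using x'(2) by (simp add: distrib_left)
  ultimately show ?case using wavg_adj[OF N xi z F x'(1)] by linarith
qed

lemma front_ract:
  assumes g: "g \<in> aut adj"
  shows "front (ract g \<xi>) (g v) = (\<lambda>h. g ` h) ` front \<xi> v"
proof -
  have diff: "ract g \<xi> - U (g v) = (\<lambda>h. g ` h) ` (\<xi> - U v)"
  proof -
    have "inj (\<lambda>h. g ` h)"
      using bij_is_inj[OF autD(1)[OF g]] by (simp add: inj_on_def inj_image_eq_iff)
    then show ?thesis unfolding ract_U[OF g, symmetric] ract_def by (rule image_set_diff[symmetric])
  qed
  have eq: "g ` h = g ` k \<longleftrightarrow> h = k" for h k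
    using bij_is_inj[OF autD(1)[OF g]] by (rule inj_image_eq_iff)
  have *: "{h \<in> (\<lambda>h. g ` h) ` D. \<forall>k\<in>(\<lambda>h. g ` h) ` D. h \<subseteq> k \<longrightarrow> k = h} =
      (\<lambda>h. g ` h) ` {h \<in> D. \<forall>k\<in>D. h \<subseteq> k \<longrightarrow> k = h}" for D
  proof -
    have "(\<forall>k\<in>(\<lambda>h. g ` h) ` D. g ` h \<subseteq> k \<longrightarrow> k = g ` h) \<longleftrightarrow> (\<forall>k\<in>D. h \<subseteq> k \<longrightarrow> k = h)" for h
      by (simp add: aut_image_subset_iff[OF g] eq)
    then show ?thesis by (simp only: Compr_image_eq)
  qed
  show ?thesis unfolding front_def diff by (rule *)
qed

lemma weight_ract:
  assumes g: "g \<in> aut adj"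
  shows "weight z (ract g \<xi>) (g x) (g v) = weight z \<xi> x v"
proof -
  have "inj_on (\<lambda>h. g ` h) (front \<xi> v)"
    using bij_is_inj[OF autD(1)[OF g]] by (simp add: inj_on_def inj_image_eq_iff)
  then have "card (front (ract g \<xi>) (g v)) = card (front \<xi> v)"
    unfolding front_ract[OF g] by (rule card_image)
  then show ?thesis by (simp add: weight_def ract_ray[OF g] aut_dist[OF g])
qed

lemma wavg_ract:
  assumes g: "g \<in> aut adj"
  shows "wavg z \<xi> x (\<lambda>v. F (g v)) = wavg z (ract g \<xi>) (g x) F"
proof -
  have "wavg z \<xi> x (\<lambda>v. F (g v)) = infsum (\<lambda>v. weight z (ract g \<xi>) (g x) (g v) * F (g v)) UNIV"
    by (simp add: wavg_def weight_ract[OF g])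
  also have "\<dots> = wavg z (ract g \<xi>) (g x) F"
    unfolding wavg_def by (rule infsum_reindex_bij_betw[of g]) (use autD(1)[OF g] in simp)
  finally show ?thesis .
qed

text \<open>Since \<open>h\<close> permutes the orbit, averaging over it leaves only the base point
  to be moved, from \<open>x0\<close> to \<open>h x0\<close>. The cost is proportional to
  \<open>1 - z\<close> and disappears in the generalized limit.\<close>

lemma finite_orbit_amenable:
  assumes G: "aut_subgroup adj G" and fd: "finite_dim adj" and lf: "locally_finite adj"
    and xi: "\<xi> \<in> roller adj" and fin: "finite ((\<lambda>g. ract g \<xi>) ` G)"
  shows "amenable_perm_group G"
proof -
  let ?O = "(\<lambda>g. ract g \<xi>) ` G"
  obtain N where N: "dim_le N" by (rule finite_dimE[OF fd])
  obtain M where M: "\<forall>v. ruc_mean G (M v)"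
    "\<forall>f h v. ruc G f \<longrightarrow> h \<in> G \<longrightarrow> M v (\<lambda>x. f (h \<circ> x)) = M (h v) f"
    by (rule equivariant_means[OF G lf])
  obtain L :: "(nat \<Rightarrow> real) \<Rightarrow> real" where
    L_lin: "\<forall>s t a b. Bseq s \<and> Bseq t \<longrightarrow> L (\<lambda>n. a * s n + b * t n) = a * L s + b * L t" and
    L_pos: "\<forall>s. Bseq s \<and> (\<forall>n. 0 \<le> s n) \<longrightarrow> 0 \<le> L s" and
    L_lim: "\<forall>s c. s \<longlonglongrightarrow> c \<longrightarrow> L s = c" by (rule exists_generalized_limit)
  fix x0 :: 'v
  \<comment> \<open>A sequence tending to 1; the shift by 2 keeps \<open>z 0\<close>
    positive.\<close>
  define z where "z n = 1 - 1 / (real n + 2)" for n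
  have z: "0 < z n" "z n < 1" for n by (auto simp: z_def field_simps)
  define A where "A n x F = (\<Sum>\<zeta>\<in>?O. wavg (z n) \<zeta> x F) / real (card ?O)" for n x F
  have card0: "card ?O > 0" using fin subgroupD(2)[OF G] by (auto simp: card_gt_0_iff)
  have O: "\<zeta> \<in> roller adj" if "\<zeta> \<in> ?O" for \<zeta>
    using that ract_roller xi subgroupD(1)[OF G] by auto
  have avg_bound: "\<bar>(\<Sum>\<zeta>\<in>?O. t \<zeta>) / real (card ?O)\<bar> \<le> C" if "\<And>\<zeta>. \<zeta> \<in> ?O \<Longrightarrow> \<bar>t \<zeta>\<bar> \<le> C" for t C
  proof -
    have "\<bar>\<Sum>\<zeta>\<in>?O. t \<zeta>\<bar> \<le> (\<Sum>\<zeta>\<in>?O. C)"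
      using that by (intro order_trans[OF sum_abs] sum_mono) auto
    then show ?thesis using card0 by (simp add: field_simps)
  qed
  have M_bounded: "\<exists>C. \<forall>v. \<bar>M v f\<bar> \<le> C" if f: "ruc G f" for f
  proof -
    obtain C where "0 \<le> C" "\<forall>x\<in>G. \<bar>f x\<bar> \<le> C" by (rule ruc_bounded[OF f])
    then show ?thesis using ruc_mean_bound[OF M(1)[rule_format] f] by blast
  qed
  have A_Bseq: "Bseq (\<lambda>n. A n x (\<lambda>v. M v f))" if f: "ruc G f" for f x
  proof -
    obtain C where C: "\<forall>v. \<bar>M v f\<bar> \<le> C" using M_bounded[OF f] by blast
    have "\<bar>A n x (\<lambda>v. M v f)\<bar> \<le> C" for n
      unfolding A_def by (rule avg_bound) (rule wavg_bound[OF N O z C])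
    then show ?thesis by (intro BseqI'[of _ C]) simp
  qed
  define m where "m f = L (\<lambda>n. A n x0 (\<lambda>v. M v f))" for f
  have lin: "m (\<lambda>x. a * f x + b * g x) = a * m f + b * m g" if fg: "ruc G f" "ruc G g" for f g a b
  proof -
    obtain C where C: "\<forall>v. \<bar>M v f\<bar> \<le> C" using M_bounded[OF fg(1)] by blast
    obtain C' where C': "\<forall>v. \<bar>M v g\<bar> \<le> C'" using M_bounded[OF fg(2)] by blast
    have "A n x0 (\<lambda>v. M v (\<lambda>x. a * f x + b * g x)) = a * A n x0 (\<lambda>v. M v f) + b * A n x0 (\<lambda>v. M v g)" for n
    proof -
      have "(\<Sum>\<zeta>\<in>?O. wavg (z n) \<zeta> x0 (\<lambda>v. M v (\<lambda>x. a * f x + b * g x))) =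
          (\<Sum>\<zeta>\<in>?O. a * wavg (z n) \<zeta> x0 (\<lambda>v. M v f) + b * wavg (z n) \<zeta> x0 (\<lambda>v. M v g))"
        unfolding ruc_meanD(1)[OF M(1)[rule_format] fg]
        by (rule sum.cong[OF refl], rule wavg_linear[OF N O z C C'])
      then show ?thesis by (simp add: A_def sum.distrib sum_distrib_left add_divide_distrib)
    qed
    then show ?thesis using L_lin A_Bseq fg by (simp add: m_def)
  qed
  have one: "m (\<lambda>_. 1) = 1"
  proof -
    have "A n x0 (\<lambda>v. M v (\<lambda>_. 1)) = 1" for n
      unfolding A_def ruc_meanD(2)[OF M(1)[rule_format]] using card0 by (simp add: wavg_one[OF N O z])
    then show ?thesis using L_lim by (simp add: m_def)
  qed
  have pos: "0 \<le> m f" if f: "ruc G f" "\<forall>x\<in>G. 0 \<le> f x" for f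
  proof -
    have "0 \<le> A n x0 (\<lambda>v. M v f)" for n
      unfolding A_def using ruc_meanD(3)[OF M(1)[rule_format] f]
      by (intro divide_nonneg_nonneg sum_nonneg wavg_nonneg z) auto
    then show ?thesis using L_pos A_Bseq f(1) by (simp add: m_def)
  qed
  have inv: "m (\<lambda>x. f (h \<circ> x)) = m f" if f: "ruc G f" and h: "h \<in> G" for f h
  proof -
    have ha: "h \<in> aut adj" using subgroupD(1)[OF G h] .
    obtain C where C: "\<forall>v. \<bar>M v f\<bar> \<le> C" using M_bounded[OF f] by blast
    have C0: "0 \<le> C" using C[rule_format, of x0] by linarith
    have fh: "ruc G (\<lambda>x. f (h \<circ> x))" using ruc_translate[OF G f h] .
    have shift: "A n x0 (\<lambda>v. M v (\<lambda>x. f (h \<circ> x))) = A n (h x0) (\<lambda>v. M v f)" for n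
    proof -
      have "(\<Sum>\<zeta>\<in>?O. wavg (z n) \<zeta> x0 (\<lambda>v. M v (\<lambda>x. f (h \<circ> x)))) =
          (\<Sum>\<zeta>\<in>?O. wavg (z n) (ract h \<zeta>) (h x0) (\<lambda>v. M v f))"
        using M(2) f h wavg_ract[OF ha, of "z n" _ x0 "\<lambda>v. M v f"] by simp
      also have "\<dots> = (\<Sum>\<zeta>\<in>?O. wavg (z n) \<zeta> (h x0) (\<lambda>v. M v f))"
        by (rule sum.reindex_bij_betw[OF ract_orbit_bij[OF G h]])
      finally show ?thesis by (simp add: A_def)
    qed
    have "(\<lambda>n. 1 * A n (h x0) (\<lambda>v. M v f) + (- 1) * A n x0 (\<lambda>v. M v f)) \<longlonglongrightarrow> 0"
    proof (rule Lim_null_comparison)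
      let ?b = "\<lambda>n. 2 * (1 - z n) * C * real (d (h x0) x0)"
      have "\<bar>A n (h x0) (\<lambda>v. M v f) - A n x0 (\<lambda>v. M v f)\<bar> \<le> ?b n" for n
      proof -
        have "A n (h x0) (\<lambda>v. M v f) - A n x0 (\<lambda>v. M v f) =
            (\<Sum>\<zeta>\<in>?O. wavg (z n) \<zeta> (h x0) (\<lambda>v. M v f) - wavg (z n) \<zeta> x0 (\<lambda>v. M v f)) / real (card ?O)"
          by (simp add: A_def sum_subtractf diff_divide_distrib)
        then show ?thesis
          using avg_bound[of "\<lambda>\<zeta>. wavg (z n) \<zeta> (h x0) (\<lambda>v. M v f) - wavg (z n) \<zeta> x0 (\<lambda>v. M v f)"]
            wavg_dist[OF N O z C, of _ n "h x0" x0] by simp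
      qed
      then show "eventually (\<lambda>n. norm (1 * A n (h x0) (\<lambda>v. M v f) + (- 1) * A n x0 (\<lambda>v. M v f)) \<le> ?b n) sequentially"
        by simp
      have "(\<lambda>n. 1 - z n) \<longlonglongrightarrow> 0" unfolding z_def by real_asymp
      then have "(\<lambda>n. 2 * (1 - z n) * C * real (d (h x0) x0)) \<longlonglongrightarrow> 2 * 0 * C * real (d (h x0) x0)"
        by (intro tendsto_intros)
      then show "?b \<longlonglongrightarrow> 0" by simp
    qed
    then have "L (\<lambda>n. 1 * A n (h x0) (\<lambda>v. M v f) + (- 1) * A n x0 (\<lambda>v. M v f)) = 0"
      using L_lim by blast
    moreover have "L (\<lambda>n. 1 * A n (h x0) (\<lambda>v. M v f) + (- 1) * A n x0 (\<lambda>v. M v f)) =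
        1 * L (\<lambda>n. A n (h x0) (\<lambda>v. M v f)) + (- 1) * m f"
      unfolding m_def using A_Bseq[OF f] by (intro L_lin[rule_format]) simp
    moreover have "m (\<lambda>x. f (h \<circ> x)) = L (\<lambda>n. A n (h x0) (\<lambda>v. M v f))"
      by (simp only: m_def shift)
    ultimately show ?thesis by simp
  qed
  show ?thesis
    unfolding amenable_perm_group_def using lin one pos inv by (intro exI[of _ m]) blast
qed

text \<open>The finite orbit has to be one of the closure, so the invariance of the interval is
  transferred to the closure beforehand.\<close>

lemma preserves_interval_amenable_closure:
  assumes G: "aut_subgroup adj \<Gamma>" and fd: "finite_dim adj" and lf: "locally_finite adj"
    and pres: "preserves_interval adj \<Gamma>"
  shows "amenable_perm_group (aut_closure adj \<Gamma>)"
proof -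
  note GC = aut_closure_subgroup[OF G]
  obtain \<xi> where "\<xi> \<in> roller adj" "finite ((\<lambda>g. ract g \<xi>) ` aut_closure adj \<Gamma>)"
    by (rule preserves_interval_finite_orbit[OF GC fd aut_closure_preserves_interval[OF G pres]])
  then show ?thesis by (rule finite_orbit_amenable[OF GC fd lf])
qed

end

theorem theorem1:
  fixes adj :: "'v \<Rightarrow> 'v \<Rightarrow> bool" and \<Gamma> :: "('v \<Rightarrow> 'v) set"
  assumes "median_graph adj"
    and "finite_dim adj"
    and "countable (UNIV :: 'v set)"
    and "aut_subgroup adj \<Gamma>"
  shows "(\<not> preserves_interval adj \<Gamma> \<longleftrightarrow> roller_nonelementary adj \<Gamma>)
       \<and> (roller_nonelementary adj \<Gamma> \<longleftrightarrow> has_free_nonabelian_free_action \<Gamma>)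
       \<and> (\<not> preserves_interval adj \<Gamma> \<longrightarrow> \<not> amenable_perm_group (aut_closure adj \<Gamma>))
       \<and> (locally_finite adj \<longrightarrow>
            (\<not> amenable_perm_group (aut_closure adj \<Gamma>) \<longrightarrow> \<not> preserves_interval adj \<Gamma>))"
proof -
  interpret median_gr adj using assms(1) by unfold_locales
  note G = assms(4) and fd = assms(2)
  have "\<not> preserves_interval adj \<Gamma> \<longleftrightarrow> roller_nonelementary adj \<Gamma>"
    unfolding roller_nonelementary_def
    using finite_orbit_preserves_interval[OF G] preserves_interval_finite_orbit[OF G fd] by metis
  moreover have "\<not> preserves_interval adj \<Gamma> \<longrightarrow> has_free_nonabelian_free_action \<Gamma>"
    using free_action_if_no_interval[OF G fd] by blast
  moreover have "has_free_nonabelian_free_action \<Gamma> \<longrightarrow> roller_nonelementary adj \<Gamma>"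
    unfolding roller_nonelementary_def using free_action_infinite_orbits[OF G fd] by blast
  moreover have "\<not> preserves_interval adj \<Gamma> \<longrightarrow> \<not> amenable_perm_group (aut_closure adj \<Gamma>)"
    using amenable_closure_preserves_interval[OF G] by blast
  moreover have "preserves_interval adj \<Gamma> \<longrightarrow> amenable_perm_group (aut_closure adj \<Gamma>)"
    if "locally_finite adj"
    using preserves_interval_amenable_closure[OF G fd that] by blast
  ultimately show ?thesis by blast
qed

end
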